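(* Let $k,n\ge3$ and $g\ge1$. Let $G$ be a group, and let $\Phi_G:B_k(\widehat\Sigma_{g,n})\to G$ be a homomorphism. (i) The following conditions are equivalent: (a) $\Phi_G$ factors through $\Phi_k:B_k(\widehat\Sigma_{g,n})\to G_k(\widehat\Sigma_g)$; (b) the restriction of $\Phi_G$ to $B_k(\mathbb D_n)$ (i.e. $\Phi_G\circ\iota_k$) factors through $p_k:B_k(\mathbb D_n)\to G_k$; (c) there exist $\sigma,\zeta\in G$ such that $\Phi_G(S)=\{\sigma\}$ and $\Phi_G(Z)=\{\zeta\}$. (ii) Let $\Phi_{G,2}:G_k\to G$ be a homomorphism such that $\Phi_{G,2}\circ p_k$ is the restriction of $\Phi_G$ to $B_k(\mathbb D_n)$. Then there exists a homomorphism $\Phi_{G,3}:G_k(\widehat\Sigma_g)\to G$ such that $\Phi_{G,3}\circ\Phi_k=\Phi_G$. Further, $\Phi_{G,3}$ is injective if and only if $\Phi_{G,2}$ is injective.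
   Context: For a connected surface $\Sigma$, $\mathbb F_m(\Sigma)=\{(x_1,\dots,x_m)\in\Sigma^m: x_i\neq x_j\ (i\ne j)\}$, $B_n(\Sigma)=\pi_1(\mathbb F_n(\Sigma)/S_n)$, $B_{k,n}(\Sigma)=\pi_1(\mathbb F_{k+n}(\Sigma)/(S_k\times S_n))$; $B_n=B_n(\mathbb D^2)$, $B_{k,n}=B_{k,n}(\mathbb D^2)$; $\mathbb D_n$ is the disc minus $n$ interior points. $\widehat\Sigma_g$ is a compact connected orientable surface of genus $g$ with one boundary component, $\widehat\Sigma_{g,n}$ is $\widehat\Sigma_g$ minus $n$ interior points. $\Gamma_1(G)=G$, $\Gamma_i(G)=[G,\Gamma_{i-1}(G)]$; $[x,y]=xyx^{-1}y^{-1}$, $x^y=y^{-1}xy$. Forgetting the first $k$ strings gives exact sequences $1\to B_k(\mathbb D_n)\to B_{k,n}\to B_n\to1$ and $1\to B_k(\widehat\Sigma_{g,n})\to B_{k,n}(\widehat\Sigma_g)\to B_n(\widehat\Sigma_g)\to1$. $G_k$ is the kernel of the induced map $B_{k,n}/\Gamma_2(B_{k,n})\to B_n/\Gamma_2(B_n)$ and $p_k:B_k(\mathbb D_n)\to G_k$ is the restriction of the Abelianisation map of $B_{k,n}$. $G_k(\widehat\Sigma_g)$ is the kernel of the induced map $B_{k,n}(\widehat\Sigma_g)/\Gamma_3(B_{k,n}(\widehat\Sigma_g))\to B_n(\widehat\Sigma_g)/\Gamma_3(B_n(\widehat\Sigma_g))$ and $\Phi_k:B_k(\widehat\Sigma_{g,n})\to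 G_k(\widehat\Sigma_g)$ is the restriction of the projection $B_{k,n}(\widehat\Sigma_g)\to B_{k,n}(\widehat\Sigma_g)/\Gamma_3(B_{k,n}(\widehat\Sigma_g))$. $\iota_k:B_k(\mathbb D_n)\to B_k(\widehat\Sigma_{g,n})$ is the natural inclusion induced by embedding a disc containing the $n$ punctures. Presentation of $B_{k,n}(\widehat\Sigma_g)$. Generators: $S=\{\sigma_1,\dots,\sigma_{k-1}\}$, $\widetilde S=\{\tilde\sigma_1,\dots,\tilde\sigma_{n-1}\}$, $AB=\{a_1,b_1,\dots,a_g,b_g\}$, $\widetilde{AB}=\{\tilde a_1,\tilde b_1,\dots,\tilde a_g,\tilde b_g\}$, $Z=\{\zeta_1,\dots,\zeta_n\}$. Write $c<d$ for $c\in\{a_i,b_i\}$, $d\in\{a_j,b_j\}$, $i<j$. Relations (for all indices for which they make sense): (a) $\sigma_i\sigma_j=\sigma_j\sigma_i$ for $|i-j|\ge2$; $\sigma_i\sigma_{i+1}\sigma_i=\sigma_{i+1}\sigma_i\sigma_{i+1}$; $c\sigma_i=\sigma_ic$ for $i\neq1$, $c\in AB\cup Z$; $c\sigma_1c\sigma_1=\sigma_1c\sigma_1c$ for $c\in AB\cup Z$; $a_i\sigma_1b_i=\sigma_1b_i\sigma_1a_i\sigma_1$; $\sigma_1^{-1}c\sigma_1$ commutes with $d$ for $c,d\in AB$, $c<d$; $\sigma_1^{-1}\zeta_i\sigma_1$ commutes with every $c\in AB$, and with $\zeta_j$ for $i<j$. (b) The relations of (a) among $S\cup AB$ only, with $k$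 replaced by $n$ and $\sigma_i,a_i,b_i$ by $\tilde\sigma_i,\tilde a_i,\tilde b_i$. (c) $\tilde\sigma_i,\tilde a_i,\tilde b_i$ commute with every $\sigma_j$; $\tilde\sigma_i$ commutes with $a_j,b_j$; $\tilde\sigma_i\zeta_{i+1}\tilde\sigma_i^{-1}=\zeta_i$; $\tilde\sigma_i\zeta_i\tilde\sigma_i^{-1}=\zeta_i^{-1}\zeta_{i+1}\zeta_i$; $\tilde\sigma_i\zeta_j\tilde\sigma_i^{-1}=\zeta_j$ for $j\ne i,i+1$; for $(\tilde x,x)=(\tilde a_i,a_i)$ or $(\tilde b_i,b_i)$: $\tilde x\zeta_1\tilde x^{-1}=\zeta_1^{x\zeta_1}$, $\tilde x\zeta_j\tilde x^{-1}=\zeta_j^{[x^{-1},\zeta_1^{-1}]}$ for $j\ne1$, $\tilde xx\tilde x^{-1}=\zeta_1^{-1}x\zeta_1$, and for $d\in\{a_j,b_j\}$, $\tilde xd\tilde x^{-1}=d^{[x^{-1},\zeta_1^{-1}]}$ if $i>j$, $\tilde xd\tilde x^{-1}=d$ if $j>i$; $\tilde a_ib_i\tilde a_i^{-1}=b_i\zeta_1$; $\tilde b_ia_i\tilde b_i^{-1}=\zeta_1^{-1}a_i[b_i^{-1},\zeta_1^{-1}]$. $B_k(\widehat\Sigma_{g,n})$ has generators $S\cup AB\cup Z$ and relations (a); $B_n(\widehat\Sigma_g)$ has generators $\widetilde S\cup\widetilde{AB}$ and relations (b); forgetting the first $k$ strings kills $S\cup AB\cup Z$ and fixes $\widetilde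 S\cup\widetilde{AB}$. For $g=0$ (no $AB$, $\widetilde{AB}$) one gets presentations of $B_{k,n}$, $B_k(\mathbb D_n)$, $B_n$; $\iota_k$ preserves names of generators. *)

theory Defs
  imports "HOL-Algebra.Generated_Groups"
begin

section \<open>Groups given by generators and relations\<close>

text \<open>A letter is a generator together with a sign; \<open>(x, True)\<close> stands for the generator \<open>x\<close>
  and \<open>(x, False)\<close> for its inverse. A relation \<open>r = s\<close> is a pair of words.\<close>

type_synonym 'x word = "('x \<times> bool) list"

definition words :: "'x set \<Rightarrow> 'x word set" where
  "words X = lists (X \<times> UNIV)"

definition letter :: "'x \<Rightarrow> 'x word" where
  "letter x = [(x, True)]"

definition winv :: "'x word \<Rightarrow> 'x word" where
  "winv w = map (\<lambda>(x, e). (x, \<not> e)) (rev w)"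

text \<open>\<open>wconj x y\<close> is $x^y = y^{-1}xy$ and \<open>wcomm x y\<close> is $[x,y] = xyx^{-1}y^{-1}$;
  \<open>commute x y\<close> is the relation $xy = yx$.\<close>

definition wconj :: "'x word \<Rightarrow> 'x word \<Rightarrow> 'x word" where
  "wconj x y = winv y @ x @ y"

definition wcomm :: "'x word \<Rightarrow> 'x word \<Rightarrow> 'x word" where
  "wcomm x y = x @ y @ winv x @ winv y"

definition commute :: "'x word \<Rightarrow> 'x word \<Rightarrow> 'x word \<times> 'x word" where
  "commute x y = (x @ y, y @ x)"

inductive_set pres_rel :: "'x set \<Rightarrow> ('x word \<times> 'x word) set \<Rightarrow> ('x word \<times> 'x word) set"
  for X :: "'x set" and R :: "('x word \<times> 'x word) set" where
  refl: "w \<in> words X \<Longrightarrow> (w, w) \<in> pres_rel X R"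
| sym: "(v, w) \<in> pres_rel X R \<Longrightarrow> (w, v) \<in> pres_rel X R"
| trans: "(u, v) \<in> pres_rel X R \<Longrightarrow> (v, w) \<in> pres_rel X R \<Longrightarrow> (u, w) \<in> pres_rel X R"
| cancel: "u \<in> words X \<Longrightarrow> v \<in> words X \<Longrightarrow> x \<in> X
    \<Longrightarrow> (u @ [(x, e), (x, \<not> e)] @ v, u @ v) \<in> pres_rel X R"
| rel: "(r, s) \<in> R \<Longrightarrow> r \<in> words X \<Longrightarrow> s \<in> words X \<Longrightarrow> u \<in> words X \<Longrightarrow> v \<in> words X
    \<Longrightarrow> (u @ r @ v, u @ s @ v) \<in> pres_rel X R"

definition presented_group :: "'x set \<Rightarrow> ('x word \<times> 'x word) set \<Rightarrow> 'x word set monoid" where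
  "presented_group X R =
    \<lparr>carrier = words X // pres_rel X R,
     mult = (\<lambda>A B. \<Union>u\<in>A. \<Union>v\<in>B. pres_rel X R `` {u @ v}),
     one = pres_rel X R `` {[]}\<rparr>"

text \<open>The homomorphism into \<open>presented_group X R\<close> induced by a map \<open>f\<close> on words
  (meaningful when \<open>f\<close> respects the relations of the source).\<close>

definition pres_map ::
    "'y set \<Rightarrow> ('y word \<times> 'y word) set \<Rightarrow> ('x word \<Rightarrow> 'y word) \<Rightarrow> 'x word set \<Rightarrow> 'y word set" where
  "pres_map X R f C = (\<Union>w\<in>C. pres_rel X R `` {f w})"

lemma words_append [simp]: "u @ v \<in> words X \<longleftrightarrow> u \<in> words X \<and> v \<in> words X"
  by (auto simp: words_def)

lemma words_Nil [simp]: "[] \<in> words X"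
  by (simp add: words_def)

lemma words_Cons [simp]: "a # w \<in> words X \<longleftrightarrow> fst a \<in> X \<and> w \<in> words X"
  by (cases a) (auto simp: words_def)

lemma words_mono: "w \<in> words X \<Longrightarrow> X \<subseteq> Y \<Longrightarrow> w \<in> words Y"
  by (auto simp: words_def)

lemma words_winv [simp]: "winv w \<in> words X \<longleftrightarrow> w \<in> words X"
  by (induction w) (auto simp: winv_def)

lemma pres_rel_words: "(v, w) \<in> pres_rel X R \<Longrightarrow> v \<in> words X \<and> w \<in> words X"
  by (induction rule: pres_rel.induct) auto

lemma equiv_pres_rel: "equiv (words X) (pres_rel X R)"
proof (rule equivI)
  show "pres_rel X R \<subseteq> words X \<times> words X"
    by (auto dest: pres_rel_words)
  show "refl_on (words X) (pres_rel X R)"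
    by (auto simp: refl_on_def intro: pres_rel.refl dest: pres_rel_words)
  show "Relation.sym (pres_rel X R)"
    by (auto simp: sym_def intro: pres_rel.sym)
  show "Relation.trans (pres_rel X R)"
    by (rule transI) (rule pres_rel.trans)
qed

lemma pres_rel_append_left:
  assumes "(v, w) \<in> pres_rel X R" "u \<in> words X"
  shows "(u @ v, u @ w) \<in> pres_rel X R"
  using assms
proof (induction rule: pres_rel.induct)
  case (cancel a b x e)
  then show ?case using pres_rel.cancel[where u = "u @ a" and v = b and x = x and e = e] by simp
next
  case (rel r s a b)
  then show ?case using pres_rel.rel[where u = "u @ a" and v = b and r = r and s = s] by simp
qed (auto intro: pres_rel.refl pres_rel.sym pres_rel.trans)

lemma pres_rel_append_right:
  assumes "(v, w) \<in> pres_rel X R" "u \<in> words X"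
  shows "(v @ u, w @ u) \<in> pres_rel X R"
  using assms
proof (induction rule: pres_rel.induct)
  case (cancel a b x e)
  then show ?case using pres_rel.cancel[where u = a and v = "b @ u" and x = x and e = e] by simp
next
  case (rel r s a b)
  then show ?case using pres_rel.rel[where u = a and v = "b @ u" and r = r and s = s] by simp
qed (auto intro: pres_rel.refl pres_rel.sym pres_rel.trans)

lemma pres_rel_append:
  assumes "(u, u') \<in> pres_rel X R" "(v, v') \<in> pres_rel X R"
  shows "(u @ v, u' @ v') \<in> pres_rel X R"
  using assms pres_rel_append_left pres_rel_append_right pres_rel_words
  by (meson pres_rel.trans)

lemma pres_rel_winv_left: "w \<in> words X \<Longrightarrow> (winv w @ w, []) \<in> pres_rel X R"
proof (induction w)
  case Nil
  then show ?case by (simp add: winv_def pres_rel.refl)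
next
  case (Cons a w)
  obtain x e where a: "a = (x, e)" by force
  have "(winv w @ [(x, \<not> e), (x, \<not> \<not> e)] @ w, winv w @ w) \<in> pres_rel X R"
    using Cons.prems a by (intro pres_rel.cancel) auto
  then have "(winv (a # w) @ a # w, winv w @ w) \<in> pres_rel X R"
    by (simp add: a winv_def)
  then show ?case
    using Cons by (auto intro: pres_rel.trans)
qed

lemma presented_group_carrier:
  "carrier (presented_group X R) = words X // pres_rel X R"
  by (simp add: presented_group_def)

lemma presented_group_mult:
  assumes "u \<in> words X" "v \<in> words X"
  shows "(pres_rel X R `` {u}) \<otimes>\<^bsub>presented_group X R\<^esub> (pres_rel X R `` {v}) = pres_rel X R `` {u @ v}"
proof -
  have "congruent2 (pres_rel X R) (pres_rel X R) (\<lambda>u v. pres_rel X R `` {u @ v})"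
    by (rule congruent2I') (rule equiv_class_eq[OF equiv_pres_rel pres_rel_append])
  from UN_equiv_class2[OF equiv_pres_rel equiv_pres_rel this assms]
  show ?thesis by (simp add: presented_group_def)
qed

lemma presented_group_one: "\<one>\<^bsub>presented_group X R\<^esub> = pres_rel X R `` {[]}"
  by (simp add: presented_group_def)

lemma presented_groupE:
  assumes "A \<in> carrier (presented_group X R)"
  obtains w where "w \<in> words X" "A = pres_rel X R `` {w}"
  using assms by (auto simp: presented_group_carrier elim: quotientE)

lemma presented_groupI: "w \<in> words X \<Longrightarrow> pres_rel X R `` {w} \<in> carrier (presented_group X R)"
  by (simp add: presented_group_carrier quotientI)

lemma group_presented_group: "group (presented_group X R)"
proof (rule groupI)
  fix A B C
  assume A: "A \<in> carrier (presented_group X R)"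
  obtain u where u: "u \<in> words X" "A = pres_rel X R `` {u}" using A by (rule presented_groupE)
  show "\<one>\<^bsub>presented_group X R\<^esub> \<otimes>\<^bsub>presented_group X R\<^esub> A = A"
    by (simp add: presented_group_one presented_group_mult u)
  show "\<exists>B\<in>carrier (presented_group X R). B \<otimes>\<^bsub>presented_group X R\<^esub> A = \<one>\<^bsub>presented_group X R\<^esub>"
  proof (rule bexI[of _ "pres_rel X R `` {winv u}"])
    show "pres_rel X R `` {winv u} \<otimes>\<^bsub>presented_group X R\<^esub> A = \<one>\<^bsub>presented_group X R\<^esub>"
      using equiv_class_eq[OF equiv_pres_rel pres_rel_winv_left[OF u(1), of R]]
      by (simp add: presented_group_one presented_group_mult u)
  qed (simp add: presented_groupI u)
  assume B: "B \<in> carrier (presented_group X R)"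
  obtain v where v: "v \<in> words X" "B = pres_rel X R `` {v}" using B by (rule presented_groupE)
  show "A \<otimes>\<^bsub>presented_group X R\<^esub> B \<in> carrier (presented_group X R)"
    by (simp add: presented_group_mult u v presented_groupI)
  assume C: "C \<in> carrier (presented_group X R)"
  obtain w where w: "w \<in> words X" "C = pres_rel X R `` {w}" using C by (rule presented_groupE)
  show "A \<otimes>\<^bsub>presented_group X R\<^esub> B \<otimes>\<^bsub>presented_group X R\<^esub> C =
      A \<otimes>\<^bsub>presented_group X R\<^esub> (B \<otimes>\<^bsub>presented_group X R\<^esub> C)"
    by (simp add: presented_group_mult u v w)
qed (simp add: presented_group_one presented_groupI)

lemma pres_map_hom:
  assumes app: "\<And>u v. f (u @ v) = f u @ f v"
    and wd: "\<And>w. w \<in> words X \<Longrightarrow> f w \<in> words Y"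
    and can: "\<And>x e. x \<in> X \<Longrightarrow> (f [(x, e), (x, \<not> e)], []) \<in> pres_rel Y Q"
    and rel: "\<And>r s. (r, s) \<in> R \<Longrightarrow> r \<in> words X \<Longrightarrow> s \<in> words X \<Longrightarrow> (f r, f s) \<in> pres_rel Y Q"
  shows "pres_map Y Q f \<in> hom (presented_group X R) (presented_group Y Q)"
    and "w \<in> words X \<Longrightarrow> pres_map Y Q f (pres_rel X R `` {w}) = pres_rel Y Q `` {f w}"
proof -
  have resp: "(f v, f w) \<in> pres_rel Y Q" if "(v, w) \<in> pres_rel X R" for v w
    using that
  proof (induction rule: pres_rel.induct)
    case (cancel u v x e)
    have "((f u @ f [(x, e), (x, \<not> e)]) @ f v, (f u @ []) @ f v) \<in> pres_rel Y Q"
      using cancel by (intro pres_rel_append_left pres_rel_append_right can wd)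
    then show ?case by (simp only: app append_assoc append_Nil)
  next
    case (rel r s u v)
    have "((f u @ f r) @ f v, (f u @ f s) @ f v) \<in> pres_rel Y Q"
      using rel by (intro pres_rel_append_left pres_rel_append_right assms(4) wd)
    then show ?case by (simp only: app append_assoc)
  qed (use wd in \<open>auto intro: pres_rel.refl pres_rel.sym pres_rel.trans\<close>)
  have "(\<lambda>w. pres_rel Y Q `` {f w}) respects pres_rel X R"
    by (rule congruentI) (use resp equiv_class_eq[OF equiv_pres_rel] in blast)
  then have cl: "pres_map Y Q f (pres_rel X R `` {w}) = pres_rel Y Q `` {f w}" if "w \<in> words X" for w
    using that UN_equiv_class[OF equiv_pres_rel] by (simp add: pres_map_def)
  then show "w \<in> words X \<Longrightarrow> pres_map Y Q f (pres_rel X R `` {w}) = pres_rel Y Q `` {f w}" .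
  show "pres_map Y Q f \<in> hom (presented_group X R) (presented_group Y Q)"
  proof (rule homI)
    fix A B
    assume "A \<in> carrier (presented_group X R)"
    then obtain u where u: "u \<in> words X" "A = pres_rel X R `` {u}" by (rule presented_groupE)
    then show "pres_map Y Q f A \<in> carrier (presented_group Y Q)"
      by (simp add: cl presented_groupI wd)
    assume "B \<in> carrier (presented_group X R)"
    then obtain v where v: "v \<in> words X" "B = pres_rel X R `` {v}" by (rule presented_groupE)
    then show "pres_map Y Q f (A \<otimes>\<^bsub>presented_group X R\<^esub> B) =
        pres_map Y Q f A \<otimes>\<^bsub>presented_group Y Q\<^esub> pres_map Y Q f B"
      using u by (simp add: cl presented_group_mult wd app)
  qed
qed


section \<open>Lower central series\<close>

text \<open>Indexed as $\Gamma_1(G) = G$, $\Gamma_{i+1}(G) = [G,\Gamma_i(G)]$; the value at 0 is a dummy.\<close>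

fun lower_central :: "('a, 'b) monoid_scheme \<Rightarrow> nat \<Rightarrow> 'a set" where
  "lower_central G 0 = carrier G"
| "lower_central G (Suc 0) = carrier G"
| "lower_central G (Suc (Suc i)) =
    generate G (\<Union>x\<in>carrier G. \<Union>y\<in>lower_central G (Suc i).
      {x \<otimes>\<^bsub>G\<^esub> y \<otimes>\<^bsub>G\<^esub> inv\<^bsub>G\<^esub> x \<otimes>\<^bsub>G\<^esub> inv\<^bsub>G\<^esub> y})"

definition lc_quotient :: "('a, 'b) monoid_scheme \<Rightarrow> nat \<Rightarrow> 'a set monoid" where
  "lc_quotient G i = G Mod lower_central G i"

definition lc_proj :: "('a, 'b) monoid_scheme \<Rightarrow> nat \<Rightarrow> 'a \<Rightarrow> 'a set" where
  "lc_proj G i x = lower_central G i #>\<^bsub>G\<^esub> x"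

text \<open>The map $G/\Gamma_i(G) \to H/\Gamma_i(H)$ induced by a homomorphism \<open>f\<close> from \<open>G\<close> to \<open>H\<close>.\<close>

definition lc_map :: "('c, 'd) monoid_scheme \<Rightarrow> nat \<Rightarrow> ('a \<Rightarrow> 'c) \<Rightarrow> 'a set \<Rightarrow> 'c set" where
  "lc_map H i f C = (\<Union>x\<in>C. lc_proj H i (f x))"

definition factors_through ::
    "('a, 'b) monoid_scheme \<Rightarrow> ('c, 'd) monoid_scheme \<Rightarrow> ('e, 'f) monoid_scheme
      \<Rightarrow> ('a \<Rightarrow> 'e) \<Rightarrow> ('a \<Rightarrow> 'c) \<Rightarrow> bool" where
  "factors_through A H G f p \<longleftrightarrow> (\<exists>h\<in>hom H G. \<forall>x\<in>carrier A. f x = h (p x))"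


section \<open>Braid groups of the surface of genus \<open>g\<close> with one boundary component\<close>

text \<open>The braid groups, fundamental groups of configuration spaces of the surface, are given here by
  their presentations, and the maps between them by their values on generators: inclusions preserve
  the names of generators, and forgetting strings kills the generators of the fibre.\<close>

text \<open>\<open>Sig\<close>, \<open>GA\<close>, \<open>GB\<close>, \<open>Zeta\<close> are the generators $\sigma_i, a_i, b_i, \zeta_i$;
  \<open>TSig\<close>, \<open>TGA\<close>, \<open>TGB\<close> are $\tilde\sigma_i, \tilde a_i, \tilde b_i$.\<close>

datatype braid_gen =
  Sig nat | GA nat | GB nat | Zeta nat | TSig nat | TGA nat | TGB nat

text \<open>The relations of the group of \<open>k\<close>-string braids on the surface of genus \<open>g\<close> with \<open>n\<close>
  punctures, where the words \<open>s i\<close>, \<open>a i\<close>, \<open>b i\<close>, \<open>z i\<close> stand for the generators. The guard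
  \<open>2 \<le> k\<close> expresses that the relations involving $\sigma_1$ only make sense in that case.\<close>

definition surface_rels ::
    "(nat \<Rightarrow> 'x word) \<Rightarrow> (nat \<Rightarrow> 'x word) \<Rightarrow> (nat \<Rightarrow> 'x word) \<Rightarrow> (nat \<Rightarrow> 'x word)
      \<Rightarrow> nat \<Rightarrow> nat \<Rightarrow> nat \<Rightarrow> ('x word \<times> 'x word) set" where
  "surface_rels s a b z g k n =
    (let AB = a ` {1..g} \<union> b ` {1..g}; Z = z ` {1..n} in
      {commute (s i) (s j) | i j. i \<in> {1..<k} \<and> j \<in> {1..<k} \<and> (i + 2 \<le> j \<or> j + 2 \<le> i)}
    \<union> {(s i @ s (i+1) @ s i, s (i+1) @ s i @ s (i+1)) | i. 1 \<le> i \<and> i + 1 < k}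
    \<union> {commute c (s i) | c i. c \<in> AB \<union> Z \<and> i \<in> {1..<k} \<and> i \<noteq> 1}
    \<union> {(c @ s 1 @ c @ s 1, s 1 @ c @ s 1 @ c) | c. c \<in> AB \<union> Z \<and> 2 \<le> k}
    \<union> {(a i @ s 1 @ b i, s 1 @ b i @ s 1 @ a i @ s 1) | i. i \<in> {1..g} \<and> 2 \<le> k}
    \<union> {commute (winv (s 1) @ c @ s 1) d | c d i j.
         c \<in> {a i, b i} \<and> d \<in> {a j, b j} \<and> i \<in> {1..g} \<and> j \<in> {1..g} \<and> i < j \<and> 2 \<le> k}
    \<union> {commute (winv (s 1) @ z i @ s 1) c | c i. i \<in> {1..n} \<and> c \<in> AB \<and> 2 \<le> k}
    \<union> {commute (winv (s 1) @ z i @ s 1) (z j) | i j.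
         i \<in> {1..n} \<and> j \<in> {1..n} \<and> i < j \<and> 2 \<le> k})"

text \<open>The relations describing the action of the last \<open>n\<close> strings on the first \<open>k\<close>. In
  \<open>(tx, x, i)\<close> the pair $(\tilde x, x)$ is $(\tilde a_i, a_i)$ or $(\tilde b_i, b_i)$.\<close>

definition mixed_rels ::
    "(nat \<Rightarrow> 'x word) \<Rightarrow> (nat \<Rightarrow> 'x word) \<Rightarrow> (nat \<Rightarrow> 'x word) \<Rightarrow> (nat \<Rightarrow> 'x word)
      \<Rightarrow> (nat \<Rightarrow> 'x word) \<Rightarrow> (nat \<Rightarrow> 'x word) \<Rightarrow> (nat \<Rightarrow> 'x word)
      \<Rightarrow> nat \<Rightarrow> nat \<Rightarrow> nat \<Rightarrow> ('x word \<times> 'x word) set" where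
  "mixed_rels s a b z ts ta tb g k n =
    (let AB = a ` {1..g} \<union> b ` {1..g};
         T = ts ` {1..<n} \<union> ta ` {1..g} \<union> tb ` {1..g};
         P = {(ta i, a i, i) | i. i \<in> {1..g} \<and> 1 \<le> n} \<union> {(tb i, b i, i) | i. i \<in> {1..g} \<and> 1 \<le> n} in
      {commute t (s j) | t j. t \<in> T \<and> j \<in> {1..<k}}
    \<union> {commute (ts i) d | d i. i \<in> {1..<n} \<and> d \<in> AB}
    \<union> {(ts i @ z (i+1) @ winv (ts i), z i) | i. i \<in> {1..<n}}
    \<union> {(ts i @ z i @ winv (ts i), winv (z i) @ z (i+1) @ z i) | i. i \<in> {1..<n}}
    \<union> {(ts i @ z j @ winv (ts i), z j) | i j. i \<in> {1..<n} \<and> j \<in> {1..n} \<and> j \<noteq> i \<and> j \<noteq> i + 1}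
    \<union> {(tx @ z 1 @ winv tx, wconj (z 1) (x @ z 1)) | tx x i. (tx, x, i) \<in> P}
    \<union> {(tx @ z j @ winv tx, wconj (z j) (wcomm (winv x) (winv (z 1)))) | tx x i j.
         (tx, x, i) \<in> P \<and> j \<in> {1..n} \<and> j \<noteq> 1}
    \<union> {(tx @ x @ winv tx, winv (z 1) @ x @ z 1) | tx x i. (tx, x, i) \<in> P}
    \<union> {(tx @ d @ winv tx, wconj d (wcomm (winv x) (winv (z 1)))) | tx x i d j.
         (tx, x, i) \<in> P \<and> j \<in> {1..g} \<and> d \<in> {a j, b j} \<and> j < i}
    \<union> {(tx @ d @ winv tx, d) | tx x i d j.
         (tx, x, i) \<in> P \<and> j \<in> {1..g} \<and> d \<in> {a j, b j} \<and> i < j}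
    \<union> {(ta i @ b i @ winv (ta i), b i @ z 1) | i. i \<in> {1..g} \<and> 1 \<le> n}
    \<union> {(tb i @ a i @ winv (tb i), winv (z 1) @ a i @ wcomm (winv (b i)) (winv (z 1))) | i.
         i \<in> {1..g} \<and> 1 \<le> n})"

abbreviation sw :: "nat \<Rightarrow> braid_gen word" where "sw i \<equiv> letter (Sig i)"
abbreviation aw :: "nat \<Rightarrow> braid_gen word" where "aw i \<equiv> letter (GA i)"
abbreviation bw :: "nat \<Rightarrow> braid_gen word" where "bw i \<equiv> letter (GB i)"
abbreviation zw :: "nat \<Rightarrow> braid_gen word" where "zw i \<equiv> letter (Zeta i)"
abbreviation tsw :: "nat \<Rightarrow> braid_gen word" where "tsw i \<equiv> letter (TSig i)"
abbreviation taw :: "nat \<Rightarrow> braid_gen word" where "taw i \<equiv> letter (TGA i)"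
abbreviation tbw :: "nat \<Rightarrow> braid_gen word" where "tbw i \<equiv> letter (TGB i)"

definition fibre_gens :: "nat \<Rightarrow> nat \<Rightarrow> nat \<Rightarrow> braid_gen set" where
  "fibre_gens g k n = Sig ` {1..<k} \<union> GA ` {1..g} \<union> GB ` {1..g} \<union> Zeta ` {1..n}"

definition base_gens :: "nat \<Rightarrow> nat \<Rightarrow> braid_gen set" where
  "base_gens g n = TSig ` {1..<n} \<union> TGA ` {1..g} \<union> TGB ` {1..g}"

definition fibre_rels :: "nat \<Rightarrow> nat \<Rightarrow> nat \<Rightarrow> (braid_gen word \<times> braid_gen word) set" where
  "fibre_rels g k n = surface_rels sw aw bw zw g k n"

text \<open>No punctures here, so the argument \<open>zw\<close> is not used.\<close>

definition base_rels :: "nat \<Rightarrow> nat \<Rightarrow> (braid_gen word \<times> braid_gen word) set" where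
  "base_rels g n = surface_rels tsw taw tbw zw g n 0"

definition total_rels :: "nat \<Rightarrow> nat \<Rightarrow> nat \<Rightarrow> (braid_gen word \<times> braid_gen word) set" where
  "total_rels g k n =
    fibre_rels g k n \<union> base_rels g n \<union> mixed_rels sw aw bw zw tsw taw tbw g k n"

text \<open>For $\Sigma = \widehat\Sigma_g$, with $\widehat\Sigma_0 = \mathbb D^2$: \<open>fibre_braid_group g k n\<close>
  is $B_k(\widehat\Sigma_{g,n})$, \<open>braid_group g n\<close> is $B_n(\widehat\Sigma_g)$ and
  \<open>mixed_braid_group g k n\<close> is $B_{k,n}(\widehat\Sigma_g)$. In particular \<open>g = 0\<close> gives
  $B_k(\mathbb D_n)$, $B_n$ and $B_{k,n}$.\<close>

definition fibre_braid_group :: "nat \<Rightarrow> nat \<Rightarrow> nat \<Rightarrow> braid_gen word set monoid" where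
  "fibre_braid_group g k n = presented_group (fibre_gens g k n) (fibre_rels g k n)"

definition braid_group :: "nat \<Rightarrow> nat \<Rightarrow> braid_gen word set monoid" where
  "braid_group g n = presented_group (base_gens g n) (base_rels g n)"

definition mixed_braid_group :: "nat \<Rightarrow> nat \<Rightarrow> nat \<Rightarrow> braid_gen word set monoid" where
  "mixed_braid_group g k n =
    presented_group (fibre_gens g k n \<union> base_gens g n) (total_rels g k n)"

definition fibre_elem :: "nat \<Rightarrow> nat \<Rightarrow> nat \<Rightarrow> braid_gen \<Rightarrow> braid_gen word set" where
  "fibre_elem g k n x = pres_rel (fibre_gens g k n) (fibre_rels g k n) `` {letter x}"

definition S_gens :: "nat \<Rightarrow> nat \<Rightarrow> nat \<Rightarrow> braid_gen word set set" where
  "S_gens g k n = {fibre_elem g k n (Sig i) | i. i \<in> {1..<k}}"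

definition Z_gens :: "nat \<Rightarrow> nat \<Rightarrow> nat \<Rightarrow> braid_gen word set set" where
  "Z_gens g k n = {fibre_elem g k n (Zeta j) | j. j \<in> {1..n}}"

text \<open>The maps of the exact sequence
  $B_k(\widehat\Sigma_{g,n}) \to B_{k,n}(\widehat\Sigma_g) \to B_n(\widehat\Sigma_g)$.\<close>

definition fibre_incl :: "nat \<Rightarrow> nat \<Rightarrow> nat \<Rightarrow> braid_gen word set \<Rightarrow> braid_gen word set" where
  "fibre_incl g k n =
    pres_map (fibre_gens g k n \<union> base_gens g n) (total_rels g k n) (\<lambda>w. w)"

definition forget :: "nat \<Rightarrow> nat \<Rightarrow> braid_gen word set \<Rightarrow> braid_gen word set" where
  "forget g n =
    pres_map (base_gens g n) (base_rels g n) (filter (\<lambda>(x, e). x \<in> base_gens g n))"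

text \<open>$\iota_k : B_k(\mathbb D_n) \to B_k(\widehat\Sigma_{g,n})$\<close>

definition iota :: "nat \<Rightarrow> nat \<Rightarrow> nat \<Rightarrow> braid_gen word set \<Rightarrow> braid_gen word set" where
  "iota g k n = pres_map (fibre_gens g k n) (fibre_rels g k n) (\<lambda>w. w)"

text \<open>The kernel of $B_{k,n}(\widehat\Sigma_g)/\Gamma_i \to B_n(\widehat\Sigma_g)/\Gamma_i$, and the
  restriction to $B_k(\widehat\Sigma_{g,n})$ of the projection
  $B_{k,n}(\widehat\Sigma_g) \to B_{k,n}(\widehat\Sigma_g)/\Gamma_i$.\<close>

definition lc_kernel :: "nat \<Rightarrow> nat \<Rightarrow> nat \<Rightarrow> nat \<Rightarrow> braid_gen word set set monoid" where
  "lc_kernel i g k n =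
    (let Q = lc_quotient (mixed_braid_group g k n) i in
      Q\<lparr>carrier := kernel Q (lc_quotient (braid_group g n) i)
                    (lc_map (braid_group g n) i (forget g n))\<rparr>)"

definition lc_restrict ::
    "nat \<Rightarrow> nat \<Rightarrow> nat \<Rightarrow> nat \<Rightarrow> braid_gen word set \<Rightarrow> braid_gen word set set" where
  "lc_restrict i g k n x = lc_proj (mixed_braid_group g k n) i (fibre_incl g k n x)"

text \<open>$p_k : B_k(\mathbb D_n) \to G_k$ and $\Phi_k : B_k(\widehat\Sigma_{g,n}) \to G_k(\widehat\Sigma_g)$.
  Both \<open>G_disc\<close> and \<open>G_surface\<close> depend on \<open>n\<close>.\<close>

definition G_disc :: "nat \<Rightarrow> nat \<Rightarrow> braid_gen word set set monoid" where
  "G_disc k n = lc_kernel 2 0 k n"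

definition p_disc :: "nat \<Rightarrow> nat \<Rightarrow> braid_gen word set \<Rightarrow> braid_gen word set set" where
  "p_disc k n = lc_restrict 2 0 k n"

definition G_surface :: "nat \<Rightarrow> nat \<Rightarrow> nat \<Rightarrow> braid_gen word set set monoid" where
  "G_surface g k n = lc_kernel 3 g k n"

definition Phi :: "nat \<Rightarrow> nat \<Rightarrow> nat \<Rightarrow> braid_gen word set \<Rightarrow> braid_gen word set set" where
  "Phi g k n = lc_restrict 3 g k n"

subsection \<open>Well-definedness\<close>

lemma group_fibre_braid_group: "group (fibre_braid_group g k n)"
  and group_braid_group: "group (braid_group g n)"
  and group_mixed_braid_group: "group (mixed_braid_group g k n)"
  by (simp_all add: fibre_braid_group_def braid_group_def mixed_braid_group_def group_presented_group)

lemma pres_map_id_hom: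
  assumes "X \<subseteq> Y" "R \<subseteq> Q"
  shows "pres_map Y Q (\<lambda>w. w) \<in> hom (presented_group X R) (presented_group Y Q)"
proof (rule pres_map_hom(1))
  have mono: "w \<in> words X \<Longrightarrow> w \<in> words Y" for w
    using assms(1) words_mono by blast
  show "w \<in> words X \<Longrightarrow> w \<in> words Y" for w by (rule mono)
  show "x \<in> X \<Longrightarrow> ([(x, e), (x, \<not> e)], []) \<in> pres_rel Y Q" for x e
    using pres_rel.cancel[where u = "[]" and v = "[]" and x = x and X = Y] assms(1) by auto
  show "(r, s) \<in> R \<Longrightarrow> r \<in> words X \<Longrightarrow> s \<in> words X \<Longrightarrow> (r, s) \<in> pres_rel Y Q" for r s
    using pres_rel.rel[where u = "[]" and v = "[]" and r = r and s = s and X = Y] assms(2) mono by auto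
qed auto

lemma fibre_incl_hom: "fibre_incl g k n \<in> hom (fibre_braid_group g k n) (mixed_braid_group g k n)"
  unfolding fibre_incl_def fibre_braid_group_def mixed_braid_group_def
  by (rule pres_map_id_hom) (auto simp: total_rels_def)

lemma iota_hom: "iota g k n \<in> hom (fibre_braid_group 0 k n) (fibre_braid_group g k n)"
  unfolding iota_def fibre_braid_group_def
proof (rule pres_map_id_hom)
  show "fibre_gens 0 k n \<subseteq> fibre_gens g k n" by (auto simp: fibre_gens_def)
  show "fibre_rels 0 k n \<subseteq> fibre_rels g k n"
    unfolding fibre_rels_def surface_rels_def Let_def by (intro Un_mono) auto
qed

lemma winv_winv: "winv (winv w) = w"
  by (induction w) (auto simp: winv_def)

lemma pres_rel_winv_right:
  assumes "t \<in> words X"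
  shows "(t @ winv t, []) \<in> pres_rel X R"
  using pres_rel_winv_left[of "winv t" X R] assms by (simp add: winv_winv)

lemma filter_winv: "filter (\<lambda>(x, e). x \<in> Y) (winv w) = winv (filter (\<lambda>(x, e). x \<in> Y) w)"
  by (induction w) (auto simp: winv_def)

lemma forget_eval:
  shows "forget g n \<in> hom (mixed_braid_group g k n) (braid_group g n)"
    and "w \<in> words (fibre_gens g k n \<union> base_gens g n) \<Longrightarrow>
      forget g n (pres_rel (fibre_gens g k n \<union> base_gens g n) (total_rels g k n) `` {w}) =
      pres_rel (base_gens g n) (base_rels g n) `` {filter (\<lambda>(x, e). x \<in> base_gens g n) w}"
proof -
  let ?Y = "base_gens g n" and ?Q = "base_rels g n" and ?X = "fibre_gens g k n \<union> base_gens g n"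
  define f :: "braid_gen word \<Rightarrow> braid_gen word" where "f = filter (\<lambda>(x, e). x \<in> ?Y)"
  have f0: "f (sw i) = []" "f (aw i) = []" "f (bw i) = []" "f (zw i) = []" "f [] = []" for i
    by (auto simp: f_def letter_def base_gens_def)
  have fY: "f w = w" if "w \<in> words ?Y" for w
    using that unfolding f_def by (induction w) auto
  have tY: "i \<in> {1..<n} \<Longrightarrow> tsw i \<in> words ?Y" "i \<in> {1..g} \<Longrightarrow> taw i \<in> words ?Y"
     "i \<in> {1..g} \<Longrightarrow> tbw i \<in> words ?Y" for i
    by (auto simp: letter_def base_gens_def)
  have app: "f (u @ v) = f u @ f v" for u v by (simp add: f_def)
  have fw: "f (winv v) = winv (f v)" for v by (simp add: f_def filter_winv)
  have w0: "winv ([] :: braid_gen word) = []" by (simp add: winv_def)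
  have nil: "([], []) \<in> pres_rel ?Y ?Q" by (simp add: pres_rel.refl)
  have wd: "f w \<in> words ?Y" for w unfolding f_def by (induction w) auto
  have can: "(f [(x, e), (x, \<not> e)], []) \<in> pres_rel ?Y ?Q" for x e
    using pres_rel.cancel[where u = "[]" and v = "[]" and x = x and X = ?Y] nil
    by (auto simp: f_def)
  have rel: "(f r, f s) \<in> pres_rel ?Y ?Q" if rs: "(r, s) \<in> total_rels g k n" for r s
  proof -
    consider "(r, s) \<in> fibre_rels g k n" | "(r, s) \<in> ?Q"
      | "(r, s) \<in> mixed_rels sw aw bw zw tsw taw tbw g k n"
      using rs by (auto simp: total_rels_def)
    then show ?thesis
    proof cases
      case 1
      then have "f r = [] \<and> f s = []"
        unfolding fibre_rels_def surface_rels_def Let_def commute_def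
        by (elim UnE) (auto simp: app fw f0 w0)
      then show ?thesis using nil by simp
    next
      case 2
      then have "r \<in> words ?Y \<and> s \<in> words ?Y"
        using tY unfolding base_rels_def surface_rels_def Let_def commute_def
        by (elim UnE) auto
      then show ?thesis
        using pres_rel.rel[where u = "[]" and v = "[]" and r = r and s = s and X = ?Y] 2 fY by auto
    next
      case 3
      have tr: "(f t, f t) \<in> pres_rel ?Y ?Q" and t: "(f t @ winv (f t), []) \<in> pres_rel ?Y ?Q" for t
        by (simp_all add: wd pres_rel.refl pres_rel_winv_right)
      from 3 show ?thesis
        unfolding mixed_rels_def Let_def commute_def wconj_def wcomm_def
        by (elim UnE) (auto simp: app fw f0 w0 tr t nil)
    qed
  qed
  show "forget g n \<in> hom (mixed_braid_group g k n) (braid_group g n)"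
    unfolding forget_def mixed_braid_group_def braid_group_def f_def[symmetric]
    by (rule pres_map_hom(1)[OF app wd can rel])
  show "forget g n (pres_rel ?X (total_rels g k n) `` {w}) =
      pres_rel ?Y ?Q `` {filter (\<lambda>(x, e). x \<in> ?Y) w}" if "w \<in> words ?X"
    unfolding forget_def f_def[symmetric] by (rule pres_map_hom(2)[OF app wd can rel that])
qed

lemma (in group) normal_lower_central: "lower_central G i \<lhd> G"
proof (induction i)
  case (Suc i)
  show ?case
  proof (cases i)
    case (Suc j)
    let ?N = "lower_central G (Suc j)"
    let ?C = "\<Union>x\<in>carrier G. \<Union>y\<in>?N. {x \<otimes> y \<otimes> inv x \<otimes> inv y}"
    have N: "?N \<lhd> G" using Suc.IH Suc by simp
    have sub: "?N \<subseteq> carrier G" using N by (simp add: normal_imp_subgroup subgroup.subset)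
    have "generate G ?C \<lhd> G"
    proof (rule normal_generateI)
      show "?C \<subseteq> carrier G" using sub by auto
      fix h g
      assume h: "h \<in> ?C" and g: "g \<in> carrier G"
      then obtain x y where xy: "x \<in> carrier G" "y \<in> ?N" "h = x \<otimes> y \<otimes> inv x \<otimes> inv y" by auto
      have y: "y \<in> carrier G" using sub xy by auto
      have yN: "g \<otimes> y \<otimes> inv g \<in> ?N" using N g xy(2) normal_inv_iff by blast
      have xG: "g \<otimes> x \<otimes> inv g \<in> carrier G" using g xy(1) by simp
      have c: "inv g \<otimes> (g \<otimes> z) = z" if "z \<in> carrier G" for z
        using that g by (metis inv_closed l_inv l_one m_assoc)
      have "g \<otimes> h \<otimes> inv g =
          (g \<otimes> x \<otimes> inv g) \<otimes> (g \<otimes> y \<otimes> inv g) \<otimes> inv (g \<otimes> x \<otimes> inv g) \<otimes> inv (g \<otimes> y \<otimes> inv g)"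
        unfolding xy(3) using xy(1) y g by (simp add: inv_mult_group m_assoc c)
      then show "g \<otimes> h \<otimes> inv g \<in> ?C"
        by (intro UN_I[OF xG] UN_I[OF yN]) simp
    qed
    then show ?thesis using Suc by simp
  qed (use normal_self in simp)
qed (use normal_self in simp)

lemma (in group_hom) lower_central_image: "h ` lower_central G i \<subseteq> lower_central H i"
proof (induction i)
  case (Suc i)
  show ?case
  proof (cases i)
    case (Suc j)
    let ?C = "\<Union>x\<in>carrier G. \<Union>y\<in>lower_central G (Suc j). {x \<otimes> y \<otimes> inv x \<otimes> inv y}"
    let ?D = "\<Union>x\<in>carrier H. \<Union>y\<in>lower_central H (Suc j).
      {x \<otimes>\<^bsub>H\<^esub> y \<otimes>\<^bsub>H\<^esub> inv\<^bsub>H\<^esub> x \<otimes>\<^bsub>H\<^esub> inv\<^bsub>H\<^esub> y}"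
    have sub: "lower_central G (Suc j) \<subseteq> carrier G"
      using G.normal_lower_central by (metis normal_imp_subgroup subgroup.subset)
    have "h ` ?C \<subseteq> ?D"
    proof safe
      fix x y
      assume x: "x \<in> carrier G" and y: "y \<in> lower_central G (Suc j)"
      have "h y \<in> lower_central H (Suc j)" using Suc.IH Suc y by blast
      moreover have "y \<in> carrier G" using sub y by auto
      ultimately show "h (x \<otimes> y \<otimes> inv x \<otimes> inv y) \<in> ?D"
        using x by (intro UN_I[of "h x"] UN_I[of "h y"]) auto
    qed
    moreover have "?C \<subseteq> carrier G" using sub by auto
    ultimately have "h ` generate G ?C \<subseteq> generate H ?D"
      using generate_img[of ?C] H.mono_generate[of "h ` ?C" ?D] by simp
    then show ?thesis using Suc by simp
  qed auto
qed auto

lemma (in group_hom) lc_map_proj: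
  assumes "x \<in> carrier G"
  shows "lc_map H i h (lc_proj G i x) = lc_proj H i (h x)"
proof -
  have N: "subgroup (lower_central G i) G" "subgroup (lower_central H i) H"
    using G.normal_lower_central H.normal_lower_central normal_imp_subgroup by blast+
  have "lc_proj H i (h y) = lc_proj H i (h x)" if y: "y \<in> lc_proj G i x" for y
  proof -
    obtain c where c: "c \<in> lower_central G i" "y = c \<otimes> x"
      using y by (auto simp: lc_proj_def r_coset_def)
    have "c \<in> carrier G" using c N(1) by (meson subgroup.mem_carrier)
    then have "h y = h c \<otimes>\<^bsub>H\<^esub> h x" using c assms by simp
    moreover have "h c \<in> lower_central H i" using c lower_central_image by blast
    ultimately have "h y \<in> lower_central H i #>\<^bsub>H\<^esub> h x" by (auto simp: r_coset_def)
    then show ?thesis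
      unfolding lc_proj_def using H.repr_independence[where x = "h x", OF _ _ N(2)] assms by auto
  qed
  moreover have "x \<in> lc_proj G i x"
    unfolding lc_proj_def by (rule G.rcos_self[OF assms N(1)])
  ultimately show ?thesis unfolding lc_map_def by blast
qed

lemma (in group_hom) lc_map_hom: "lc_map H i h \<in> hom (lc_quotient G i) (lc_quotient H i)"
proof -
  interpret NG: normal "lower_central G i" G by (rule G.normal_lower_central)
  interpret NH: normal "lower_central H i" H by (rule H.normal_lower_central)
  have car: "\<exists>x\<in>carrier G. C = lc_proj G i x" if "C \<in> carrier (lc_quotient G i)" for C
    using that by (auto simp: lc_quotient_def FactGroup_def RCOSETS_def lc_proj_def)
  show ?thesis
  proof (rule homI)
    fix C D
    assume "C \<in> carrier (lc_quotient G i)"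
    then obtain x where x: "x \<in> carrier G" "C = lc_proj G i x" using car by blast
    show "lc_map H i h C \<in> carrier (lc_quotient H i)"
      unfolding x(2) lc_map_proj[OF x(1)]
      using x(1) by (auto simp: lc_quotient_def FactGroup_def RCOSETS_def lc_proj_def)
    assume "D \<in> carrier (lc_quotient G i)"
    then obtain y where y: "y \<in> carrier G" "D = lc_proj G i y" using car by blast
    have "C \<otimes>\<^bsub>lc_quotient G i\<^esub> D = lc_proj G i (x \<otimes> y)"
      using x y NG.rcos_sum by (simp add: lc_quotient_def lc_proj_def)
    then show "lc_map H i h (C \<otimes>\<^bsub>lc_quotient G i\<^esub> D) =
        lc_map H i h C \<otimes>\<^bsub>lc_quotient H i\<^esub> lc_map H i h D"
      using x y NH.rcos_sum by (simp add: lc_map_proj) (simp add: lc_quotient_def lc_proj_def)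
  qed
qed

lemma group_lc_kernel: "group (lc_kernel i g k n)"
  and lc_restrict_hom: "lc_restrict i g k n \<in> hom (fibre_braid_group g k n) (lc_kernel i g k n)"
proof -
  let ?M = "mixed_braid_group g k n" and ?B = "braid_group g n" and ?F = "fibre_braid_group g k n"
  interpret f: group_hom ?M ?B "forget g n"
    using group_mixed_braid_group group_braid_group forget_eval(1)
    by (simp add: group_hom_def group_hom_axioms_def)
  interpret NM: normal "lower_central ?M i" ?M by (rule f.G.normal_lower_central)
  interpret NB: normal "lower_central ?B i" ?B by (rule f.H.normal_lower_central)
  interpret q: group_hom "lc_quotient ?M i" "lc_quotient ?B i" "lc_map ?B i (forget g n)"
    using f.lc_map_hom NM.factorgroup_is_group NB.factorgroup_is_group
    by (simp add: group_hom_def group_hom_axioms_def lc_quotient_def)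
  show "group (lc_kernel i g k n)"
    unfolding lc_kernel_def Let_def
    by (rule q.G.subgroup_imp_group[OF q.subgroup_kernel])
  have p: "lc_proj ?M i \<in> hom ?M (lc_quotient ?M i)"
    using NM.r_coset_hom_Mod by (simp add: lc_quotient_def lc_proj_def[abs_def])
  have incl: "fibre_incl g k n x \<in> carrier ?M" if "x \<in> carrier ?F" for x
    using that fibre_incl_hom by (meson hom_in_carrier)
  have triv: "forget g n (fibre_incl g k n x) = \<one>\<^bsub>?B\<^esub>" if x: "x \<in> carrier ?F" for x
  proof -
    let ?X = "fibre_gens g k n" and ?Y = "fibre_gens g k n \<union> base_gens g n"
    obtain w where w: "w \<in> words ?X" "x = pres_rel ?X (fibre_rels g k n) `` {w}"
      using x by (auto simp: fibre_braid_group_def elim: presented_groupE)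
    have mono: "v \<in> words ?Y" if "v \<in> words ?X" for v using that by (rule words_mono) blast
    have wY: "w \<in> words ?Y" by (rule mono[OF w(1)])
    have cls: "pres_map ?Y (total_rels g k n) (\<lambda>w. w) x = pres_rel ?Y (total_rels g k n) `` {w}"
      unfolding w(2)
    proof (rule pres_map_hom(2)[OF HOL.refl])
      show "v \<in> words ?X \<Longrightarrow> v \<in> words ?Y" for v by (rule mono)
      show "x \<in> ?X \<Longrightarrow> ([(x, e), (x, \<not> e)], []) \<in> pres_rel ?Y (total_rels g k n)" for x e
        using pres_rel.cancel[where u = "[]" and v = "[]" and x = x and X = ?Y] by auto
      show "(r, s) \<in> pres_rel ?Y (total_rels g k n)"
        if "(r, s) \<in> fibre_rels g k n" "r \<in> words ?X" "s \<in> words ?X" for r s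
        using pres_rel.rel[where u = "[]" and v = "[]" and r = r and s = s and X = ?Y
            and R = "total_rels g k n"] that mono
        by (auto simp: total_rels_def)
      show "w \<in> words ?X" by (rule w(1))
    qed
    have "filter (\<lambda>(x, e). x \<in> base_gens g n) w = []"
      using w(1) by (induction w) (auto simp: fibre_gens_def base_gens_def)
    then show ?thesis
      using forget_eval(2)[OF wY] cls by (simp add: fibre_incl_def braid_group_def presented_group_one)
  qed
  have one: "lc_proj ?B i \<one>\<^bsub>?B\<^esub> = \<one>\<^bsub>lc_quotient ?B i\<^esub>"
    using f.H.coset_mult_one[OF NB.subset] by (simp add: lc_proj_def lc_quotient_def FactGroup_def)
  show "lc_restrict i g k n \<in> hom ?F (lc_kernel i g k n)"
  proof (rule homI)
    fix x y
    assume x: "x \<in> carrier ?F"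
    then show "lc_restrict i g k n x \<in> carrier (lc_kernel i g k n)"
      using incl p by (auto simp: lc_restrict_def lc_kernel_def Let_def kernel_def f.lc_map_proj triv one
          intro: hom_in_carrier)
    assume y: "y \<in> carrier ?F"
    show "lc_restrict i g k n (x \<otimes>\<^bsub>?F\<^esub> y) =
        lc_restrict i g k n x \<otimes>\<^bsub>lc_kernel i g k n\<^esub> lc_restrict i g k n y"
      using x y incl hom_mult[OF fibre_incl_hom] hom_mult[OF p]
      by (simp add: lc_restrict_def lc_kernel_def Let_def)
  qed
qed

end

theory Submission
  imports Defs
begin

text \<open>Modulo $\Gamma_3$ the generators $\sigma_i$ become equal and central, and so do the $\zeta_j$; the
  $a_i, b_i$ commute up to $[a_i,b_i] = \sigma^2$. Conversely these relations hold in the image of any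
  homomorphism of $B_k(\widehat\Sigma_{g,n})$ that is constant on the $\sigma_i$ and on the $\zeta_j$, so
  that such a homomorphism is determined by a normal form
  $\sigma^p \zeta^q \prod_i a_i^{m_i} b_i^{l_i}$. The exponents can be read off in an explicit nilpotent
  group of class 2 to which the whole of $B_{k,n}(\widehat\Sigma_g)$ maps. Hence the kernel of $\Phi_k$ is exactly
  the set of elements whose exponents vanish, and the same holds for $p_k$ with $g = 0$ and
  $\Gamma_2$. For injectivity, commutators with $b_i$ and $a_i$ reduce an element of the kernel of
  $\Phi_G$ to one of the form $\sigma^p \zeta^q$, which comes from $B_k(\mathbb D_n)$.\<close>

section \<open>Words and presented groups\<close>

text \<open>Two obstacles shape the proof. The terms Gamma_i are taken in B_{k,n}, not in the fibre,
  so exponents of fibre elements survive modulo Gamma_i only if their reading extends to the mixed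
  group. The generators \<open>TGA\<close>, \<open>TGB\<close> cannot be made trivial there:
  conjugating b_i by \<open>TGA i\<close> multiplies it by zeta_1, which would force zeta = 1. Hence
  the model carries coordinates for them. Secondly, a factor must be defined on all of the kernel of
  B_{k,n}/Gamma_i to B_n/Gamma_i, not merely on the image of the fibre. That these coincide is
  derived from the presentations: modulo Gamma_i the image of the fibre has to be stable under
  conjugation by the base generators and by their inverses, whereas the mixed relations describe
  only one of the two signs. The disc is not a separate argument. For \<open>g = 0\<close> the
  commutators of the model vanish, so Gamma_2 plays the role that Gamma_3 has in positive genus, and
  the lemmas cover both cases at once.\<close>

fun word_eval :: "('a, 'b) monoid_scheme \<Rightarrow> ('x \<Rightarrow> 'a) \<Rightarrow> 'x word \<Rightarrow> 'a" where
  "word_eval G f [] = \<one>\<^bsub>G\<^esub>"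
| "word_eval G f ((x, e) # w) = (if e then f x else inv\<^bsub>G\<^esub> f x) \<otimes>\<^bsub>G\<^esub> word_eval G f w"

text \<open>The presentation does not occur in the definition, so a single function serves every
  group whose relations \<open>f\<close> respects, here the fibre group and the mixed group.
  Independence of the chosen word is \<open>pres_lift_class\<close>.\<close>

definition pres_lift ::
    "('a, 'b) monoid_scheme \<Rightarrow> ('x \<Rightarrow> 'a) \<Rightarrow> 'x word set \<Rightarrow> 'a" where
  "pres_lift G f C = word_eval G f (SOME w. w \<in> C)"

lemma words_letter [simp]: "letter x \<in> words X \<longleftrightarrow> x \<in> X"
  by (simp add: letter_def)

lemma winv_Nil [simp]: "winv [] = []"
  by (simp add: winv_def)

lemma winv_Cons: "winv ((x, e) # w) = winv w @ [(x, \<not> e)]"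
  by (simp add: winv_def)

context group
begin

lemma word_eval_closed [simp]:
  assumes "\<And>x. x \<in> X \<Longrightarrow> f x \<in> carrier G" "w \<in> words X"
  shows "word_eval G f w \<in> carrier G"
  using assms(2) by (induction w) (auto simp: assms(1))

lemma word_eval_append:
  assumes "\<And>x. x \<in> X \<Longrightarrow> f x \<in> carrier G" "u \<in> words X" "v \<in> words X"
  shows "word_eval G f (u @ v) = word_eval G f u \<otimes> word_eval G f v"
  using assms(2)
proof (induction u)
  case (Cons p u)
  obtain x e where "p = (x, e)" by force
  then show ?case
    using Cons assms(1) word_eval_closed[OF assms(1), where w = u] word_eval_closed[OF assms(1,3)]
    by (simp add: m_assoc)
qed (use word_eval_closed[OF assms(1,3)] in simp)

lemma word_eval_winv:
  assumes f: "\<And>x. x \<in> X \<Longrightarrow> f x \<in> carrier G" and "w \<in> words X"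
  shows "word_eval G f (winv w) = inv (word_eval G f w)"
  using assms(2)
proof (induction w)
  case (Cons p w)
  obtain x e where p: "p = (x, e)" by force
  then have x: "x \<in> X" and w: "w \<in> words X" using Cons.prems by auto
  have "word_eval G f (winv (p # w)) = word_eval G f (winv w) \<otimes> word_eval G f [(x, \<not> e)]"
    unfolding p winv_Cons using x w by (intro word_eval_append[OF f]) auto
  then show ?case
    using Cons.IH w x f word_eval_closed[OF f w] p by (auto simp: inv_mult_group)
qed simp

lemma word_eval_letter: "f x \<in> carrier G \<Longrightarrow> word_eval G f (letter x) = f x"
  by (simp add: letter_def)

lemma word_eval_pres_rel:
  assumes "(v, w) \<in> pres_rel X R"
    and f: "\<And>x. x \<in> X \<Longrightarrow> f x \<in> carrier G"
    and R: "\<And>r s. (r, s) \<in> R \<Longrightarrow> r \<in> words X \<Longrightarrow> s \<in> words X \<Longrightarrow>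
      word_eval G f r = word_eval G f s"
  shows "word_eval G f v = word_eval G f w"
  using assms(1)
proof (induction rule: pres_rel.induct)
  case (cancel u v x e)
  have "word_eval G f ([(x, e), (x, \<not> e)] @ v) = word_eval G f v"
    using cancel f word_eval_closed[OF f cancel(2)] by (auto simp: m_assoc[symmetric])
  then show ?case
    using cancel word_eval_append[OF f cancel(1), where v = v]
      word_eval_append[OF f cancel(1), where v = "[(x, e), (x, \<not> e)] @ v"] by auto
next
  case (rel r s u v)
  then show ?case by (simp add: word_eval_append[of X] f R)
qed auto

text \<open>Von Dyck's theorem, existence part.\<close>

lemma
  assumes f: "\<And>x. x \<in> X \<Longrightarrow> f x \<in> carrier G"
    and R: "\<And>r s. (r, s) \<in> R \<Longrightarrow> r \<in> words X \<Longrightarrow> s \<in> words X \<Longrightarrow>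
      word_eval G f r = word_eval G f s"
  shows pres_lift_class:
      "w \<in> words X \<Longrightarrow> pres_lift G f (pres_rel X R `` {w}) = word_eval G f w"
    and pres_lift_hom: "pres_lift G f \<in> hom (presented_group X R) G"
proof -
  show cl: "pres_lift G f (pres_rel X R `` {w}) = word_eval G f w" if "w \<in> words X" for w
  proof -
    have "w \<in> pres_rel X R `` {w}" using that by (simp add: pres_rel.refl)
    then have "(w, SOME v. v \<in> pres_rel X R `` {w}) \<in> pres_rel X R"
      by (metis Image_singleton_iff someI)
    then have "word_eval G f w = word_eval G f (SOME v. v \<in> pres_rel X R `` {w})"
      by (rule word_eval_pres_rel) (fact f, rule R)
    then show ?thesis by (simp add: pres_lift_def)
  qed
  show "pres_lift G f \<in> hom (presented_group X R) G"
  proof (rule homI)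
    fix A B
    assume "A \<in> carrier (presented_group X R)"
    then obtain u where u: "u \<in> words X" "A = pres_rel X R `` {u}" by (rule presented_groupE)
    then show "pres_lift G f A \<in> carrier G" by (simp add: cl word_eval_closed[OF f])
    assume "B \<in> carrier (presented_group X R)"
    then obtain v where v: "v \<in> words X" "B = pres_rel X R `` {v}" by (rule presented_groupE)
    show "pres_lift G f (A \<otimes>\<^bsub>presented_group X R\<^esub> B) = pres_lift G f A \<otimes> pres_lift G f B"
      using u v by (simp add: presented_group_mult cl word_eval_append[OF f])
  qed
qed

text \<open>Uniqueness counterpart of the lift: questions about homomorphisms reduce to their values
  on generators.\<close>

lemma hom_presented_group:
  assumes h: "h \<in> hom (presented_group X R) G" and w: "w \<in> words X"
  shows "h (pres_rel X R `` {w}) = word_eval G (\<lambda>x. h (pres_rel X R `` {letter x})) w"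
  using w
proof (induction w)
  case Nil
  interpret h: group_hom "presented_group X R" G h
    using h group_presented_group is_group by (simp add: group_hom_def group_hom_axioms_def)
  show ?case using h.hom_one by (simp add: presented_group_one)
next
  case (Cons p w)
  interpret h: group_hom "presented_group X R" G h
    using h group_presented_group is_group by (simp add: group_hom_def group_hom_axioms_def)
  obtain x e where p: "p = (x, e)" by force
  have xw: "x \<in> X" "w \<in> words X" using Cons.prems p by auto
  have "h (pres_rel X R `` {p # w}) =
      h (pres_rel X R `` {[(x, e)]} \<otimes>\<^bsub>presented_group X R\<^esub> pres_rel X R `` {w})"
    using xw presented_group_mult[of "[(x, e)]" X w R] p by simp
  also have "\<dots> = h (pres_rel X R `` {[(x, e)]}) \<otimes> h (pres_rel X R `` {w})"
    using xw by (simp add: presented_groupI)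
  also have "h (pres_rel X R `` {[(x, e)]}) =
      (if e then h (pres_rel X R `` {letter x}) else inv h (pres_rel X R `` {letter x}))"
  proof (cases e)
    case False
    have "pres_rel X R `` {[(x, False)]} \<otimes>\<^bsub>presented_group X R\<^esub> pres_rel X R `` {letter x} =
        \<one>\<^bsub>presented_group X R\<^esub>"
      using xw pres_rel_winv_left[of "letter x" X R]
      by (simp add: presented_group_mult presented_group_one letter_def winv_def
          equiv_class_eq[OF equiv_pres_rel])
    then have "h (pres_rel X R `` {[(x, False)]}) \<otimes> h (pres_rel X R `` {letter x}) = \<one>"
      using xw by (metis h.hom_mult h.hom_one presented_groupI words_letter fst_conv words_Cons words_Nil)
    then show ?thesis
      using False xw inv_equality by (simp add: presented_groupI)
  qed (simp add: letter_def)
  finally show ?case using Cons.IH xw p by simp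
qed

lemma hom_presented_group_respects:
  assumes h: "h \<in> hom (presented_group X R) G"
    and "(r, s) \<in> R" "r \<in> words X" "s \<in> words X"
  shows "word_eval G (\<lambda>x. h (pres_rel X R `` {letter x})) r =
    word_eval G (\<lambda>x. h (pres_rel X R `` {letter x})) s"
proof -
  have "(r, s) \<in> pres_rel X R"
    using pres_rel.rel[of r s R X "[]" "[]"] assms by simp
  then show ?thesis
    using hom_presented_group[OF h] assms(3,4) equiv_class_eq[OF equiv_pres_rel] by metis
qed

end

section \<open>A nilpotent model\<close>

text \<open>Counts the exchanges of noncommuting letters when two normal forms are multiplied. It is
  an empty sum for \<open>g = 0\<close>.\<close>

definition pairing :: "nat \<Rightarrow> (nat \<Rightarrow> int) \<Rightarrow> (nat \<Rightarrow> int) \<Rightarrow> int" where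
  "pairing g f h = (\<Sum>i = 1..g. f i * h i)"

definition unit_vec :: "nat \<Rightarrow> nat \<Rightarrow> int" where
  "unit_vec j = (\<lambda>i. if i = j then 1 else 0)"

lemma pairing_bilinear [simp]:
  "pairing g (\<lambda>i. f i + f' i) h = pairing g f h + pairing g f' h"
  "pairing g f (\<lambda>i. h i + h' i) = pairing g f h + pairing g f h'"
  "pairing g (\<lambda>i. - f i) h = - pairing g f h"
  "pairing g f (\<lambda>i. - h i) = - pairing g f h"
  "pairing g (\<lambda>i. 0) h = 0"
  "pairing g f (\<lambda>i. 0) = 0"
  by (simp_all add: pairing_def algebra_simps sum.distrib sum_negf)

lemma pairing_unit [simp]:
  assumes "j \<in> {1..g}"
  shows "pairing g (unit_vec j) f = f j" "pairing g f (unit_vec j) = f j"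
proof -
  have "(\<Sum>i = 1..g. (if i = j then f i else 0)) = f j"
    using assms by (subst sum.delta) auto
  moreover have "pairing g (unit_vec j) f = (\<Sum>i = 1..g. (if i = j then f i else 0))"
    "pairing g f (unit_vec j) = (\<Sum>i = 1..g. (if i = j then f i else 0))"
    unfolding pairing_def unit_vec_def by (intro sum.cong; simp)+
  ultimately show "pairing g (unit_vec j) f = f j" "pairing g f (unit_vec j) = f j" by simp_all
qed

lemma unit_vec_eval [simp]: "unit_vec j j = 1" "i \<noteq> j \<Longrightarrow> unit_vec j i = 0"
  by (simp_all add: unit_vec_def)

text \<open>The exponents of $\sigma, \zeta, a_i, b_i, \tilde a_i, \tilde b_i$ in the normal form of an element
  of the quotient of $B_{k,n}(\widehat\Sigma_g)/\Gamma_3$ in which the $\tilde\sigma_i$ are trivial. There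
  $\sigma$ and $\zeta$ are central and the other nontrivial commutators of generators are
  $[a_i,b_i] = \sigma^2$, $[\tilde a_i,b_i] = \zeta$ and $[\tilde b_i,a_i] = \zeta^{-1}$.\<close>

datatype heis =
  Heis (h_s: int) (h_z: int) (h_a: "nat \<Rightarrow> int") (h_b: "nat \<Rightarrow> int")
    (h_ta: "nat \<Rightarrow> int") (h_tb: "nat \<Rightarrow> int")

text \<open>The pairings arise from collecting a product in the order sigma, zeta, a, b,
  \<open>TGA\<close>, \<open>TGB\<close>. Moving b_i^l past a_i^m costs sigma^(-2lm), moving a power
  l of \<open>TGA i\<close> past b_i^m costs zeta^(lm), and moving a power l of \<open>TGB i\<close>
  past a_i^m costs zeta^(-lm).\<close>

definition heis_group :: "nat \<Rightarrow> heis monoid" where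
  "heis_group g =
    \<lparr>carrier = UNIV,
     mult = (\<lambda>x y. Heis (h_s x + h_s y - 2 * pairing g (h_b x) (h_a y))
       (h_z x + h_z y + pairing g (h_ta x) (h_b y) - pairing g (h_tb x) (h_a y))
       (\<lambda>i. h_a x i + h_a y i) (\<lambda>i. h_b x i + h_b y i)
       (\<lambda>i. h_ta x i + h_ta y i) (\<lambda>i. h_tb x i + h_tb y i)),
     one = Heis 0 0 (\<lambda>i. 0) (\<lambda>i. 0) (\<lambda>i. 0) (\<lambda>i. 0)\<rparr>"

lemma carrier_heis [simp]: "carrier (heis_group g) = UNIV"
  by (simp add: heis_group_def)

lemma mult_heis [simp]:
  "x \<otimes>\<^bsub>heis_group g\<^esub> y = Heis (h_s x + h_s y - 2 * pairing g (h_b x) (h_a y))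
       (h_z x + h_z y + pairing g (h_ta x) (h_b y) - pairing g (h_tb x) (h_a y))
       (\<lambda>i. h_a x i + h_a y i) (\<lambda>i. h_b x i + h_b y i)
       (\<lambda>i. h_ta x i + h_ta y i) (\<lambda>i. h_tb x i + h_tb y i)"
  by (simp add: heis_group_def)

lemma one_heis [simp]:
  "\<one>\<^bsub>heis_group g\<^esub> = Heis 0 0 (\<lambda>i. 0) (\<lambda>i. 0) (\<lambda>i. 0) (\<lambda>i. 0)"
  by (simp add: heis_group_def)

lemma group_heis [simp, intro]: "group (heis_group g)"
proof (rule groupI)
  fix x :: heis
  show "\<exists>y\<in>carrier (heis_group g). y \<otimes>\<^bsub>heis_group g\<^esub> x = \<one>\<^bsub>heis_group g\<^esub>"
    \<comment> \<open>Negating the linear exponents leaves self-pairings of \<open>x\<close>, which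
      the first two coordinates compensate.\<close>
    by (rule bexI[of _ "Heis (- h_s x - 2 * pairing g (h_b x) (h_a x))
       (- h_z x + pairing g (h_ta x) (h_b x) - pairing g (h_tb x) (h_a x))
       (\<lambda>i. - h_a x i) (\<lambda>i. - h_b x i) (\<lambda>i. - h_ta x i) (\<lambda>i. - h_tb x i)"]) simp_all
qed (simp_all add: heis.expand algebra_simps)

lemma inv_heis [simp]:
  "inv\<^bsub>heis_group g\<^esub> x = Heis (- h_s x - 2 * pairing g (h_b x) (h_a x))
       (- h_z x + pairing g (h_ta x) (h_b x) - pairing g (h_tb x) (h_a x))
       (\<lambda>i. - h_a x i) (\<lambda>i. - h_b x i) (\<lambda>i. - h_ta x i) (\<lambda>i. - h_tb x i)"
  by (rule group.inv_equality) simp_all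

lemma heis_pow_s: "Heis 1 0 (\<lambda>i. 0) (\<lambda>i. 0) (\<lambda>i. 0) (\<lambda>i. 0) [^]\<^bsub>heis_group g\<^esub> (p :: int) =
    Heis p 0 (\<lambda>i. 0) (\<lambda>i. 0) (\<lambda>i. 0) (\<lambda>i. 0)" (is "?x [^]\<^bsub>_\<^esub> _ = ?h p")
  and heis_pow_z: "Heis 0 1 (\<lambda>i. 0) (\<lambda>i. 0) (\<lambda>i. 0) (\<lambda>i. 0) [^]\<^bsub>heis_group g\<^esub> (p :: int) =
    Heis 0 p (\<lambda>i. 0) (\<lambda>i. 0) (\<lambda>i. 0) (\<lambda>i. 0)" (is "?y [^]\<^bsub>_\<^esub> _ = ?h' p")
proof -
  have n: "?x [^]\<^bsub>heis_group g\<^esub> m = ?h (int m)" "?y [^]\<^bsub>heis_group g\<^esub> m = ?h' (int m)" for m :: nat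
    by (induction m) simp_all
  show "?x [^]\<^bsub>heis_group g\<^esub> p = ?h p" "?y [^]\<^bsub>heis_group g\<^esub> p = ?h' p"
    by (simp_all add: int_pow_def2 n)
qed

text \<open>Since only exponents of fibre elements have to be detected, \<open>TSig\<close> may be
  sent to 1. The base relation between \<open>TGA i\<close>, \<open>TSig 1\<close> and
  \<open>TGB i\<close> then says that the two handle generators commute, as they do in the
  model.\<close>

fun heis_gen :: "braid_gen \<Rightarrow> heis" where
  "heis_gen (Sig i) = Heis 1 0 (\<lambda>i. 0) (\<lambda>i. 0) (\<lambda>i. 0) (\<lambda>i. 0)"
| "heis_gen (Zeta i) = Heis 0 1 (\<lambda>i. 0) (\<lambda>i. 0) (\<lambda>i. 0) (\<lambda>i. 0)"
| "heis_gen (GA i) = Heis 0 0 (unit_vec i) (\<lambda>i. 0) (\<lambda>i. 0) (\<lambda>i. 0)"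
| "heis_gen (GB i) = Heis 0 0 (\<lambda>i. 0) (unit_vec i) (\<lambda>i. 0) (\<lambda>i. 0)"
| "heis_gen (TSig i) = Heis 0 0 (\<lambda>i. 0) (\<lambda>i. 0) (\<lambda>i. 0) (\<lambda>i. 0)"
| "heis_gen (TGA i) = Heis 0 0 (\<lambda>i. 0) (\<lambda>i. 0) (unit_vec i) (\<lambda>i. 0)"
| "heis_gen (TGB i) = Heis 0 0 (\<lambda>i. 0) (\<lambda>i. 0) (\<lambda>i. 0) (unit_vec i)"

lemma words_UNIV [simp]: "w \<in> words UNIV"
  by (simp add: words_def)

lemma heis_eval:
  "word_eval (heis_group g) heis_gen (u @ v) =
    word_eval (heis_group g) heis_gen u \<otimes>\<^bsub>heis_group g\<^esub> word_eval (heis_group g) heis_gen v"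
  "word_eval (heis_group g) heis_gen (winv u) =
    inv\<^bsub>heis_group g\<^esub> word_eval (heis_group g) heis_gen u"
  "word_eval (heis_group g) heis_gen (letter x) = heis_gen x"
  by (rule group.word_eval_append[where X = UNIV] group.word_eval_winv[where X = UNIV]
      group.word_eval_letter; simp)+

text \<open>Each relation becomes an identity of exponents. Three families dictate the constants:
  a_i sigma_1 b_i = sigma_1 b_i sigma_1 a_i sigma_1 gives the factor 2, and the relations of
  \<open>TGA i\<close> with b_i and of \<open>TGB i\<close> with a_i give the two signs of
  zeta.\<close>

lemma heis_total_rels:
  assumes "(r, s) \<in> total_rels g k n"
  shows "word_eval (heis_group g) heis_gen r = word_eval (heis_group g) heis_gen s"
proof -
  note eval = heis_eval commute_def wconj_def wcomm_def
  consider "(r, s) \<in> fibre_rels g k n" | "(r, s) \<in> base_rels g n"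
    | "(r, s) \<in> mixed_rels sw aw bw zw tsw taw tbw g k n"
    using assms by (auto simp: total_rels_def)
  then show ?thesis
  proof cases
    case 1
    then show ?thesis
      unfolding fibre_rels_def surface_rels_def Let_def
      by (elim UnE) (auto simp: eval algebra_simps)
  next
    case 2
    then show ?thesis
      unfolding base_rels_def surface_rels_def Let_def
      by (elim UnE) (auto simp: eval algebra_simps)
  next
    case 3
    then show ?thesis
      unfolding mixed_rels_def Let_def
      by (elim UnE) (auto simp: eval algebra_simps)
  qed
qed

text \<open>The four exponent functions are additive, so they vanish on commutators.\<close>

lemma lower_central_heis:
  "x \<in> lower_central (heis_group g) (Suc (Suc i)) \<Longrightarrow> h_a x = (\<lambda>_. 0) \<and> h_b x = (\<lambda>_. 0) \<and>
    h_ta x = (\<lambda>_. 0) \<and> h_tb x = (\<lambda>_. 0)"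
  unfolding lower_central.simps
proof (induction rule: generate.induct)
qed auto

text \<open>Elements of Gamma_2 have nothing left to pair with, so their commutators are trivial.
  For \<open>g = 0\<close> the group is already abelian.\<close>

lemma lower_central_heis_trivial:
  assumes "i = 3 \<or> i = 2 \<and> g = 0"
  shows "lower_central (heis_group g) i = {\<one>\<^bsub>heis_group g\<^esub>}"
proof -
  have "x = \<one>\<^bsub>heis_group g\<^esub>"
    if "x \<in> lower_central (heis_group g) i" for x
  proof -
    obtain j where j: "i = Suc (Suc j)" "j = 1 \<or> j = 0 \<and> g = 0"
      using assms by (auto simp: numeral_eq_Suc)
    have c: "y \<otimes>\<^bsub>heis_group g\<^esub> z \<otimes>\<^bsub>heis_group g\<^esub> inv\<^bsub>heis_group g\<^esub> y \<otimes>\<^bsub>heis_group g\<^esub>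
        inv\<^bsub>heis_group g\<^esub> z = \<one>\<^bsub>heis_group g\<^esub>"
      if "z \<in> lower_central (heis_group g) (Suc j)" for y z
    proof (cases "g = 0")
      case True
      then show ?thesis by (simp add: pairing_def)
    next
      case False
      then have "z \<in> lower_central (heis_group g) (Suc (Suc 0))"
        using j that by simp
      then show ?thesis
        using lower_central_heis[of z g 0] by simp
    qed
    from that show ?thesis
      unfolding j(1) lower_central.simps
      by (induction rule: generate.induct) (use c in auto)
  qed
  moreover have "\<one>\<^bsub>heis_group g\<^esub> \<in> lower_central (heis_group g) i"
    using group.normal_lower_central[OF group_heis] normal_imp_subgroup subgroup.one_closed
    by blast
  ultimately show ?thesis by blast
qed

section \<open>Normal forms in the target group\<close>

context group
begin

lemma commutes_mult:
  assumes "x \<otimes> y = y \<otimes> x" "x \<otimes> z = z \<otimes> x" "x \<in> carrier G" "y \<in> carrier G" "z \<in> carrier G"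
  shows "x \<otimes> (y \<otimes> z) = (y \<otimes> z) \<otimes> x"
  using assms by (metis m_assoc)

text \<open>Conjugation by \<open>x\<close> is a homomorphism sending \<open>y\<close> to
  \<open>t \<otimes> y\<close>, and powers of this product split because \<open>t\<close> and
  \<open>y\<close> commute.\<close>

lemma int_pow_twist:
  assumes xy: "x \<otimes> y = t \<otimes> (y \<otimes> x)" and ty: "t \<otimes> y = y \<otimes> t"
    and car: "x \<in> carrier G" "y \<in> carrier G" "t \<in> carrier G"
  shows "x \<otimes> y [^] (l :: int) = t [^] l \<otimes> (y [^] l \<otimes> x)"
proof -
  interpret c: group_hom G G "\<lambda>w. x \<otimes> w \<otimes> inv x"
    using car by unfold_locales (auto intro!: homI simp: m_assoc inv_solve_left)
  have "x \<otimes> y \<otimes> inv x = t \<otimes> y"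
    using xy car by (simp add: m_assoc)
  then have "x \<otimes> y [^] l \<otimes> inv x = t [^] l \<otimes> y [^] l"
    using c.hom_int_pow[of y l] int_pow_mult_distrib[OF ty, of l] car by simp
  then show ?thesis
    using car by (metis int_pow_closed inv_solve_right' m_assoc m_closed)
qed

lemma commutes_int_pow:
  assumes "x \<otimes> y = y \<otimes> x" "x \<in> carrier G" "y \<in> carrier G"
  shows "x \<otimes> y [^] (l :: int) = y [^] l \<otimes> x"
  using int_pow_twist[of x y \<one> l] assms by simp

end

lemma (in group) int_pow_mult_assoc:
  "x \<in> carrier G \<Longrightarrow> y \<in> carrier G \<Longrightarrow> x [^] (p :: int) \<otimes> (x [^] (q :: int) \<otimes> y) = x [^] (p + q) \<otimes> y"
  by (simp add: int_pow_mult m_assoc)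

text \<open>The relations that hold between the images of sigma, zeta, a_i, b_i under a homomorphism
  constant on the sigma_i and on the zeta_j. They are those of the part of the model with vanishing
  \<open>h_ta\<close> and \<open>h_tb\<close>, which \<open>theta\<close> maps to the
  target.\<close>

locale heis_family = group G for G (structure) +
  fixes s z :: 'a and a b :: "nat \<Rightarrow> 'a" and g :: nat
  assumes closed [simp]: "s \<in> carrier G" "z \<in> carrier G"
      "\<And>i. i \<in> {1..g} \<Longrightarrow> a i \<in> carrier G" "\<And>i. i \<in> {1..g} \<Longrightarrow> b i \<in> carrier G"
    and s_commutes: "s \<otimes> z = z \<otimes> s" "\<And>i. i \<in> {1..g} \<Longrightarrow> s \<otimes> a i = a i \<otimes> s"
      "\<And>i. i \<in> {1..g} \<Longrightarrow> s \<otimes> b i = b i \<otimes> s"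
    and z_commutes: "\<And>i. i \<in> {1..g} \<Longrightarrow> z \<otimes> a i = a i \<otimes> z"
      "\<And>i. i \<in> {1..g} \<Longrightarrow> z \<otimes> b i = b i \<otimes> z"
    and ab: "\<And>i. i \<in> {1..g} \<Longrightarrow> a i \<otimes> b i = s \<otimes> s \<otimes> (b i \<otimes> a i)"
    and distinct_commute: "\<And>i j x y. \<lbrakk>i \<in> {1..g}; j \<in> {1..g}; i < j; x \<in> {a i, b i}; y \<in> {a j, b j}\<rbrakk>
      \<Longrightarrow> x \<otimes> y = y \<otimes> x"
begin

primrec ab_prod :: "nat \<Rightarrow> (nat \<Rightarrow> int) \<Rightarrow> (nat \<Rightarrow> int) \<Rightarrow> 'a" where
  "ab_prod 0 f h = \<one>"
| "ab_prod (Suc n) f h = ab_prod n f h \<otimes> (a (Suc n) [^] f (Suc n) \<otimes> b (Suc n) [^] h (Suc n))"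

definition theta :: "heis \<Rightarrow> 'a" where
  "theta x = s [^] h_s x \<otimes> z [^] h_z x \<otimes> ab_prod g (h_a x) (h_b x)"

lemma ab_prod_closed [simp]: "n \<le> g \<Longrightarrow> ab_prod n f h \<in> carrier G"
  by (induction n) auto

lemma ab_prod_commutes:
  assumes "n \<le> g" "x \<in> carrier G"
    and "\<And>i. i \<in> {1..n} \<Longrightarrow> x \<otimes> a i = a i \<otimes> x" "\<And>i. i \<in> {1..n} \<Longrightarrow> x \<otimes> b i = b i \<otimes> x"
  shows "x \<otimes> ab_prod n f h = ab_prod n f h \<otimes> x"
  using assms
proof (induction n)
  case (Suc n)
  have "x \<otimes> ab_prod n f h = ab_prod n f h \<otimes> x" using Suc by auto
  moreover have "x \<otimes> a (Suc n) [^] f (Suc n) = a (Suc n) [^] f (Suc n) \<otimes> x"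
    "x \<otimes> b (Suc n) [^] h (Suc n) = b (Suc n) [^] h (Suc n) \<otimes> x"
    using Suc.prems by (auto intro!: commutes_int_pow)
  ultimately show ?case
    using Suc.prems by (auto intro!: commutes_mult)
qed simp

text \<open>Two twists: passing a single a_i across b_i^l produces (s s)^l, and read backwards this
  is the twist (s s)^(-l) for carrying b_i^l across the powers of a_i.\<close>

lemma ab_block_mult:
  fixes m l m' l' :: int
  assumes i: "i \<in> {1..g}"
  shows "(a i [^] m \<otimes> b i [^] l) \<otimes> (a i [^] m' \<otimes> b i [^] l') =
    s [^] (- 2 * (l * m')) \<otimes> (a i [^] (m + m') \<otimes> b i [^] (l + l'))"
proof -
  let ?t = "s \<otimes> s" and ?A = "a i" and ?B = "b i"
  have car: "?A \<in> carrier G" "?B \<in> carrier G" using i by auto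
  have t: "?t \<otimes> x = x \<otimes> ?t" if "x \<in> carrier G" "s \<otimes> x = x \<otimes> s" for x
    by (rule commutes_mult[OF that(2)[symmetric] that(2)[symmetric] that(1) closed(1) closed(1),
          symmetric])
  have 1: "?A \<otimes> ?B [^] l = ?t [^] l \<otimes> (?B [^] l \<otimes> ?A)"
    using int_pow_twist[OF ab[OF i] t] car s_commutes i by simp
  have "?t [^] l \<otimes> ?A = ?A \<otimes> ?t [^] l"
    using commutes_int_pow[of ?A ?t l] t[of ?A] car s_commutes i by simp
  then have "inv (?t [^] l) \<otimes> ?A = ?A \<otimes> inv (?t [^] l)"
    using car by (metis inv_closed inv_solve_left' inv_solve_right' closed(1) int_pow_closed m_assoc m_closed)
  moreover have "?B [^] l \<otimes> ?A = inv (?t [^] l) \<otimes> (?A \<otimes> ?B [^] l)"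
    unfolding 1 using car by (simp add: m_assoc[symmetric])
  ultimately have 2: "?B [^] l \<otimes> ?A [^] m' = inv (?t [^] l) [^] m' \<otimes> (?A [^] m' \<otimes> ?B [^] l)"
    using car by (intro int_pow_twist) auto
  have "?t = s [^] (2 :: int)"
    using int_pow_mult[of s 1 1] by simp
  then have 3: "inv (?t [^] l) [^] m' = s [^] (- 2 * (l * m'))"
    by (simp add: int_pow_neg[symmetric] int_pow_pow mult.assoc)
  have 4: "s [^] p \<otimes> ?A [^] m = ?A [^] m \<otimes> s [^] p" for p :: int
    using car i s_commutes by (intro commutes_int_pow) (auto intro: commutes_int_pow[symmetric])
  have "(?A [^] m \<otimes> ?B [^] l) \<otimes> (?A [^] m' \<otimes> ?B [^] l') =
      ?A [^] m \<otimes> (?B [^] l \<otimes> ?A [^] m') \<otimes> ?B [^] l'"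
    using car by (simp add: m_assoc)
  also have "\<dots> = s [^] (- 2 * (l * m')) \<otimes> ?A [^] m \<otimes> ?A [^] m' \<otimes> (?B [^] l \<otimes> ?B [^] l')"
    unfolding 2 3 4 using car by (simp add: m_assoc)
  finally show ?thesis
    using car by (simp add: int_pow_mult m_assoc)
qed

text \<open>The last block of the first product moves freely past all blocks of smaller index in the
  second, so corrections occur only between blocks of equal index and add up to the pairing.\<close>

lemma ab_prod_mult:
  assumes "n \<le> g"
  shows "ab_prod n f h \<otimes> ab_prod n f' h' =
    s [^] (- 2 * pairing n h f') \<otimes> ab_prod n (\<lambda>i. f i + f' i) (\<lambda>i. h i + h' i)"
  using assms
proof (induction n)
  case 0
  then show ?case by (simp add: pairing_def)
next
  case (Suc n)
  let ?N = "Suc n"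
  have N: "?N \<in> {1..g}" using Suc.prems by auto
  define P P' R where "P = ab_prod n f h" and "P' = ab_prod n f' h'"
    and "R = ab_prod n (\<lambda>i. f i + f' i) (\<lambda>i. h i + h' i)"
  define A A' C where "A = a ?N [^] f ?N \<otimes> b ?N [^] h ?N" and "A' = a ?N [^] f' ?N \<otimes> b ?N [^] h' ?N"
    and "C = a ?N [^] (f ?N + f' ?N) \<otimes> b ?N [^] (h ?N + h' ?N)"
  have car: "P \<in> carrier G" "P' \<in> carrier G" "R \<in> carrier G" "A \<in> carrier G" "A' \<in> carrier G"
    "C \<in> carrier G"
    using N Suc.prems by (auto simp: P_def P'_def R_def A_def A'_def C_def)
  have ca: "a ?N \<otimes> P' = P' \<otimes> a ?N" "b ?N \<otimes> P' = P' \<otimes> b ?N"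
    unfolding P'_def using N Suc.prems
    by (intro ab_prod_commutes; force intro: distinct_commute[symmetric])+
  have AP': "P' \<otimes> A = A \<otimes> P'"
    unfolding A_def using ca N car by (intro commutes_mult commutes_int_pow) auto
  have sR: "s [^] p \<otimes> R = R \<otimes> s [^] p" for p :: int
    unfolding R_def using Suc.prems s_commutes
    by (intro commutes_int_pow[symmetric] ab_prod_commutes[symmetric]) auto
  have "ab_prod ?N f h \<otimes> ab_prod ?N f' h' = P \<otimes> (A \<otimes> P') \<otimes> A'"
    using car by (simp add: m_assoc P_def P'_def A_def A'_def)
  also have "\<dots> = (P \<otimes> P') \<otimes> (A \<otimes> A')"
    unfolding AP'[symmetric] using car by (simp add: m_assoc)
  also have "P \<otimes> P' = s [^] (- 2 * pairing n h f') \<otimes> R"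
    using Suc by (simp add: P_def P'_def R_def)
  also have "A \<otimes> A' = s [^] (- 2 * (h ?N * f' ?N)) \<otimes> C"
    unfolding A_def A'_def C_def by (rule ab_block_mult[OF N])
  also have "s [^] (- 2 * pairing n h f') \<otimes> R \<otimes> (s [^] (- 2 * (h ?N * f' ?N)) \<otimes> C) =
      s [^] (- 2 * pairing n h f') \<otimes> (R \<otimes> s [^] (- 2 * (h ?N * f' ?N))) \<otimes> C"
    using car by (simp add: m_assoc)
  also have "\<dots> = s [^] (- 2 * pairing n h f' + - 2 * (h ?N * f' ?N)) \<otimes> (R \<otimes> C)"
    unfolding sR[symmetric] using car by (simp add: m_assoc int_pow_mult_assoc)
  also have "- 2 * pairing n h f' + - 2 * (h ?N * f' ?N) = - 2 * pairing ?N h f'"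
    by (simp add: pairing_def)
  finally show ?case by (simp add: R_def C_def)
qed

lemma theta_closed [simp]: "theta x \<in> carrier G"
  by (simp add: theta_def)

text \<open>The zeta-coordinate of a product contains pairings with \<open>h_ta x\<close> and
  \<open>h_tb x\<close>, which have no counterpart in the target; hence the condition on the left
  factor.\<close>

lemma theta_mult:
  assumes "h_ta x = (\<lambda>_. 0)" "h_tb x = (\<lambda>_. 0)"
  shows "theta (x \<otimes>\<^bsub>heis_group g\<^esub> y) = theta x \<otimes> theta y"
proof -
  define P P' R where "P = ab_prod g (h_a x) (h_b x)" and "P' = ab_prod g (h_a y) (h_b y)"
    and "R = ab_prod g (\<lambda>i. h_a x i + h_a y i) (\<lambda>i. h_b x i + h_b y i)"
  have car: "P \<in> carrier G" "P' \<in> carrier G" "R \<in> carrier G"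
    by (simp_all add: P_def P'_def R_def)
  have PP': "P \<otimes> P' = s [^] (- 2 * pairing g (h_b x) (h_a y)) \<otimes> R"
    unfolding P_def P'_def R_def by (rule ab_prod_mult) simp
  have s: "s [^] p \<otimes> P = P \<otimes> s [^] p" and z: "z [^] p \<otimes> P = P \<otimes> z [^] p"
    and sz: "s [^] p \<otimes> z [^] q = z [^] q \<otimes> s [^] p" for p q :: int
    unfolding P_def using s_commutes z_commutes
    by (auto intro!: commutes_int_pow commutes_int_pow[symmetric] ab_prod_commutes[symmetric])
  have "theta x \<otimes> theta y =
      s [^] h_s x \<otimes> z [^] h_z x \<otimes> (P \<otimes> s [^] h_s y) \<otimes> z [^] h_z y \<otimes> P'"
    using car by (simp add: theta_def m_assoc P_def[symmetric] P'_def[symmetric])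
  also have "\<dots> = s [^] h_s x \<otimes> (z [^] h_z x \<otimes> s [^] h_s y) \<otimes> (P \<otimes> z [^] h_z y) \<otimes> P'"
    unfolding s[symmetric] using car by (simp add: m_assoc)
  also have "\<dots> = s [^] h_s x \<otimes> s [^] h_s y \<otimes> z [^] h_z x \<otimes> z [^] h_z y \<otimes> (P \<otimes> P')"
    unfolding z[symmetric] sz[symmetric] using car by (simp add: m_assoc)
  also have "\<dots> = s [^] h_s x \<otimes> s [^] h_s y \<otimes> (z [^] (h_z x + h_z y) \<otimes>
      s [^] (- 2 * pairing g (h_b x) (h_a y))) \<otimes> R"
    unfolding PP' using car by (simp add: m_assoc int_pow_mult)
  also have "\<dots> = s [^] (h_s x + h_s y + - 2 * pairing g (h_b x) (h_a y)) \<otimes>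
      z [^] (h_z x + h_z y) \<otimes> R"
    unfolding sz[symmetric] using car by (simp add: m_assoc int_pow_mult_assoc add_diff_eq)
  finally show ?thesis
    using assms by (simp add: theta_def R_def)
qed

lemma ab_prod_0 [simp]: "n \<le> g \<Longrightarrow> ab_prod n (\<lambda>_. 0) (\<lambda>_. 0) = \<one>"
  by (induction n) auto

lemma theta_central: "theta (Heis p q (\<lambda>_. 0) (\<lambda>_. 0) c d) = s [^] p \<otimes> z [^] q"
  by (simp add: theta_def)

lemma theta_unit:
  assumes "i \<in> {1..g}"
  shows "theta (Heis 0 0 (unit_vec i) (\<lambda>_. 0) c d) = a i"
    and "theta (Heis 0 0 (\<lambda>_. 0) (unit_vec i) c d) = b i"
proof -
  have "ab_prod n (unit_vec i) (\<lambda>_. 0) = (if i \<le> n then a i else \<one>) \<and>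
      ab_prod n (\<lambda>_. 0) (unit_vec i) = (if i \<le> n then b i else \<one>)" if "n \<le> g" for n
    using that
  proof (induction n)
    case (Suc n)
    then show ?case using assms by (cases "i = Suc n") auto
  qed (use assms in auto)
  then show "theta (Heis 0 0 (unit_vec i) (\<lambda>_. 0) c d) = a i"
    "theta (Heis 0 0 (\<lambda>_. 0) (unit_vec i) c d) = b i"
    using assms by (simp_all add: theta_def)
qed

text \<open>The value of a word depends only on its exponents in the model. Letters are split off on
  the left, so the left factor always satisfies the condition of \<open>theta_mult\<close>.\<close>

lemma theta_word_eval:
  assumes w: "w \<in> words (fibre_gens g k n)"
    and f: "\<And>i. i \<in> {1..<k} \<Longrightarrow> f (Sig i) = s" "\<And>i. i \<in> {1..n} \<Longrightarrow> f (Zeta i) = z"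
      "\<And>i. i \<in> {1..g} \<Longrightarrow> f (GA i) = a i" "\<And>i. i \<in> {1..g} \<Longrightarrow> f (GB i) = b i"
  shows "theta (word_eval (heis_group g) heis_gen w) = word_eval G f w"
  using w
proof (induction w)
  case Nil
  then show ?case by (simp add: theta_central)
next
  case (Cons p w)
  obtain x e where p: "p = (x, e)" by force
  define X where "X = heis_gen x"
  have x: "x \<in> fibre_gens g k n" using Cons.prems p by auto
  then have X: "h_ta X = (\<lambda>_. 0)" "h_tb X = (\<lambda>_. 0)" "theta X = f x"
    by (auto simp: fibre_gens_def X_def theta_central theta_unit f)
  have "theta (inv\<^bsub>heis_group g\<^esub> X \<otimes>\<^bsub>heis_group g\<^esub> X) = theta (inv\<^bsub>heis_group g\<^esub> X) \<otimes> theta X"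
    by (rule theta_mult) (simp_all add: X)
  moreover have "theta (inv\<^bsub>heis_group g\<^esub> X \<otimes>\<^bsub>heis_group g\<^esub> X) = \<one>"
    by (simp only: group.l_inv group_heis carrier_heis UNIV_I) (simp add: theta_central)
  ultimately have "theta (inv\<^bsub>heis_group g\<^esub> X) \<otimes> theta X = \<one>" by simp
  then have inv: "theta (inv\<^bsub>heis_group g\<^esub> X) = inv f x"
    using inv_equality[OF _ theta_closed theta_closed] X(3) by metis
  have "theta (word_eval (heis_group g) heis_gen (p # w)) =
      theta (if e then X else inv\<^bsub>heis_group g\<^esub> X) \<otimes> theta (word_eval (heis_group g) heis_gen w)"
    unfolding p X_def[symmetric] word_eval.simps by (rule theta_mult) (auto simp: X)
  then show ?case
    using Cons X(3) inv p by auto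
qed

end

section \<open>Homomorphisms from the braid groups\<close>

lemma gens_iff [simp]:
  "Sig i \<in> fibre_gens g k n \<longleftrightarrow> i \<in> {1..<k}" "GA i \<in> fibre_gens g k n \<longleftrightarrow> i \<in> {1..g}"
  "GB i \<in> fibre_gens g k n \<longleftrightarrow> i \<in> {1..g}" "Zeta i \<in> fibre_gens g k n \<longleftrightarrow> i \<in> {1..n}"
  "TSig i \<in> base_gens g n \<longleftrightarrow> i \<in> {1..<n}" "TGA i \<in> base_gens g n \<longleftrightarrow> i \<in> {1..g}"
  "TGB i \<in> base_gens g n \<longleftrightarrow> i \<in> {1..g}"
  by (auto simp: fibre_gens_def base_gens_def)

definition mixed_elem :: "nat \<Rightarrow> nat \<Rightarrow> nat \<Rightarrow> braid_gen \<Rightarrow> braid_gen word set" where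
  "mixed_elem g k n x =
    pres_rel (fibre_gens g k n \<union> base_gens g n) (total_rels g k n) `` {letter x}"

lemma fibre_elem_closed [simp]:
  "x \<in> fibre_gens g k n \<Longrightarrow> fibre_elem g k n x \<in> carrier (fibre_braid_group g k n)"
  by (simp add: fibre_elem_def fibre_braid_group_def presented_groupI)

lemma mixed_elem_closed [simp]:
  "x \<in> fibre_gens g k n \<union> base_gens g n \<Longrightarrow> mixed_elem g k n x \<in> carrier (mixed_braid_group g k n)"
  by (simp add: mixed_elem_def mixed_braid_group_def presented_groupI)

lemma surface_relsI:
  fixes s a b z g k n
  defines "AB \<equiv> a ` {1..g} \<union> b ` {1..g}"
  shows "i \<in> {1..<k} \<Longrightarrow> i \<noteq> 1 \<Longrightarrow> c \<in> AB \<union> z ` {1..n} \<Longrightarrow> commute c (s i) \<in> surface_rels s a b z g k n"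
    and "1 \<le> i \<Longrightarrow> i + 1 < k \<Longrightarrow>
      (s i @ s (i+1) @ s i, s (i+1) @ s i @ s (i+1)) \<in> surface_rels s a b z g k n"
    and "i \<in> {1..g} \<Longrightarrow> 2 \<le> k \<Longrightarrow>
      (a i @ s 1 @ b i, s 1 @ b i @ s 1 @ a i @ s 1) \<in> surface_rels s a b z g k n"
    and "c \<in> {a i, b i} \<Longrightarrow> d \<in> {a j, b j} \<Longrightarrow> i \<in> {1..g} \<Longrightarrow> j \<in> {1..g} \<Longrightarrow> i < j \<Longrightarrow> 2 \<le> k \<Longrightarrow>
      commute (winv (s 1) @ c @ s 1) d \<in> surface_rels s a b z g k n"
    and "i \<in> {1..n} \<Longrightarrow> c \<in> AB \<Longrightarrow> 2 \<le> k \<Longrightarrow>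
      commute (winv (s 1) @ z i @ s 1) c \<in> surface_rels s a b z g k n"
  unfolding surface_rels_def Let_def AB_def
  subgoal by (rule UnI1, rule UnI1, rule UnI1, rule UnI1, rule UnI1, rule UnI2) blast
  subgoal by (rule UnI1, rule UnI1, rule UnI1, rule UnI1, rule UnI1, rule UnI1, rule UnI2) blast
  subgoal by (rule UnI1, rule UnI1, rule UnI1, rule UnI2) blast
  subgoal by (rule UnI1, rule UnI1, rule UnI2) blast
  subgoal by (rule UnI1, rule UnI2) blast
  done

context group
begin

lemma fibre_hom_eval:
  assumes "h \<in> hom (fibre_braid_group g k n) G" "w \<in> words (fibre_gens g k n)"
  shows "h (pres_rel (fibre_gens g k n) (fibre_rels g k n) `` {w}) =
    word_eval G (\<lambda>x. h (fibre_elem g k n x)) w"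
  using hom_presented_group[OF assms[unfolded fibre_braid_group_def]] by (simp add: fibre_elem_def)

lemma fibre_hom_respects:
  assumes "h \<in> hom (fibre_braid_group g k n) G" "(r, s) \<in> fibre_rels g k n"
    "r \<in> words (fibre_gens g k n)" "s \<in> words (fibre_gens g k n)"
  shows "word_eval G (\<lambda>x. h (fibre_elem g k n x)) r = word_eval G (\<lambda>x. h (fibre_elem g k n x)) s"
  using hom_presented_group_respects[OF assms[unfolded fibre_braid_group_def]]
  by (simp add: fibre_elem_def)

lemma mixed_hom_respects:
  assumes "h \<in> hom (mixed_braid_group g k n) G" "(r, s) \<in> total_rels g k n"
    "r \<in> words (fibre_gens g k n \<union> base_gens g n)" "s \<in> words (fibre_gens g k n \<union> base_gens g n)"
  shows "word_eval G (\<lambda>x. h (mixed_elem g k n x)) r = word_eval G (\<lambda>x. h (mixed_elem g k n x)) s"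
  using hom_presented_group_respects[OF assms[unfolded mixed_braid_group_def]]
  by (simp add: mixed_elem_def)

lemma inv_mult_cancel [simp]:
  "x \<in> carrier G \<Longrightarrow> y \<in> carrier G \<Longrightarrow> inv x \<otimes> (x \<otimes> y) = y"
  "x \<in> carrier G \<Longrightarrow> y \<in> carrier G \<Longrightarrow> x \<otimes> (inv x \<otimes> y) = y"
  by (simp_all add: m_assoc[symmetric])

text \<open>Since \<open>k \<ge> 3\<close>, sigma_2 is available and commutes with all a_i, b_i and
  zeta_j; its image is also that of sigma_1, so \<open>s\<close> commutes with all their images.
  Conjugation by sigma_1 then disappears from the remaining relations, which become the plain
  commutations and, after cancelling one \<open>s\<close>, the identity for a_i and b_i.\<close>

lemma fibre_hom_heis_family:
  assumes "k \<ge> 3" "n \<ge> 1" and h: "h \<in> hom (fibre_braid_group g k n) G"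
    and S: "\<And>i. i \<in> {1..<k} \<Longrightarrow> h (fibre_elem g k n (Sig i)) = s"
    and Z: "\<And>i. i \<in> {1..n} \<Longrightarrow> h (fibre_elem g k n (Zeta i)) = z"
  shows "heis_family G s z (\<lambda>i. h (fibre_elem g k n (GA i))) (\<lambda>i. h (fibre_elem g k n (GB i))) g"
proof -
  let ?X = "fibre_gens g k n"
  define f where "f = (\<lambda>x. h (fibre_elem g k n x))"
  have f: "f x \<in> carrier G" if "x \<in> ?X" for x
    using that h unfolding f_def by (blast intro: hom_in_carrier fibre_elem_closed)
  have fS: "f (Sig i) = s" if "i \<in> {1..<k}" for i using S that by (simp add: f_def)
  have fZ: "f (Zeta i) = z" if "i \<in> {1..n}" for i using Z that by (simp add: f_def)
  have s: "s \<in> carrier G" using f[of "Sig 1"] fS[of 1] assms(1) by simp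
  have z: "z \<in> carrier G" using f[of "Zeta 1"] fZ[of 1] assms(2) by simp
  have rel: "word_eval G f r = word_eval G f t"
    if "(r, t) \<in> fibre_rels g k n" "r \<in> words ?X" "t \<in> words ?X" for r t
    unfolding f_def by (rule fibre_hom_respects[OF h that])
  note eval = word_eval_append[of ?X f, OF f] word_eval_winv[of ?X f, OF f]
  have letter: "word_eval G f (letter x) = f x" if "x \<in> ?X" for x
    using that f by (simp add: word_eval_letter)
  have sx: "s \<otimes> f c = f c \<otimes> s" if "c \<in> ?X" "letter c \<in> aw ` {1..g} \<union> bw ` {1..g} \<union> zw ` {1..n}" for c
  proof -
    have "commute (letter c) (sw 2) \<in> fibre_rels g k n"
      using that(2) assms(1) unfolding fibre_rels_def by (intro surface_relsI) auto
    then have "word_eval G f (letter c @ sw 2) = word_eval G f (sw 2 @ letter c)"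
      using that(1) assms(1) unfolding commute_def by (intro rel) auto
    then show ?thesis
      using that(1) assms(1) by (simp add: eval letter fS)
  qed
  have sconj: "inv s \<otimes> (f c \<otimes> s) = f c" "y \<in> carrier G \<Longrightarrow> inv s \<otimes> (f c \<otimes> (s \<otimes> y)) = f c \<otimes> y"
    if "s \<otimes> f c = f c \<otimes> s" "c \<in> ?X" for c y
  proof -
    show 1: "inv s \<otimes> (f c \<otimes> s) = f c"
      using that(2) s f by (simp flip: that(1))
    show "inv s \<otimes> (f c \<otimes> (s \<otimes> y)) = f c \<otimes> y" if "y \<in> carrier G"
      using 1 that s f[OF \<open>c \<in> ?X\<close>] by (metis inv_closed m_assoc m_closed)
  qed
  have fold: "h (fibre_elem g k n x) = f x" for x by (simp add: f_def)
  show ?thesis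
    unfolding fold
  proof
    show "s \<in> carrier G" "z \<in> carrier G" by fact+
    show "f (GA i) \<in> carrier G" "f (GB i) \<in> carrier G" if "i \<in> {1..g}" for i
      using that by (simp_all add: f)
    show "s \<otimes> z = z \<otimes> s"
      using sx[of "Zeta 1"] fZ[of 1] assms(2) by simp
    show sa: "s \<otimes> f (GA i) = f (GA i) \<otimes> s" and sb: "s \<otimes> f (GB i) = f (GB i) \<otimes> s"
      if "i \<in> {1..g}" for i
      using that by (auto intro: sx)
    have zc: "z \<otimes> f c = f c \<otimes> z" if "c \<in> ?X" "letter c \<in> aw ` {1..g} \<union> bw ` {1..g}" for c
    proof -
      have "commute (winv (sw 1) @ zw 1 @ sw 1) (letter c) \<in> fibre_rels g k n"
        using that(2) assms(1,2) unfolding fibre_rels_def by (intro surface_relsI) auto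
      then have "word_eval G f ((winv (sw 1) @ zw 1 @ sw 1) @ letter c) =
          word_eval G f (letter c @ (winv (sw 1) @ zw 1 @ sw 1))"
        using that(1) assms(1,2) unfolding commute_def by (intro rel) auto
      then show ?thesis
        using that(1) assms(1,2) sconj[of "Zeta 1"] f \<open>s \<otimes> z = z \<otimes> s\<close>
        by (simp add: eval letter fS fZ)
    qed
    show "z \<otimes> f (GA i) = f (GA i) \<otimes> z" "z \<otimes> f (GB i) = f (GB i) \<otimes> z"
      if "i \<in> {1..g}" for i
      using that by (auto intro: zc)
    show "f (GA i) \<otimes> f (GB i) = s \<otimes> s \<otimes> (f (GB i) \<otimes> f (GA i))" if i: "i \<in> {1..g}" for i
    proof -
      have car: "f (GA i) \<in> carrier G" "f (GB i) \<in> carrier G" using i by (auto intro: f)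
      have "(aw i @ sw 1 @ bw i, sw 1 @ bw i @ sw 1 @ aw i @ sw 1) \<in> fibre_rels g k n"
        using i assms(1) unfolding fibre_rels_def by (intro surface_relsI) auto
      then have "word_eval G f (aw i @ sw 1 @ bw i) = word_eval G f (sw 1 @ bw i @ sw 1 @ aw i @ sw 1)"
        using i assms(1) by (intro rel) auto
      then have "f (GA i) \<otimes> (s \<otimes> f (GB i)) = s \<otimes> (f (GB i) \<otimes> (s \<otimes> (f (GA i) \<otimes> s)))"
        using i assms(1) by (simp add: eval letter fS)
      then have "s \<otimes> (f (GA i) \<otimes> f (GB i)) = s \<otimes> (s \<otimes> (s \<otimes> (f (GB i) \<otimes> f (GA i))))"
        using car s sa[OF i] sb[OF i] by (metis m_assoc m_closed)
      then show ?thesis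
        using car s by (simp add: m_assoc)
    qed
    show "x \<otimes> y = y \<otimes> x"
      if ij: "i \<in> {1..g}" "j \<in> {1..g}" "i < j"
        and xy: "x \<in> {f (GA i), f (GB i)}" "y \<in> {f (GA j), f (GB j)}" for i j x y
    proof -
      obtain c d where cd: "c \<in> {GA i, GB i}" "d \<in> {GA j, GB j}" "x = f c" "y = f d"
        using xy by auto
      then have X: "c \<in> ?X" "d \<in> ?X" using ij by auto
      have "commute (winv (sw 1) @ letter c @ sw 1) (letter d) \<in> fibre_rels g k n"
        using cd ij assms(1) unfolding fibre_rels_def by (intro surface_relsI(4)[of _ _ i _ _ j]) auto
      then have "word_eval G f ((winv (sw 1) @ letter c @ sw 1) @ letter d) =
          word_eval G f (letter d @ (winv (sw 1) @ letter c @ sw 1))"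
        using X assms(1) unfolding commute_def by (intro rel) auto
      moreover have "s \<otimes> f c = f c \<otimes> s" using cd(1) ij by (auto intro: sa sb)
      ultimately show ?thesis
        using X assms(1) sconj[of c] f by (simp add: eval letter fS cd)
    qed
  qed
qed

end

section \<open>Exponents of elements of the mixed and fibre braid groups\<close>

abbreviation heis_map :: "nat \<Rightarrow> braid_gen word set \<Rightarrow> heis" where
  "heis_map g \<equiv> pres_lift (heis_group g) heis_gen"

lemma
  shows heis_map_mixed_hom: "heis_map g \<in> hom (mixed_braid_group g k n) (heis_group g)"
    and heis_map_mixed_class: "w \<in> words (fibre_gens g k n \<union> base_gens g n) \<Longrightarrow>
      heis_map g (pres_rel (fibre_gens g k n \<union> base_gens g n) (total_rels g k n) `` {w}) =
      word_eval (heis_group g) heis_gen w"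
  unfolding mixed_braid_group_def
  by (rule group.pres_lift_hom group.pres_lift_class; simp add: heis_total_rels)+

lemma
  shows heis_map_fibre_hom: "heis_map g \<in> hom (fibre_braid_group g k n) (heis_group g)"
    and heis_map_fibre_class: "w \<in> words (fibre_gens g k n) \<Longrightarrow>
      heis_map g (pres_rel (fibre_gens g k n) (fibre_rels g k n) `` {w}) =
      word_eval (heis_group g) heis_gen w"
proof -
  have "fibre_rels g k n \<subseteq> total_rels g k n" by (auto simp: total_rels_def)
  then show "heis_map g \<in> hom (fibre_braid_group g k n) (heis_group g)"
    "w \<in> words (fibre_gens g k n) \<Longrightarrow>
      heis_map g (pres_rel (fibre_gens g k n) (fibre_rels g k n) `` {w}) =
      word_eval (heis_group g) heis_gen w"
    unfolding fibre_braid_group_def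
    by (intro group.pres_lift_hom group.pres_lift_class; auto dest: heis_total_rels)+
qed

lemma heis_map_fibre_elem: "x \<in> fibre_gens g k n \<Longrightarrow> heis_map g (fibre_elem g k n x) = heis_gen x"
  by (simp add: fibre_elem_def heis_map_fibre_class heis_eval)

text \<open>In particular such a homomorphism kills every element with trivial exponents. This is
  applied to the given homomorphism, to the projections modulo Gamma_i, and to the inclusion of the
  disc followed by the model.\<close>

lemma fibre_hom_eq_theta:
  assumes "group G" and h: "h \<in> hom (fibre_braid_group g k n) G"
    and S: "\<And>i. i \<in> {1..<k} \<Longrightarrow> h (fibre_elem g k n (Sig i)) = s"
    and Z: "\<And>i. i \<in> {1..n} \<Longrightarrow> h (fibre_elem g k n (Zeta i)) = z"
    and kn: "k \<ge> 3" "n \<ge> 1" and x: "x \<in> carrier (fibre_braid_group g k n)"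
  shows "h x = heis_family.theta G s z (\<lambda>i. h (fibre_elem g k n (GA i)))
    (\<lambda>i. h (fibre_elem g k n (GB i))) g (heis_map g x)"
proof -
  interpret heis_family G s z "\<lambda>i. h (fibre_elem g k n (GA i))" "\<lambda>i. h (fibre_elem g k n (GB i))" g
    using group.fibre_hom_heis_family[OF assms(1) kn h S Z] by blast
  obtain w where w: "w \<in> words (fibre_gens g k n)"
    "x = pres_rel (fibre_gens g k n) (fibre_rels g k n) `` {w}"
    using x by (auto simp: fibre_braid_group_def elim: presented_groupE)
  show ?thesis
    using w theta_word_eval[OF w(1), of "\<lambda>x. h (fibre_elem g k n x)"] S Z
    by (simp add: heis_map_fibre_class fibre_hom_eval[OF h])
qed

section \<open>The fibre as a normal subgroup\<close>

lemma mixed_relsI: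
  fixes s a b z ts ta tb g k n
  defines "M \<equiv> mixed_rels s a b z ts ta tb g k n"
  shows "t \<in> ts ` {1..<n} \<union> ta ` {1..g} \<union> tb ` {1..g} \<Longrightarrow> j \<in> {1..<k} \<Longrightarrow> commute t (s j) \<in> M"
    and "i \<in> {1..<n} \<Longrightarrow> d \<in> a ` {1..g} \<union> b ` {1..g} \<Longrightarrow> commute (ts i) d \<in> M"
    and "i \<in> {1..<n} \<Longrightarrow> (ts i @ z (i+1) @ winv (ts i), z i) \<in> M"
    and "i \<in> {1..<n} \<Longrightarrow> (ts i @ z i @ winv (ts i), winv (z i) @ z (i+1) @ z i) \<in> M"
    and "i \<in> {1..<n} \<Longrightarrow> j \<in> {1..n} \<Longrightarrow> j \<noteq> i \<Longrightarrow> j \<noteq> i + 1 \<Longrightarrow> (ts i @ z j @ winv (ts i), z j) \<in> M"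
    and "(tx, x) \<in> {(ta i, a i), (tb i, b i)} \<Longrightarrow> i \<in> {1..g} \<Longrightarrow> 1 \<le> n \<Longrightarrow>
      (tx @ z 1 @ winv tx, wconj (z 1) (x @ z 1)) \<in> M"
    and "(tx, x) \<in> {(ta i, a i), (tb i, b i)} \<Longrightarrow> i \<in> {1..g} \<Longrightarrow> 1 \<le> n \<Longrightarrow> j \<in> {1..n} \<Longrightarrow> j \<noteq> 1 \<Longrightarrow>
      (tx @ z j @ winv tx, wconj (z j) (wcomm (winv x) (winv (z 1)))) \<in> M"
    and "(tx, x) \<in> {(ta i, a i), (tb i, b i)} \<Longrightarrow> i \<in> {1..g} \<Longrightarrow> 1 \<le> n \<Longrightarrow>
      (tx @ x @ winv tx, winv (z 1) @ x @ z 1) \<in> M"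
    and "(tx, x) \<in> {(ta i, a i), (tb i, b i)} \<Longrightarrow> i \<in> {1..g} \<Longrightarrow> 1 \<le> n \<Longrightarrow>
      j \<in> {1..g} \<Longrightarrow> d \<in> {a j, b j} \<Longrightarrow> j < i \<Longrightarrow>
      (tx @ d @ winv tx, wconj d (wcomm (winv x) (winv (z 1)))) \<in> M"
    and "(tx, x) \<in> {(ta i, a i), (tb i, b i)} \<Longrightarrow> i \<in> {1..g} \<Longrightarrow> 1 \<le> n \<Longrightarrow>
      j \<in> {1..g} \<Longrightarrow> d \<in> {a j, b j} \<Longrightarrow> i < j \<Longrightarrow> (tx @ d @ winv tx, d) \<in> M"
    and "i \<in> {1..g} \<Longrightarrow> 1 \<le> n \<Longrightarrow> (ta i @ b i @ winv (ta i), b i @ z 1) \<in> M"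
    and "i \<in> {1..g} \<Longrightarrow> 1 \<le> n \<Longrightarrow>
      (tb i @ a i @ winv (tb i), winv (z 1) @ a i @ wcomm (winv (b i)) (winv (z 1))) \<in> M"
  unfolding mixed_rels_def Let_def M_def
    subgoal by (rule UnI1, rule UnI1, rule UnI1, rule UnI1, rule UnI1, rule UnI1, rule UnI1, rule
      UnI1, rule UnI1, rule UnI1, rule UnI1, blast)
    subgoal by (rule UnI1, rule UnI1, rule UnI1, rule UnI1, rule UnI1, rule UnI1, rule UnI1, rule
      UnI1, rule UnI1, rule UnI1, rule UnI2, blast)
    subgoal by (rule UnI1, rule UnI1, rule UnI1, rule UnI1, rule UnI1, rule UnI1, rule UnI1, rule
      UnI1, rule UnI1, rule UnI2, blast)
    subgoal by (rule UnI1, rule UnI1, rule UnI1, rule UnI1, rule UnI1, rule UnI1, rule UnI1, rule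
      UnI1, rule UnI2, blast)
    subgoal by (rule UnI1, rule UnI1, rule UnI1, rule UnI1, rule UnI1, rule UnI1, rule UnI1, rule
      UnI2, blast)
  subgoal by (rule UnI1, rule UnI1, rule UnI1, rule UnI1, rule UnI1, rule UnI1, rule UnI2, blast)
  subgoal by (rule UnI1, rule UnI1, rule UnI1, rule UnI1, rule UnI1, rule UnI2, blast)
  subgoal by (rule UnI1, rule UnI1, rule UnI1, rule UnI1, rule UnI2, blast)
  subgoal by (rule UnI1, rule UnI1, rule UnI1, rule UnI2, blast)
  subgoal by (rule UnI1, rule UnI1, rule UnI2, blast)
  subgoal by (rule UnI1, rule UnI2, blast)
  subgoal by (rule UnI2, blast)
  done

lemma words_wconj [simp]: "wconj u v \<in> words X \<longleftrightarrow> u \<in> words X \<and> v \<in> words X"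
  by (auto simp: wconj_def)

lemma words_wcomm [simp]: "wcomm u v \<in> words X \<longleftrightarrow> u \<in> words X \<and> v \<in> words X"
  by (auto simp: wcomm_def)

lemma (in group) word_eval_subgroup:
  assumes S: "subgroup S G" and f: "\<And>x. x \<in> X \<Longrightarrow> f x \<in> S" and "w \<in> words X"
  shows "word_eval G f w \<in> S"
  using assms(3)
proof (induction w)
  case (Cons p w)
  then show ?case
    using f subgroup.m_closed[OF S] subgroup.m_inv_closed[OF S] by (cases p) auto
qed (simp add: subgroup.one_closed[OF S])

lemma (in group) subgroup_conj_cancel:
  assumes S: "subgroup S G" and "y \<in> S" "inv y \<otimes> x \<otimes> y \<in> S" "x \<in> carrier G"
  shows "x \<in> S"
proof -
  have y: "y \<in> carrier G" using assms(2) S by (meson subgroup.mem_carrier)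
  have "y \<otimes> (inv y \<otimes> x \<otimes> y) \<otimes> inv y \<in> S"
    using assms subgroup.m_closed[OF S] subgroup.m_inv_closed[OF S] by blast
  then show ?thesis using y assms(4) by (simp add: m_assoc)
qed

lemma (in group) subgroup_mult_cancel:
  assumes S: "subgroup S G" and x: "x \<in> carrier G" and y: "y \<in> S"
  shows "x \<otimes> y \<in> S \<Longrightarrow> x \<in> S" "y \<otimes> x \<in> S \<Longrightarrow> x \<in> S"
proof -
  have y': "y \<in> carrier G" "inv y \<in> S"
    using y S subgroup.m_inv_closed[OF S] by (auto intro: subgroup.mem_carrier)
  show "x \<in> S" if "x \<otimes> y \<in> S"
    using subgroup.m_closed[OF S that y'(2)] x y' by (simp add: m_assoc)
  show "x \<in> S" if "y \<otimes> x \<in> S"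
    using subgroup.m_closed[OF S y'(2) that] x y' by simp
qed

text \<open>The target is left arbitrary; the case of interest is the projection modulo a term of
  the lower central series.\<close>

locale mixed_hom = group G for G (structure) +
  fixes g k n :: nat and h :: "braid_gen word set \<Rightarrow> 'a"
  assumes hom: "h \<in> hom (mixed_braid_group g k n) G"
begin

definition img :: "braid_gen \<Rightarrow> 'a" where
  "img x = h (mixed_elem g k n x)"

definition cj :: "braid_gen \<Rightarrow> braid_gen \<Rightarrow> 'a" where
  "cj t x = img t \<otimes> img x \<otimes> inv (img t)"

lemma img_closed [simp]: "x \<in> fibre_gens g k n \<union> base_gens g n \<Longrightarrow> img x \<in> carrier G"
  unfolding img_def by (rule hom_in_carrier[OF hom]) simp

lemma respects:
  assumes "(r, s) \<in> total_rels g k n"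
    "r \<in> words (fibre_gens g k n \<union> base_gens g n)" "s \<in> words (fibre_gens g k n \<union> base_gens g n)"
  shows "word_eval G img r = word_eval G img s"
  unfolding img_def by (rule mixed_hom_respects[OF hom assms])

lemma eval:
  assumes u: "u \<in> words (fibre_gens g k n \<union> base_gens g n)"
  shows "v \<in> words (fibre_gens g k n \<union> base_gens g n) \<Longrightarrow>
      word_eval G img (u @ v) = word_eval G img u \<otimes> word_eval G img v"
    and "word_eval G img (winv u) = inv (word_eval G img u)"
    and "word_eval G img u \<in> carrier G"
proof -
  show "word_eval G img (u @ v) = word_eval G img u \<otimes> word_eval G img v"
    if "v \<in> words (fibre_gens g k n \<union> base_gens g n)"
    by (rule word_eval_append[OF _ u that]) (rule img_closed)
  show "word_eval G img (winv u) = inv (word_eval G img u)"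
    by (rule word_eval_winv[OF _ u]) (rule img_closed)
  show "word_eval G img u \<in> carrier G"
    by (rule word_eval_closed[OF _ u]) (rule img_closed)
qed

lemmas braid_relsI = mixed_relsI[where s = sw and a = aw and b = bw and z = zw and ts = tsw
    and ta = taw and tb = tbw and g = g and k = k and n = n]

lemma eval_letter: "x \<in> fibre_gens g k n \<union> base_gens g n \<Longrightarrow> word_eval G img (letter x) = img x"
  by (rule word_eval_letter) (rule img_closed)

lemma cj_rel:
  assumes "(letter t @ letter x @ winv (letter t), w) \<in> mixed_rels sw aw bw zw tsw taw tbw g k n"
    and "t \<in> base_gens g n" "x \<in> fibre_gens g k n" "w \<in> words (fibre_gens g k n)"
  shows "cj t x = word_eval G img w"
proof -
  have "w \<in> words (fibre_gens g k n \<union> base_gens g n)"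
    using assms(4) words_mono by blast
  then have "word_eval G img (letter t @ letter x @ winv (letter t)) = word_eval G img w"
    using assms by (intro respects) (auto simp: total_rels_def)
  then show ?thesis
    using assms by (simp add: eval eval_letter cj_def m_assoc)
qed

lemma cj_commute:
  assumes "commute (letter t) (letter x) \<in> mixed_rels sw aw bw zw tsw taw tbw g k n"
    and "t \<in> base_gens g n" "x \<in> fibre_gens g k n"
  shows "cj t x = img x"
proof -
  have "word_eval G img (letter t @ letter x) = word_eval G img (letter x @ letter t)"
    using assms unfolding commute_def by (intro respects) (auto simp: total_rels_def)
  then have "img t \<otimes> img x = img x \<otimes> img t"
    using assms by (simp add: eval eval_letter)
  then show ?thesis
    using assms by (simp add: cj_def m_assoc)
qed

lemma cj_Sig: "t \<in> base_gens g n \<Longrightarrow> j \<in> {1..<k} \<Longrightarrow> cj t (Sig j) = img (Sig j)"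
  by (rule cj_commute) (auto simp: base_gens_def intro!: braid_relsI(1))

lemma cj_TSig:
  assumes i: "i \<in> {1..<n}"
  shows "j \<in> {1..g} \<Longrightarrow> d \<in> {GA j, GB j} \<Longrightarrow> cj (TSig i) d = img d"
    and "cj (TSig i) (Zeta (i + 1)) = img (Zeta i)"
    and "cj (TSig i) (Zeta i) = word_eval G img (winv (zw i) @ zw (i + 1) @ zw i)"
    and "j \<in> {1..n} \<Longrightarrow> j \<noteq> i \<Longrightarrow> j \<noteq> i + 1 \<Longrightarrow> cj (TSig i) (Zeta j) = img (Zeta j)"
proof -
  show "j \<in> {1..g} \<Longrightarrow> d \<in> {GA j, GB j} \<Longrightarrow> cj (TSig i) d = img d"
    using i by (intro cj_commute) (auto intro!: braid_relsI(2))
  show "cj (TSig i) (Zeta (i + 1)) = img (Zeta i)"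
    using i cj_rel[OF braid_relsI(3)[OF i]] by (simp add: eval_letter)
  show "cj (TSig i) (Zeta i) = word_eval G img (winv (zw i) @ zw (i + 1) @ zw i)"
    using i by (intro cj_rel braid_relsI(4)) auto
  show "j \<in> {1..n} \<Longrightarrow> j \<noteq> i \<Longrightarrow> j \<noteq> i + 1 \<Longrightarrow> cj (TSig i) (Zeta j) = img (Zeta j)"
    using i cj_rel[OF braid_relsI(5)[OF i]] by (simp add: eval_letter)
qed

lemma cj_handle:
  assumes tx: "(t, x) \<in> {(TGA i, GA i), (TGB i, GB i)}" and i: "i \<in> {1..g}" and n: "1 \<le> n"
  shows "cj t (Zeta 1) = word_eval G img (wconj (zw 1) (letter x @ zw 1))"
    and "j \<in> {1..n} \<Longrightarrow> j \<noteq> 1 \<Longrightarrow>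
      cj t (Zeta j) = word_eval G img (wconj (zw j) (wcomm (winv (letter x)) (winv (zw 1))))"
    and "cj t x = word_eval G img (winv (zw 1) @ letter x @ zw 1)"
    and "j \<in> {1..g} \<Longrightarrow> d \<in> {GA j, GB j} \<Longrightarrow> j < i \<Longrightarrow>
      cj t d = word_eval G img (wconj (letter d) (wcomm (winv (letter x)) (winv (zw 1))))"
    and "j \<in> {1..g} \<Longrightarrow> d \<in> {GA j, GB j} \<Longrightarrow> i < j \<Longrightarrow> cj t d = word_eval G img (letter d)"
proof -
  have P: "(letter t, letter x) \<in> {(taw i, aw i), (tbw i, bw i)}" using tx by auto
  have tX: "t \<in> base_gens g n" "x \<in> fibre_gens g k n" using tx i by auto
  show "cj t (Zeta 1) = word_eval G img (wconj (zw 1) (letter x @ zw 1))"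
    using tX n by (intro cj_rel braid_relsI(6)[OF P i n]) auto
  show "j \<in> {1..n} \<Longrightarrow> j \<noteq> 1 \<Longrightarrow>
      cj t (Zeta j) = word_eval G img (wconj (zw j) (wcomm (winv (letter x)) (winv (zw 1))))"
    using tX n by (intro cj_rel braid_relsI(7)[OF P i n]) auto
  show "cj t x = word_eval G img (winv (zw 1) @ letter x @ zw 1)"
    using tX n by (intro cj_rel braid_relsI(8)[OF P i n]) auto
  show "j \<in> {1..g} \<Longrightarrow> d \<in> {GA j, GB j} \<Longrightarrow> j < i \<Longrightarrow>
      cj t d = word_eval G img (wconj (letter d) (wcomm (winv (letter x)) (winv (zw 1))))"
    using tX n by (intro cj_rel braid_relsI(9)[OF P i n, of j]) auto
  show "j \<in> {1..g} \<Longrightarrow> d \<in> {GA j, GB j} \<Longrightarrow> i < j \<Longrightarrow> cj t d = word_eval G img (letter d)"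
    using tX n by (intro cj_rel braid_relsI(10)[OF P i n, of j]) auto
qed

lemma cj_handle_partner:
  assumes i: "i \<in> {1..g}" and n: "1 \<le> n"
  shows "cj (TGA i) (GB i) = word_eval G img (bw i @ zw 1)"
    and "cj (TGB i) (GA i) =
      word_eval G img (winv (zw 1) @ aw i @ wcomm (winv (bw i)) (winv (zw 1)))"
  using i n by (intro cj_rel braid_relsI(11,12)[OF i n]; simp)+

lemma base_gens_cases:
  assumes "t \<in> base_gens g n"
  obtains i where "i \<in> {1..<n}" "t = TSig i"
    | i x where "i \<in> {1..g}" "(t, x) \<in> {(TGA i, GA i), (TGB i, GB i)}"
  using assms by (auto simp: base_gens_def)

lemma puncture_gens_cases:
  assumes "y \<in> fibre_gens g k n"
  obtains j where "j \<in> {1..<k}" "y = Sig j" | j where "j \<in> {1..g}" "y \<in> {GA j, GB j}"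
    | "y = Zeta i" | "y = Zeta (i + 1)" | j where "j \<in> {1..n}" "j \<noteq> i" "j \<noteq> i + 1" "y = Zeta j"
proof -
  consider j where "j \<in> {1..<k}" "y = Sig j" | j where "j \<in> {1..g}" "y \<in> {GA j, GB j}"
    | j where "j \<in> {1..n}" "y = Zeta j"
    using assms by (auto simp: fibre_gens_def)
  then show ?thesis
  proof cases
    case (3 j)
    then show ?thesis using that(3-5) by blast
  qed (fact that(1), fact that(2))
qed

text \<open>The cases follow the shapes of the mixed relations for a generator of the handle
  \<open>i\<close>.\<close>

lemma handle_gens_cases:
  assumes "y \<in> fibre_gens g k n" "(t, x) \<in> {(TGA i, GA i), (TGB i, GB i)}"
  obtains j where "j \<in> {1..<k}" "y = Sig j"
    | "y = Zeta 1" | j where "j \<in> {1..n}" "j \<noteq> 1" "y = Zeta j"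
    | "y = x" | j where "j \<in> {1..g}" "y \<in> {GA j, GB j}" "j < i"
    | j where "j \<in> {1..g}" "y \<in> {GA j, GB j}" "i < j"
    | "t = TGA i" "y = GB i" | "t = TGB i" "y = GA i"
proof -
  have "\<exists>j. j \<in> {1..g} \<and> y \<in> {GA j, GB j} \<and> (j < i \<or> i < j) \<or> y \<in> {GA i, GB i} \<or> j \<in> {1..<k} \<and> y = Sig j
      \<or> j \<in> {1..n} \<and> y = Zeta j"
    using assms(1) by (auto simp: fibre_gens_def)
  then show ?thesis using that assms(2) by auto
qed

text \<open>The right-hand sides of the mixed relations are fibre words. This settles conjugation by
  \<open>t\<close>; for its inverse see \<open>fibre_in_cj\<close>.\<close>

lemma cj_in_fibre:
  assumes n: "1 \<le> n" and t: "t \<in> base_gens g n" and y: "y \<in> fibre_gens g k n"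
  shows "\<exists>w \<in> words (fibre_gens g k n). cj t y = word_eval G img w"
  using t
proof (cases rule: base_gens_cases)
  case (1 i)
  have self: ?thesis if "cj t y = img y"
    using that y by (intro bexI[of _ "letter y"]) (auto simp: eval_letter)
  show ?thesis
    using y
  proof (cases rule: puncture_gens_cases[where i = i])
    case a: 3
    then show ?thesis
      using 1 cj_TSig(3)[OF 1(1)] by (intro bexI[of _ "winv (zw i) @ zw (i + 1) @ zw i"]) auto
  next
    case a: 4
    then show ?thesis
      using 1 cj_TSig(2)[OF 1(1)] by (intro bexI[of _ "zw i"]) (auto simp: eval_letter)
  qed (use 1 t self cj_Sig cj_TSig in auto)
next
  case (2 i x)
  have x: "x \<in> fibre_gens g k n" using 2 by auto
  have z: "Zeta 1 \<in> fibre_gens g k n" using n by simp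
  note e = cj_handle[OF 2(2,1) n] cj_handle_partner[OF 2(1) n]
  show ?thesis
    using y 2(2)
  proof (cases rule: handle_gens_cases)
    case (1 j)
    then show ?thesis using cj_Sig[OF t] by (intro bexI[of _ "letter y"]) (auto simp: eval_letter)
  next
    case 2
    show ?thesis unfolding 2 e(1) by (rule bexI, rule HOL.refl) (use x z in simp)
  next
    case (3 j)
    show ?thesis unfolding 3(3) e(2)[OF 3(1,2)] by (rule bexI, rule HOL.refl) (use x z 3 in simp)
  next
    case 4
    show ?thesis unfolding 4 e(3) by (rule bexI, rule HOL.refl) (use x z in simp)
  next
    case (5 j)
    show ?thesis unfolding e(4)[OF 5] by (rule bexI, rule HOL.refl) (use x y z in simp)
  next
    case (6 j)
    show ?thesis unfolding e(5)[OF 6] by (rule bexI, rule HOL.refl) (use y in simp)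
  next
    case 7
    show ?thesis unfolding 7 e(6) by (rule bexI, rule HOL.refl) (use y z 7 in simp)
  next
    case 8
    show ?thesis unfolding 8 e(7) by (rule bexI, rule HOL.refl) (use \<open>i \<in> {1..g}\<close> z in simp)
  qed
qed

text \<open>The mixed relations are solved for the original generators, in an order in which each
  one uses only those already recovered. For \<open>TSig i\<close> this is zeta_i and then
  zeta_(i+1). For a handle it is zeta_1, then the generator \<open>x\<close> of that handle, then
  all others, whose conjugates differ from them by words in \<open>x\<close> and zeta_1.\<close>

lemma fibre_in_cj:
  assumes n: "1 \<le> n" and t: "t \<in> base_gens g n" and S: "subgroup S G"
    and cjS: "\<And>y. y \<in> fibre_gens g k n \<Longrightarrow> cj t y \<in> S" and y: "y \<in> fibre_gens g k n"
  shows "img y \<in> S"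
  using t
proof (cases rule: base_gens_cases)
  case (1 i)
  have z1: "img (Zeta i) \<in> S"
    using cjS[of "Zeta (i + 1)"] cj_TSig(2)[OF 1(1)] 1 by simp
  have "inv (img (Zeta i)) \<otimes> img (Zeta (i + 1)) \<otimes> img (Zeta i) \<in> S"
    using cjS[of "Zeta i"] cj_TSig(3)[OF 1(1)] 1 by (simp add: eval eval_letter m_assoc)
  then have z2: "img (Zeta (i + 1)) \<in> S"
    using subgroup_conj_cancel[OF S z1] 1 by simp
  show ?thesis
    using y by (cases rule: puncture_gens_cases[where i = i]) (use z1 z2 cjS[OF y] 1 cj_Sig[OF t] cj_TSig in auto)
next
  case (2 i x)
  have x: "x \<in> fibre_gens g k n" using 2 by auto
  have z: "Zeta 1 \<in> fibre_gens g k n" using n by simp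
  note ev = eval eval_letter wconj_def wcomm_def
  note e = cj_handle[OF 2(2,1) n] cj_handle_partner[OF 2(1) n]
  have car: "img x \<in> carrier G" "img (Zeta 1) \<in> carrier G" using x z by simp_all
  \<comment> \<open>This is the conjugate of \<open>x\<close> by \<open>t\<close>, and the conjugate
    of zeta_1 equals \<open>inv \<alpha> \<otimes> img (Zeta 1) \<otimes> \<alpha>\<close>. So
    zeta_1 is recovered before \<open>x\<close> itself is known to lie in \<open>S\<close>.\<close>
  define \<alpha> where "\<alpha> = inv (img (Zeta 1)) \<otimes> img x \<otimes> img (Zeta 1)"
  have \<alpha>: "\<alpha> \<in> S" "\<alpha> \<in> carrier G"
    using cjS[OF x] e(3) x z car by (simp_all add: ev \<alpha>_def m_assoc)
  have "inv \<alpha> \<otimes> img (Zeta 1) \<otimes> \<alpha> \<in> S"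
    using cjS[OF z] e(1) x z car by (simp add: ev \<alpha>_def m_assoc inv_mult_group)
  then have zS: "img (Zeta 1) \<in> S" using subgroup_conj_cancel[OF S \<alpha>(1)] car by simp
  then have xS: "img x \<in> S"
    using subgroup_conj_cancel[OF S zS] \<alpha> car by (simp add: \<alpha>_def)
  have wS: "word_eval G img w \<in> S" if "w \<in> words {x, Zeta 1}" for w
    using that xS zS by (intro word_eval_subgroup[OF S, of "{x, Zeta 1}"]) auto
  have conj: "img y \<in> S"
    if "cj t y = word_eval G img (wconj (letter y) (wcomm (winv (letter x)) (winv (zw 1))))"
  proof (rule subgroup_conj_cancel[OF S wS])
    show "inv (word_eval G img (wcomm (winv (letter x)) (winv (zw 1)))) \<otimes> img y \<otimes>
        word_eval G img (wcomm (winv (letter x)) (winv (zw 1))) \<in> S"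
      using that cjS[OF y] x y z by (simp add: wconj_def eval eval_letter m_assoc)
  qed (use y in simp_all)
  show ?thesis
    using y 2(2)
  proof (cases rule: handle_gens_cases)
    case (1 j)
    then show ?thesis using cj_Sig[OF t] cjS[OF y] by simp
  next
    case (3 j)
    then show ?thesis using conj e(2)[OF 3(1,2)] by simp
  next
    case (5 j)
    then show ?thesis using conj e(4)[OF 5] by simp
  next
    case (6 j)
    then show ?thesis using cjS[OF y] e(5)[OF 6] y by (simp add: eval_letter)
  next
    case 7
    then have "img y \<otimes> img (Zeta 1) \<in> S" using cjS[OF y] e(6) y z by (simp add: ev)
    then show ?thesis using subgroup_mult_cancel(1)[OF S _ zS] y by simp
  next
    case 8
    then have xB: "x = GB i" using 2(2) by auto
    define u where "u = word_eval G img (wcomm (winv (bw i)) (winv (zw 1)))"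
    have u: "u \<in> S" unfolding u_def using xB by (intro wS) simp
    then have u': "u \<in> carrier G" using S by (meson subgroup.mem_carrier)
    have "inv (img (Zeta 1)) \<otimes> (img y \<otimes> u) \<in> S"
      using cjS[OF y] e(7) y z x 8 xB unfolding u_def
      by (simp add: eval eval_letter)
    then have "img y \<otimes> u \<in> S"
      using subgroup_mult_cancel(2)[OF S _ subgroup.m_inv_closed[OF S zS]] y u' by simp
    then show ?thesis using subgroup_mult_cancel(1)[OF S _ u] y by simp
  qed (use xS zS in simp_all)
qed

end

section \<open>Normality of the fibre image and the splitting of words into fibre and base
  parts\<close>

context mixed_hom
begin

lemma hom_class:
  assumes "w \<in> words (fibre_gens g k n \<union> base_gens g n)"
  shows "h (pres_rel (fibre_gens g k n \<union> base_gens g n) (total_rels g k n) `` {w}) = word_eval G img w"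
  using hom_presented_group[OF hom[unfolded mixed_braid_group_def] assms]
  unfolding img_def[abs_def] mixed_elem_def .

definition fibre_img :: "'a set" where
  "fibre_img = word_eval G img ` words (fibre_gens g k n)"

lemma fibre_words: "w \<in> words (fibre_gens g k n) \<Longrightarrow> w \<in> words (fibre_gens g k n \<union> base_gens g n)"
  by (erule words_mono) blast

lemma subgroup_fibre_img: "subgroup fibre_img G"
proof (rule subgroupI)
  show "fibre_img \<subseteq> carrier G"
    by (auto simp: fibre_img_def fibre_words eval)
  show "fibre_img \<noteq> {}"
    using words_Nil[of "fibre_gens g k n"] unfolding fibre_img_def by blast
  show "inv y \<in> fibre_img" if "y \<in> fibre_img" for y
    using that unfolding fibre_img_def
    by (force simp: fibre_words eval(2)[symmetric])
  show "y \<otimes> y' \<in> fibre_img" if "y \<in> fibre_img" "y' \<in> fibre_img" for y y'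
    using that unfolding fibre_img_def
    by (force simp: fibre_words eval(1)[symmetric])
qed

text \<open>The sign covered by the relations follows letter by letter. For the other one,
  \<open>fibre_in_cj\<close> is applied to the conjugate of the fibre image: it contains all fibre
  generators, hence the whole fibre image.\<close>

lemma base_normalizes_fibre_img:
  assumes n: "1 \<le> n" and t: "t \<in> base_gens g n" and y: "y \<in> fibre_img"
  shows "img t \<otimes> y \<otimes> inv (img t) \<in> fibre_img" "inv (img t) \<otimes> y \<otimes> img t \<in> fibre_img"
proof -
  let ?c = "\<lambda>x. img t \<otimes> x \<otimes> inv (img t)"
  have tc: "img t \<in> carrier G" using t by simp
  interpret c: group_hom G G ?c
    using tc by unfold_locales (auto intro!: homI simp: m_assoc)
  have sub: "fibre_img \<subseteq> carrier G" using subgroup_fibre_img by (rule subgroup.subset)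
  have cj: "cj t x \<in> fibre_img" if "x \<in> fibre_gens g k n" for x
    using cj_in_fibre[OF n t that] by (auto simp: fibre_img_def)
  obtain w where w: "w \<in> words (fibre_gens g k n)" "y = word_eval G img w"
    using y by (auto simp: fibre_img_def)
  have "?c (word_eval G img w) = word_eval G (cj t) w"
    using w(1)
  proof (induction w)
    case Nil
    then show ?case using tc by simp
  next
    case (Cons p w)
    obtain x e where p: "p = (x, e)" by force
    have xw: "x \<in> fibre_gens g k n" "word_eval G img w \<in> carrier G"
      using Cons.prems p by (auto simp: fibre_words eval)
    have "?c (word_eval G img (p # w)) = ?c (if e then img x else inv (img x)) \<otimes> ?c (word_eval G img w)"
      unfolding p word_eval.simps using xw by (intro c.hom_mult) auto
    then show ?case
      using Cons xw p c.hom_inv[of "img x"] by (auto simp: cj_def)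
  qed
  then show "img t \<otimes> y \<otimes> inv (img t) \<in> fibre_img"
    using word_eval_subgroup[OF subgroup_fibre_img cj w(1)] w(2) by simp
  have S: "subgroup (?c ` fibre_img) G"
    by (rule c.subgroup_img_is_subgroup[OF subgroup_fibre_img])
  have img: "img x \<in> fibre_img" if "x \<in> fibre_gens g k n" for x
    using that by (auto simp: fibre_img_def eval_letter intro!: rev_image_eqI[of "letter x"])
  have "img x \<in> ?c ` fibre_img" if "x \<in> fibre_gens g k n" for x
    by (rule fibre_in_cj[OF n t S _ that]) (auto simp: cj_def img)
  then have "y \<in> ?c ` fibre_img"
    using word_eval_subgroup[OF S _ w(1)] w(2) by blast
  then obtain y' where "y' \<in> fibre_img" "y = ?c y'" by blast
  then show "inv (img t) \<otimes> y \<otimes> img t \<in> fibre_img"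
    using sub tc by (auto simp: m_assoc)
qed

text \<open>A base letter of either sign is pushed to the right past the fibre factor, which is
  replaced by a conjugate. What remains on the right is the word with its fibre letters deleted,
  which is how \<open>forget\<close> acts.\<close>

lemma fibre_base_decomposition:
  assumes n: "1 \<le> n" and w: "w \<in> words (fibre_gens g k n \<union> base_gens g n)"
  shows "\<exists>y\<in>fibre_img. word_eval G img w = y \<otimes> word_eval G img (filter (\<lambda>(x, e). x \<in> base_gens g n) w)"
  using w
proof (induction w)
  case Nil
  then show ?case using subgroup.one_closed[OF subgroup_fibre_img] by (intro bexI[of _ \<one>]) auto
next
  case (Cons p w)
  let ?f = "filter (\<lambda>(x, e). x \<in> base_gens g n)"
  obtain x e where p: "p = (x, e)" by force
  obtain y where y: "y \<in> fibre_img" "word_eval G img w = y \<otimes> word_eval G img (?f w)"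
    using Cons by auto
  have "?f w \<in> words (fibre_gens g k n \<union> base_gens g n)"
    using Cons.prems by (auto simp: words_def)
  then have car: "y \<in> carrier G" "word_eval G img (?f w) \<in> carrier G" "img x \<in> carrier G"
    using y(1) subgroup_fibre_img Cons.prems p by (auto simp: eval subgroup.mem_carrier)
  define T where "T = (if e then img x else inv (img x))"
  have T: "T \<in> carrier G" using car by (simp add: T_def)
  have ev: "word_eval G img (p # w) = T \<otimes> (y \<otimes> word_eval G img (?f w))"
    using y(2) by (simp add: p T_def)
  show ?case
  proof (cases "x \<in> base_gens g n")
    case True
    have "T \<otimes> y \<otimes> inv T \<in> fibre_img"
      using base_normalizes_fibre_img[OF n True y(1)] car by (auto simp: T_def)
    moreover have "word_eval G img (?f (p # w)) = T \<otimes> word_eval G img (?f w)"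
      using True by (simp add: p T_def)
    ultimately show ?thesis
      unfolding ev using car T by (intro bexI[of _ "T \<otimes> y \<otimes> inv T"]) (simp_all add: m_assoc)
  next
    case False
    then have x: "x \<in> fibre_gens g k n" using Cons.prems p by auto
    have "word_eval G img [(x, e)] \<in> fibre_img" unfolding fibre_img_def by (rule imageI) (use x in simp)
    then have "T \<in> fibre_img" using car by (auto simp: T_def split: if_splits)
    then show ?thesis
      unfolding ev using False car T y subgroup.m_closed[OF subgroup_fibre_img]
      by (intro bexI[of _ "T \<otimes> y"]) (simp_all add: p m_assoc)
  qed
qed

end

section \<open>Quotients by terms of the lower central series\<close>

context group
begin

lemma group_lc_quotient: "group (lc_quotient G i)"
  unfolding lc_quotient_def by (rule normal.factorgroup_is_group[OF normal_lower_central])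

lemma lc_proj_hom: "lc_proj G i \<in> hom G (lc_quotient G i)"
  using normal.r_coset_hom_Mod[OF normal_lower_central] by (simp add: lc_quotient_def lc_proj_def[abs_def])

lemma lc_proj_eq_one_iff:
  assumes "x \<in> carrier G"
  shows "lc_proj G i x = \<one>\<^bsub>lc_quotient G i\<^esub> \<longleftrightarrow> x \<in> lower_central G i"
proof -
  have N: "subgroup (lower_central G i) G"
    using normal_lower_central normal_imp_subgroup by blast
  show ?thesis
    using assms coset_join1[OF _ assms N] coset_join2[OF assms N] subgroup.subset[OF N]
    by (auto simp: lc_proj_def lc_quotient_def)
qed

lemma carrier_lc_quotient: "carrier (lc_quotient G i) = lc_proj G i ` carrier G"
  by (auto simp: lc_quotient_def carrier_FactGroup lc_proj_def)

text \<open>The commutator \<open>c\<close> of two elements lies in Gamma_(i-1), so its commutators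
  with anything die modulo Gamma_i. For \<open>i = 2\<close> membership in Gamma_1 is
  automatic.\<close>

lemma lc_quotient_commutators_central:
  assumes i: "i \<in> {2, 3}"
    and "x \<in> carrier (lc_quotient G i)" "y \<in> carrier (lc_quotient G i)" "z \<in> carrier (lc_quotient G i)"
  defines "Q \<equiv> lc_quotient G i"
  shows "(x \<otimes>\<^bsub>Q\<^esub> y \<otimes>\<^bsub>Q\<^esub> inv\<^bsub>Q\<^esub> x \<otimes>\<^bsub>Q\<^esub> inv\<^bsub>Q\<^esub> y) \<otimes>\<^bsub>Q\<^esub> z =
    z \<otimes>\<^bsub>Q\<^esub> (x \<otimes>\<^bsub>Q\<^esub> y \<otimes>\<^bsub>Q\<^esub> inv\<^bsub>Q\<^esub> x \<otimes>\<^bsub>Q\<^esub> inv\<^bsub>Q\<^esub> y)"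
proof -
  interpret q: group_hom G Q "lc_proj G i"
    unfolding Q_def using lc_proj_hom group_lc_quotient is_group
    by (simp add: group_hom_def group_hom_axioms_def)
  obtain a b d where abd: "a \<in> carrier G" "b \<in> carrier G" "d \<in> carrier G"
    "x = lc_proj G i a" "y = lc_proj G i b" "z = lc_proj G i d"
    using assms(2-4) by (auto simp: carrier_lc_quotient)
  define c where "c = a \<otimes> b \<otimes> inv a \<otimes> inv b"
  have c: "c \<in> carrier G" using abd by (simp add: c_def)
  have pc: "x \<otimes>\<^bsub>Q\<^esub> y \<otimes>\<^bsub>Q\<^esub> inv\<^bsub>Q\<^esub> x \<otimes>\<^bsub>Q\<^esub> inv\<^bsub>Q\<^esub> y = lc_proj G i c"
    using abd by (simp add: c_def)
  obtain j where j: "i = Suc (Suc j)" "j = 0 \<or> j = 1" using i by (auto simp: numeral_eq_Suc)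
  have "c \<in> lower_central G (Suc j)"
    using j(2)
  proof
    assume "j = 1"
    moreover have "c \<in> (\<Union>x\<in>carrier G. \<Union>y\<in>carrier G. {x \<otimes> y \<otimes> inv x \<otimes> inv y})"
      using abd by (auto simp: c_def)
    ultimately show ?thesis by (auto intro: generate.incl)
  qed (use c in simp)
  then have "d \<otimes> c \<otimes> inv d \<otimes> inv c \<in> lower_central G i"
    unfolding j(1) using abd by (auto intro!: generate.incl)
  then have "lc_proj G i (d \<otimes> c \<otimes> inv d \<otimes> inv c) = \<one>\<^bsub>Q\<^esub>"
    unfolding Q_def using abd c by (subst lc_proj_eq_one_iff) auto
  then have "z \<otimes>\<^bsub>Q\<^esub> lc_proj G i c \<otimes>\<^bsub>Q\<^esub> inv\<^bsub>Q\<^esub> z \<otimes>\<^bsub>Q\<^esub> inv\<^bsub>Q\<^esub> (lc_proj G i c) = \<one>\<^bsub>Q\<^esub>"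
    using abd c by simp
  then have "z \<otimes>\<^bsub>Q\<^esub> lc_proj G i c = lc_proj G i c \<otimes>\<^bsub>Q\<^esub> z"
    using abd c by (simp add: q.H.inv_solve_right' q.H.m_assoc[symmetric] q.H.inv_solve_right)
  then show ?thesis unfolding pc by simp
qed

text \<open>The braid relation says that x y conjugates x to y, so y = c x with c the commutator of
  x y and x. As c is central, substituting gives c x^3 = c^2 x^3, hence c = 1.\<close>

lemma braid_relation_class_2:
  assumes central: "\<And>x y z. \<lbrakk>x \<in> carrier G; y \<in> carrier G; z \<in> carrier G\<rbrakk> \<Longrightarrow>
      (x \<otimes> y \<otimes> inv x \<otimes> inv y) \<otimes> z = z \<otimes> (x \<otimes> y \<otimes> inv x \<otimes> inv y)"
    and x: "x \<in> carrier G" and y: "y \<in> carrier G" and rel: "x \<otimes> (y \<otimes> x) = y \<otimes> (x \<otimes> y)"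
  shows "y = x"
proof -
  define c where "c = (x \<otimes> y) \<otimes> x \<otimes> inv (x \<otimes> y) \<otimes> inv x"
  have c: "c \<in> carrier G" using x y by (simp add: c_def)
  have "(x \<otimes> y) \<otimes> x = y \<otimes> (x \<otimes> y)" using rel x y by (simp add: m_assoc)
  then have "(x \<otimes> y) \<otimes> x \<otimes> inv (x \<otimes> y) = y"
    using x y by (metis inv_solve_right' m_closed)
  then have yc: "y = c \<otimes> x" using x y by (simp add: c_def m_assoc)
  have cx: "c \<otimes> x = x \<otimes> c"
    unfolding c_def using x y by (intro central) auto
  have xc: "x \<otimes> (c \<otimes> v) = c \<otimes> (x \<otimes> v)" if "v \<in> carrier G" for v
  proof -
    have "x \<otimes> (c \<otimes> v) = c \<otimes> x \<otimes> v" using that x c by (simp add: cx m_assoc[symmetric])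
    then show ?thesis using that x c by (simp add: m_assoc)
  qed
  have "c \<otimes> (x \<otimes> (x \<otimes> x)) = c \<otimes> (c \<otimes> (x \<otimes> (x \<otimes> x)))"
    using rel unfolding yc using x c by (simp add: m_assoc xc)
  then have "x \<otimes> (x \<otimes> x) = c \<otimes> (x \<otimes> (x \<otimes> x))" using x c by simp
  then have "c = \<one>" using x c by (metis m_closed r_cancel_one')
  then show ?thesis using yc x by simp
qed

end

section \<open>Collapse of the sigma_i and of the zeta_j when commutators are central\<close>

context mixed_hom
begin

text \<open>For the zeta_j, the braid relations first identify all \<open>TSig i\<close>, so they
  have one common conjugation action. It sends zeta_(j+1) to zeta_j for every j, and it fixes zeta_1
  because \<open>TSig 2\<close> does, which exists for \<open>n \<ge> 3\<close>. Injectivity of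
  conjugation then identifies the zeta_j one after another.\<close>

lemma
  assumes central: "\<And>x y z. \<lbrakk>x \<in> carrier G; y \<in> carrier G; z \<in> carrier G\<rbrakk> \<Longrightarrow>
      (x \<otimes> y \<otimes> inv x \<otimes> inv y) \<otimes> z = z \<otimes> (x \<otimes> y \<otimes> inv x \<otimes> inv y)"
  shows img_Sig: "j \<in> {1..<k} \<Longrightarrow> img (Sig j) = img (Sig 1)"
    and img_Zeta: "n \<ge> 3 \<Longrightarrow> j \<in> {1..n} \<Longrightarrow> img (Zeta j) = img (Zeta 1)"
proof -
  show "img (Sig j) = img (Sig 1)" if "j \<in> {1..<k}"
    using that
  proof (induction j)
    case (Suc j)
    show ?case
    proof (cases "j = 0")
      case False
      have "(sw j @ sw (j + 1) @ sw j, sw (j + 1) @ sw j @ sw (j + 1)) \<in> total_rels g k n"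
        using Suc.prems False unfolding total_rels_def fibre_rels_def
        by (intro UnI1 surface_relsI) auto
      then have "word_eval G img (sw j @ sw (j + 1) @ sw j) =
          word_eval G img (sw (j + 1) @ sw j @ sw (j + 1))"
        using Suc.prems False by (intro respects) auto
      then have "img (Sig (j + 1)) = img (Sig j)"
        using Suc.prems False
        by - (rule braid_relation_class_2[OF central], auto simp: eval eval_letter)
      then show ?thesis using Suc False by simp
    qed simp
  qed simp
  have T: "img (TSig j) = img (TSig 1)" if "j \<in> {1..<n}" for j
    using that
  proof (induction j)
    case (Suc j)
    show ?case
    proof (cases "j = 0")
      case False
      have "(tsw j @ tsw (j + 1) @ tsw j, tsw (j + 1) @ tsw j @ tsw (j + 1)) \<in> total_rels g k n"
        using Suc.prems False unfolding total_rels_def base_rels_def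
        by (intro UnI1 UnI2 surface_relsI) auto
      then have "word_eval G img (tsw j @ tsw (j + 1) @ tsw j) =
          word_eval G img (tsw (j + 1) @ tsw j @ tsw (j + 1))"
        using Suc.prems False by (intro respects) auto
      then have "img (TSig (j + 1)) = img (TSig j)"
        using Suc.prems False
        by - (rule braid_relation_class_2[OF central], auto simp: eval eval_letter)
      then show ?thesis using Suc False by simp
    qed simp
  qed simp
  have cjT: "cj (TSig i) x = cj (TSig 1) x" if "i \<in> {1..<n}" for i x
    using T[OF that] by (simp add: cj_def)
  show "img (Zeta j) = img (Zeta 1)" if n: "n \<ge> 3" and "j \<in> {1..n}"
    using that(2)
  proof (induction j)
    case (Suc j)
    show ?case
    proof (cases "j = 0")
      case False
      then have "cj (TSig 1) (Zeta (Suc j)) = img (Zeta j)"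
        using Suc.prems cj_TSig(2)[of j] cjT[of j] by simp
      also have "\<dots> = img (Zeta 1)" using Suc False by simp
      also have "\<dots> = cj (TSig 1) (Zeta 1)"
        using n cj_TSig(4)[of 2 1] cjT[of 2] by simp
      finally show ?thesis
        using Suc.prems n by (simp add: cj_def)
    qed simp
  qed simp
qed

end

section \<open>Factorisation through the quotients\<close>

lemma pres_map_id_class:
  assumes "X \<subseteq> Y" "R \<subseteq> Q" "w \<in> words X"
  shows "pres_map Y Q (\<lambda>w. w) (pres_rel X R `` {w}) = pres_rel Y Q `` {w}"
proof (rule pres_map_hom(2)[OF HOL.refl _ _ _ assms(3)])
  have mono: "v \<in> words X \<Longrightarrow> v \<in> words Y" for v
    using assms(1) words_mono by blast
  show "v \<in> words X \<Longrightarrow> v \<in> words Y" for v by (rule mono)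
  show "x \<in> X \<Longrightarrow> ([(x, e), (x, \<not> e)], []) \<in> pres_rel Y Q" for x e
    using pres_rel.cancel[where u = "[]" and v = "[]" and x = x and X = Y] assms(1) by auto
  show "(r, s) \<in> R \<Longrightarrow> r \<in> words X \<Longrightarrow> s \<in> words X \<Longrightarrow> (r, s) \<in> pres_rel Y Q" for r s
    using pres_rel.rel[where u = "[]" and v = "[]" and r = r and s = s and X = Y] assms(2) mono by auto
qed

lemma fibre_braid_groupE:
  assumes "x \<in> carrier (fibre_braid_group g k n)"
  obtains w where "w \<in> words (fibre_gens g k n)"
    "x = pres_rel (fibre_gens g k n) (fibre_rels g k n) `` {w}"
  using assms by (auto simp: fibre_braid_group_def elim: presented_groupE)

lemma lc_restrict_class:
  assumes "w \<in> words (fibre_gens g k n)"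
  shows "lc_restrict i g k n (pres_rel (fibre_gens g k n) (fibre_rels g k n) `` {w}) =
    lc_proj (mixed_braid_group g k n) i
      (pres_rel (fibre_gens g k n \<union> base_gens g n) (total_rels g k n) `` {w})"
  unfolding lc_restrict_def fibre_incl_def
  by (subst pres_map_id_class[OF _ _ assms]) (auto simp: total_rels_def)

lemma lc_restrict_fibre_elem:
  "x \<in> fibre_gens g k n \<Longrightarrow>
    lc_restrict i g k n (fibre_elem g k n x) = lc_proj (mixed_braid_group g k n) i (mixed_elem g k n x)"
  by (simp add: fibre_elem_def mixed_elem_def lc_restrict_class)

lemma iota_fibre_elem:
  assumes "x \<in> fibre_gens 0 k n"
  shows "iota g k n (fibre_elem 0 k n x) = fibre_elem g k n x"
proof -
  have "fibre_rels 0 k n \<subseteq> fibre_rels g k n"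
    unfolding fibre_rels_def surface_rels_def Let_def by (intro Un_mono) auto
  moreover have "fibre_gens 0 k n \<subseteq> fibre_gens g k n" by (auto simp: fibre_gens_def)
  ultimately show ?thesis
    using assms by (simp add: iota_def fibre_elem_def pres_map_id_class)
qed

lemma mixed_hom_lc_proj:
  "mixed_hom (lc_quotient (mixed_braid_group g k n) i) g k n (lc_proj (mixed_braid_group g k n) i)"
  by (simp add: mixed_hom_def mixed_hom_axioms_def group.group_lc_quotient group.lc_proj_hom
      group_mixed_braid_group)

lemma one_lc_kernel: "\<one>\<^bsub>lc_kernel i g k n\<^esub> = \<one>\<^bsub>lc_quotient (mixed_braid_group g k n) i\<^esub>"
  by (simp add: lc_kernel_def Let_def)

lemma lc_restrict_fibre_elem_const:
  assumes i: "i \<in> {2, 3}"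
  shows "j \<in> {1..<k} \<Longrightarrow>
      lc_restrict i g k n (fibre_elem g k n (Sig j)) = lc_restrict i g k n (fibre_elem g k n (Sig 1))"
    and "n \<ge> 3 \<Longrightarrow> j \<in> {1..n} \<Longrightarrow>
      lc_restrict i g k n (fibre_elem g k n (Zeta j)) = lc_restrict i g k n (fibre_elem g k n (Zeta 1))"
proof -
  interpret Q: mixed_hom "lc_quotient (mixed_braid_group g k n) i" g k n
    "lc_proj (mixed_braid_group g k n) i"
    by (rule mixed_hom_lc_proj)
  note central = group.lc_quotient_commutators_central[OF group_mixed_braid_group i]
  show "lc_restrict i g k n (fibre_elem g k n (Sig j)) = lc_restrict i g k n (fibre_elem g k n (Sig 1))"
    if "j \<in> {1..<k}"
    using Q.img_Sig[OF central that] that by (simp add: lc_restrict_fibre_elem Q.img_def)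
  show "lc_restrict i g k n (fibre_elem g k n (Zeta j)) = lc_restrict i g k n (fibre_elem g k n (Zeta 1))"
    if "n \<ge> 3" "j \<in> {1..n}"
    using Q.img_Zeta[OF central that] that by (simp add: lc_restrict_fibre_elem Q.img_def)
qed

text \<open>The sequence $B_k(\widehat\Sigma_{g,n}) \to B_{k,n}(\widehat\Sigma_g) \to B_n(\widehat\Sigma_g)$ is split
  by the map preserving the names of generators, which carries $\Gamma_i$ into $\Gamma_i$.\<close>

lemma lc_restrict_surj:
  assumes n: "1 \<le> n"
  shows "lc_restrict i g k n ` carrier (fibre_braid_group g k n) = carrier (lc_kernel i g k n)"
proof (rule antisym)
  show "lc_restrict i g k n ` carrier (fibre_braid_group g k n) \<subseteq> carrier (lc_kernel i g k n)"
    by (auto intro: hom_in_carrier[OF lc_restrict_hom])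
next
  let ?M = "mixed_braid_group g k n" and ?B = "braid_group g n" and ?X = "fibre_gens g k n"
  let ?XY = "?X \<union> base_gens g n" and ?f = "filter (\<lambda>(x, e). x \<in> base_gens g n)"
  let ?cls = "\<lambda>w. pres_rel ?XY (total_rels g k n) `` {w}"
  interpret Q: mixed_hom "lc_quotient ?M i" g k n "lc_proj ?M i"
    by (rule mixed_hom_lc_proj)
  interpret forget: group_hom ?M ?B "forget g n"
    using group_mixed_braid_group group_braid_group forget_eval(1)
    by (simp add: group_hom_def group_hom_axioms_def)
  let ?s = "pres_map ?XY (total_rels g k n) (\<lambda>w. w)"
  have sub: "base_gens g n \<subseteq> ?XY" "base_rels g n \<subseteq> total_rels g k n"
    by (auto simp: total_rels_def)
  interpret s: group_hom ?B ?M ?s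
    using group_mixed_braid_group group_braid_group pres_map_id_hom[OF sub]
    by (simp add: group_hom_def group_hom_axioms_def braid_group_def mixed_braid_group_def)
  have ev: "lc_proj ?M i (?cls w) = word_eval (lc_quotient ?M i) Q.img w" if "w \<in> words ?XY" for w
    by (rule Q.hom_class[OF that])
  show "carrier (lc_kernel i g k n) \<subseteq> lc_restrict i g k n ` carrier (fibre_braid_group g k n)"
  proof
    fix C
    assume "C \<in> carrier (lc_kernel i g k n)"
    then obtain m where m: "m \<in> carrier ?M" "C = lc_proj ?M i m"
      "lc_map ?B i (forget g n) C = \<one>\<^bsub>lc_quotient ?B i\<^esub>"
      by (auto simp: lc_kernel_def Let_def kernel_def group.carrier_lc_quotient[OF group_mixed_braid_group])
    obtain w where w: "w \<in> words ?XY" "m = ?cls w"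
      using m(1) by (auto simp: mixed_braid_group_def elim: presented_groupE)
    have fw: "?f w \<in> words (base_gens g n)" by (auto simp: words_def)
    then have fw': "?f w \<in> words ?XY" using words_mono by blast
    \<comment> \<open>Lying in the kernel modulo Gamma_i means exactly this in the base
      group.\<close>
    have "forget g n m \<in> lower_central ?B i"
      using m forget.lc_map_proj[OF m(1)] group.lc_proj_eq_one_iff[OF group_braid_group] by simp
    then have "?s (forget g n m) \<in> lower_central ?M i"
      using s.lower_central_image by blast
    moreover have "?s (forget g n m) = ?cls (?f w)"
      unfolding w(2) forget_eval(2)[OF w(1)] by (rule pres_map_id_class[OF sub fw])
    moreover have "?cls (?f w) \<in> carrier ?M"
      using fw' by (simp add: mixed_braid_group_def presented_groupI)
    ultimately have "lc_proj ?M i (?cls (?f w)) = \<one>\<^bsub>lc_quotient ?M i\<^esub>"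
      using group.lc_proj_eq_one_iff[OF group_mixed_braid_group] by metis
    \<comment> \<open>The base part of \<open>w\<close> is thus trivial modulo Gamma_i, and the
      decomposition leaves a fibre word.\<close>
    then have "word_eval (lc_quotient ?M i) Q.img (?f w) = \<one>\<^bsub>lc_quotient ?M i\<^esub>"
      using ev[OF fw'] by simp
    then obtain y where y: "y \<in> Q.fibre_img" "word_eval (lc_quotient ?M i) Q.img w = y"
      using Q.fibre_base_decomposition[OF n w(1)] Q.subgroup_fibre_img
      by (auto simp: subgroup.mem_carrier)
    then obtain u where u: "u \<in> words ?X" "C = word_eval (lc_quotient ?M i) Q.img u"
      using ev[OF w(1)] m(2) w(2) by (auto simp: Q.fibre_img_def)
    then have "C = lc_restrict i g k n (pres_rel ?X (fibre_rels g k n) `` {u})"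
      using ev[OF Q.fibre_words[OF u(1)]] by (simp add: lc_restrict_class)
    then show "C \<in> lc_restrict i g k n ` carrier (fibre_braid_group g k n)"
      using u(1) by (auto simp: fibre_braid_group_def presented_groupI)
  qed
qed

text \<open>From left to right, the model is defined on the mixed group and its own Gamma_i is
  trivial. From right to left, \<open>lc_restrict\<close> is itself constant on the sigma_i and on
  the zeta_j, so the normal form applies to it.\<close>

lemma lc_restrict_eq_one_iff:
  assumes i: "i = 3 \<or> i = 2 \<and> g = 0" and kn: "k \<ge> 3" "n \<ge> 3"
    and x: "x \<in> carrier (fibre_braid_group g k n)"
  shows "lc_restrict i g k n x = \<one>\<^bsub>lc_kernel i g k n\<^esub> \<longleftrightarrow> heis_map g x = \<one>\<^bsub>heis_group g\<^esub>"
proof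
  let ?M = "mixed_braid_group g k n" and ?X = "fibre_gens g k n"
  let ?XY = "?X \<union> base_gens g n"
  interpret h: group_hom ?M "heis_group g" "heis_map g"
    using heis_map_mixed_hom group_mixed_braid_group by (simp add: group_hom_def group_hom_axioms_def)
  assume one: "lc_restrict i g k n x = \<one>\<^bsub>lc_kernel i g k n\<^esub>"
  obtain w where w: "w \<in> words ?X" "x = pres_rel ?X (fibre_rels g k n) `` {w}"
    using x by (rule fibre_braid_groupE)
  let ?m = "pres_rel ?XY (total_rels g k n) `` {w}"
  have w': "w \<in> words ?XY" using w(1) words_mono by blast
  have "?m \<in> carrier ?M" using w' by (simp add: mixed_braid_group_def presented_groupI)
  then have "?m \<in> lower_central ?M i"
    using one w by (simp add: lc_restrict_class one_lc_kernel
        group.lc_proj_eq_one_iff[OF group_mixed_braid_group])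
  then have "heis_map g ?m = \<one>\<^bsub>heis_group g\<^esub>"
    using h.lower_central_image lower_central_heis_trivial[OF i] by blast
  then show "heis_map g x = \<one>\<^bsub>heis_group g\<^esub>"
    by (simp add: w(2) heis_map_fibre_class[OF w(1)] heis_map_mixed_class[OF w'])
next
  let ?r = "lc_restrict i g k n"
  have i': "i \<in> {2, 3}" using i by auto
  define s z where "s = ?r (fibre_elem g k n (Sig 1))" and "z = ?r (fibre_elem g k n (Zeta 1))"
  have const: "\<And>j. j \<in> {1..<k} \<Longrightarrow> ?r (fibre_elem g k n (Sig j)) = s"
    "\<And>j. j \<in> {1..n} \<Longrightarrow> ?r (fibre_elem g k n (Zeta j)) = z"
    unfolding s_def z_def using lc_restrict_fibre_elem_const[OF i'] kn by blast+
  interpret heis_family "lc_kernel i g k n" s z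
    "\<lambda>j. ?r (fibre_elem g k n (GA j))" "\<lambda>j. ?r (fibre_elem g k n (GB j))" g
    using group.fibre_hom_heis_family[OF group_lc_kernel _ _ lc_restrict_hom const(1,2)] kn by auto
  assume "heis_map g x = \<one>\<^bsub>heis_group g\<^esub>"
  then show "?r x = \<one>\<^bsub>lc_kernel i g k n\<^esub>"
    using fibre_hom_eq_theta[OF group_lc_kernel lc_restrict_hom const(1,2) _ _ x] kn
    by (simp add: theta_central)
qed

lemma factors_through_surj:
  assumes "group A" "group H" "group G" and p: "p \<in> hom A H" and f: "f \<in> hom A G"
    and surj: "p ` carrier A = carrier H"
    and ker: "\<And>x. x \<in> carrier A \<Longrightarrow> p x = \<one>\<^bsub>H\<^esub> \<Longrightarrow> f x = \<one>\<^bsub>G\<^esub>"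
  shows "factors_through A H G f p"
proof -
  interpret p: group_hom A H p using assms by (simp add: group_hom_def group_hom_axioms_def)
  interpret f: group_hom A G f using assms by (simp add: group_hom_def group_hom_axioms_def)
  have eq: "f x = f y" if "x \<in> carrier A" "y \<in> carrier A" "p x = p y" for x y
  proof -
    have "f (x \<otimes>\<^bsub>A\<^esub> inv\<^bsub>A\<^esub> y) = \<one>\<^bsub>G\<^esub>" using that by (intro ker) simp_all
    then show ?thesis using that by (simp add: f.H.inv_solve_right')
  qed
  define h where "h c = f (inv_into (carrier A) p c)" for c
  have hp: "h (p x) = f x" if "x \<in> carrier A" for x
    unfolding h_def using that
    by (intro eq inv_into_into f_inv_into_f) auto
  have "h \<in> hom H G"
  proof (rule homI)
    fix c d
    assume "c \<in> carrier H" "d \<in> carrier H"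
    then obtain x y where xy: "x \<in> carrier A" "c = p x" "y \<in> carrier A" "d = p y"
      using surj by blast
    then show "h c \<in> carrier G" by (simp add: hp)
    have "h (c \<otimes>\<^bsub>H\<^esub> d) = h (p (x \<otimes>\<^bsub>A\<^esub> y))" using xy by simp
    also have "\<dots> = f (x \<otimes>\<^bsub>A\<^esub> y)" using xy by (intro hp) simp
    finally show "h (c \<otimes>\<^bsub>H\<^esub> d) = h c \<otimes>\<^bsub>G\<^esub> h d" using xy by (simp add: hp)
  qed
  then show ?thesis using hp unfolding factors_through_def by (intro bexI[of _ h]) auto
qed

text \<open>Taken with \<open>i = 3\<close> and with \<open>i = 2\<close>, \<open>g = 0\<close> it
  handles conditions (a) and (b). Constancy suffices because an element killed by
  \<open>lc_restrict\<close> has trivial exponents and is therefore killed by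
  \<open>f\<close>.\<close>

lemma factors_through_lc_restrict_iff:
  assumes i: "i = 3 \<or> i = 2 \<and> g = 0" and kn: "k \<ge> 3" "n \<ge> 3"
    and G: "group G" and f: "f \<in> hom (fibre_braid_group g k n) G"
  shows "factors_through (fibre_braid_group g k n) (lc_kernel i g k n) G f (lc_restrict i g k n) \<longleftrightarrow>
    (\<forall>j\<in>{1..<k}. f (fibre_elem g k n (Sig j)) = f (fibre_elem g k n (Sig 1))) \<and>
    (\<forall>j\<in>{1..n}. f (fibre_elem g k n (Zeta j)) = f (fibre_elem g k n (Zeta 1)))"
    (is "_ \<longleftrightarrow> ?S \<and> ?Z")
proof
  assume "factors_through (fibre_braid_group g k n) (lc_kernel i g k n) G f (lc_restrict i g k n)"
  then obtain h where h: "\<And>x. x \<in> carrier (fibre_braid_group g k n) \<Longrightarrow> f x = h (lc_restrict i g k n x)"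
    by (auto simp: factors_through_def)
  have "i \<in> {2, 3}" using i by auto
  note const = lc_restrict_fibre_elem_const[OF this]
  show "?S \<and> ?Z"
  proof (intro conjI ballI)
    show "f (fibre_elem g k n (Sig j)) = f (fibre_elem g k n (Sig 1))" if "j \<in> {1..<k}" for j
      using that h const(1)[OF that] by simp
    show "f (fibre_elem g k n (Zeta j)) = f (fibre_elem g k n (Zeta 1))" if "j \<in> {1..n}" for j
      using that h const(2)[OF kn(2) that] by simp
  qed
next
  assume SZ: "?S \<and> ?Z"
  define s z where "s = f (fibre_elem g k n (Sig 1))" and "z = f (fibre_elem g k n (Zeta 1))"
  have c: "\<And>j. j \<in> {1..<k} \<Longrightarrow> f (fibre_elem g k n (Sig j)) = s"
    "\<And>j. j \<in> {1..n} \<Longrightarrow> f (fibre_elem g k n (Zeta j)) = z"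
    unfolding s_def z_def using SZ by blast+
  interpret heis_family G s z "\<lambda>j. f (fibre_elem g k n (GA j))" "\<lambda>j. f (fibre_elem g k n (GB j))" g
    using group.fibre_hom_heis_family[OF G _ _ f c] kn by auto
  show "factors_through (fibre_braid_group g k n) (lc_kernel i g k n) G f (lc_restrict i g k n)"
  proof (rule factors_through_surj[OF group_fibre_braid_group group_lc_kernel G lc_restrict_hom f])
    show "lc_restrict i g k n ` carrier (fibre_braid_group g k n) = carrier (lc_kernel i g k n)"
      using kn by (intro lc_restrict_surj) simp
    show "f x = \<one>\<^bsub>G\<^esub>"
      if "x \<in> carrier (fibre_braid_group g k n)" "lc_restrict i g k n x = \<one>\<^bsub>lc_kernel i g k n\<^esub>" for x
      using fibre_hom_eq_theta[OF G f c _ _ that(1)] lc_restrict_eq_one_iff[OF i kn that(1)] that(2) kn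
      by (simp add: theta_central)
  qed
qed

text \<open>The exponents are functions on all naturals, so equality with the identity of the model
  also requires them to vanish outside 1..g.\<close>

lemma heis_map_support:
  assumes "x \<in> carrier (fibre_braid_group g k n)"
  shows "h_ta (heis_map g x) = (\<lambda>_. 0)" "h_tb (heis_map g x) = (\<lambda>_. 0)"
    and "j \<notin> {1..g} \<Longrightarrow> h_a (heis_map g x) j = 0" "j \<notin> {1..g} \<Longrightarrow> h_b (heis_map g x) j = 0"
proof -
  obtain w where w: "w \<in> words (fibre_gens g k n)"
    "x = pres_rel (fibre_gens g k n) (fibre_rels g k n) `` {w}"
    using assms by (rule fibre_braid_groupE)
  let ?e = "word_eval (heis_group g) heis_gen w"
  have "h_ta ?e = (\<lambda>_. 0) \<and> h_tb ?e = (\<lambda>_. 0) \<and> (\<forall>j. j \<notin> {1..g} \<longrightarrow> h_a ?e j = 0 \<and> h_b ?e j = 0)"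
    using w(1)
  proof (induction w)
    case (Cons p w)
    obtain y e where "p = (y, e)" by force
    then show ?case using Cons by (auto simp: fibre_gens_def unit_vec_def)
  qed simp
  then show "h_ta (heis_map g x) = (\<lambda>_. 0)" "h_tb (heis_map g x) = (\<lambda>_. 0)"
    "j \<notin> {1..g} \<Longrightarrow> h_a (heis_map g x) j = 0" "j \<notin> {1..g} \<Longrightarrow> h_b (heis_map g x) j = 0"
    using w by (simp_all add: heis_map_fibre_class)
qed

text \<open>The injectivity clause quantifies over every factor \<open>\<Phi>\<^sub>3\<close>. This
  agrees with speaking of the factor, since \<open>Phi\<close> is onto and determines it.\<close>

theorem corollary4p4:
  fixes k n g :: nat
    and G :: "('a, 'b) monoid_scheme"
    and \<Phi>\<^sub>G :: "braid_gen word set \<Rightarrow> 'a"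
  assumes "k \<ge> 3" and "n \<ge> 3" and "g \<ge> 1"
    and "group G"
    and "\<Phi>\<^sub>G \<in> hom (fibre_braid_group g k n) G"
  shows
    "(factors_through (fibre_braid_group g k n) (G_surface g k n) G \<Phi>\<^sub>G (Phi g k n)
        \<longleftrightarrow> factors_through (fibre_braid_group 0 k n) (G_disc k n) G
              (\<lambda>x. \<Phi>\<^sub>G (iota g k n x)) (p_disc k n))
     \<and> (factors_through (fibre_braid_group 0 k n) (G_disc k n) G
              (\<lambda>x. \<Phi>\<^sub>G (iota g k n x)) (p_disc k n)
        \<longleftrightarrow> (\<exists>\<sigma>\<in>carrier G. \<exists>\<zeta>\<in>carrier G.
              \<Phi>\<^sub>G ` S_gens g k n = {\<sigma>} \<and> \<Phi>\<^sub>G ` Z_gens g k n = {\<zeta>}))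
     \<and> (\<forall>\<Phi>\<^sub>2\<in>hom (G_disc k n) G.
          (\<forall>x\<in>carrier (fibre_braid_group 0 k n). \<Phi>\<^sub>2 (p_disc k n x) = \<Phi>\<^sub>G (iota g k n x)) \<longrightarrow>
          (\<exists>\<Phi>\<^sub>3\<in>hom (G_surface g k n) G.
             \<forall>x\<in>carrier (fibre_braid_group g k n). \<Phi>\<^sub>3 (Phi g k n x) = \<Phi>\<^sub>G x) \<and>
          (\<forall>\<Phi>\<^sub>3\<in>hom (G_surface g k n) G.
             (\<forall>x\<in>carrier (fibre_braid_group g k n). \<Phi>\<^sub>3 (Phi g k n x) = \<Phi>\<^sub>G x) \<longrightarrow>
             (inj_on \<Phi>\<^sub>3 (carrier (G_surface g k n)) \<longleftrightarrow> inj_on \<Phi>\<^sub>2 (carrier (G_disc k n)))))"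
proof -
  note kn = assms(1,2) and G = assms(4) and \<Phi> = assms(5)
  let ?F = "fibre_braid_group g k n" and ?D = "fibre_braid_group 0 k n"
  let ?\<iota> = "iota g k n" and ?e = "fibre_elem g k n" and ?d = "fibre_elem 0 k n"
  define s where "s = \<Phi>\<^sub>G (?e (Sig 1))"
  define z where "z = \<Phi>\<^sub>G (?e (Zeta 1))"
  \<comment> \<open>Condition (c) with its only possible witnesses, the values at index 1. All three
    conditions are compared with it.\<close>
  define const where "const \<longleftrightarrow> (\<forall>j\<in>{1..<k}. \<Phi>\<^sub>G (?e (Sig j)) = s) \<and> (\<forall>j\<in>{1..n}. \<Phi>\<^sub>G (?e (Zeta j)) = z)"
  have sz: "s \<in> carrier G" "z \<in> carrier G"
    using \<Phi> kn by (auto simp: s_def z_def intro!: hom_in_carrier[OF \<Phi>])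
  have \<iota>: "?\<iota> \<in> hom ?D ?F" by (rule iota_hom)
  have \<Phi>\<iota>: "(\<lambda>x. \<Phi>\<^sub>G (?\<iota> x)) \<in> hom ?D G"
    using hom_compose[OF \<iota> \<Phi>] by (simp add: o_def)
  have a: "factors_through ?F (G_surface g k n) G \<Phi>\<^sub>G (Phi g k n) \<longleftrightarrow> const"
    unfolding G_surface_def Phi_def const_def s_def z_def
    by (rule factors_through_lc_restrict_iff[OF _ kn G \<Phi>]) simp
  \<comment> \<open>The disc is the case of genus 0, and inclusion keeps the names of sigma_i and
    zeta_j, so the condition is literally the same.\<close>
  have b: "factors_through ?D (G_disc k n) G (\<lambda>x. \<Phi>\<^sub>G (?\<iota> x)) (p_disc k n) \<longleftrightarrow> const"
    unfolding G_disc_def p_disc_def const_def s_def z_def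
    using factors_through_lc_restrict_iff[OF _ kn G \<Phi>\<iota>, of 2] kn by (simp add: iota_fibre_elem)
  have c: "(\<exists>\<sigma>\<in>carrier G. \<exists>\<zeta>\<in>carrier G. \<Phi>\<^sub>G ` S_gens g k n = {\<sigma>} \<and> \<Phi>\<^sub>G ` Z_gens g k n = {\<zeta>}) \<longleftrightarrow> const"
  proof
    assume "\<exists>\<sigma>\<in>carrier G. \<exists>\<zeta>\<in>carrier G. \<Phi>\<^sub>G ` S_gens g k n = {\<sigma>} \<and> \<Phi>\<^sub>G ` Z_gens g k n = {\<zeta>}"
    then obtain \<sigma> \<zeta> where im: "\<Phi>\<^sub>G ` S_gens g k n = {\<sigma>}" "\<Phi>\<^sub>G ` Z_gens g k n = {\<zeta>}" by blast
    have "\<Phi>\<^sub>G (?e (Sig j)) = \<sigma>" if "j \<in> {1..<k}" for j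
      using im(1) that unfolding S_gens_def by blast
    moreover have "\<Phi>\<^sub>G (?e (Zeta j)) = \<zeta>" if "j \<in> {1..n}" for j
      using im(2) that unfolding Z_gens_def by blast
    ultimately show const using kn by (simp add: const_def s_def z_def)
  next
    assume const: const
    have "\<Phi>\<^sub>G ` S_gens g k n = (\<lambda>j. \<Phi>\<^sub>G (?e (Sig j))) ` {1..<k}"
      "\<Phi>\<^sub>G ` Z_gens g k n = (\<lambda>j. \<Phi>\<^sub>G (?e (Zeta j))) ` {1..n}"
      by (simp_all only: S_gens_def Z_gens_def Setcompr_eq_image image_image)
    moreover have "\<dots> = (\<lambda>j. z) ` {1..n}" "(\<lambda>j. \<Phi>\<^sub>G (?e (Sig j))) ` {1..<k} = (\<lambda>j. s) ` {1..<k}"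
      using const by (auto simp: const_def intro!: image_cong)
    ultimately have "\<Phi>\<^sub>G ` S_gens g k n = {s}" "\<Phi>\<^sub>G ` Z_gens g k n = {z}"
      using kn by (simp_all add: image_constant_conv)
    then show "\<exists>\<sigma>\<in>carrier G. \<exists>\<zeta>\<in>carrier G. \<Phi>\<^sub>G ` S_gens g k n = {\<sigma>} \<and> \<Phi>\<^sub>G ` Z_gens g k n = {\<zeta>}"
      using sz by blast
  qed
  have ex: "\<exists>\<Phi>\<^sub>3\<in>hom (G_surface g k n) G. \<forall>x\<in>carrier ?F. \<Phi>\<^sub>3 (Phi g k n x) = \<Phi>\<^sub>G x" if const
    using a that unfolding factors_through_def by metis
  have inj: "inj_on \<Phi>\<^sub>3 (carrier (G_surface g k n)) \<longleftrightarrow> inj_on \<Phi>\<^sub>2 (carrier (G_disc k n))"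
    if const: const and \<Phi>2: "\<Phi>\<^sub>2 \<in> hom (G_disc k n) G" "\<And>x. x \<in> carrier ?D \<Longrightarrow> \<Phi>\<^sub>2 (p_disc k n x) = \<Phi>\<^sub>G (?\<iota> x)"
      and \<Phi>3: "\<Phi>\<^sub>3 \<in> hom (G_surface g k n) G" "\<And>x. x \<in> carrier ?F \<Longrightarrow> \<Phi>\<^sub>3 (Phi g k n x) = \<Phi>\<^sub>G x"
    for \<Phi>\<^sub>2 \<Phi>\<^sub>3
  proof -
    have cS: "\<And>j. j \<in> {1..<k} \<Longrightarrow> \<Phi>\<^sub>G (?e (Sig j)) = s" and cZ: "\<And>j. j \<in> {1..n} \<Longrightarrow> \<Phi>\<^sub>G (?e (Zeta j)) = z"
      using const by (auto simp: const_def)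
    have n1: "1 \<le> n" using kn by simp
    interpret \<Phi>: group_hom ?F G \<Phi>\<^sub>G
      using \<Phi> G group_fibre_braid_group by (simp add: group_hom_def group_hom_axioms_def)
    interpret \<Phi>\<iota>: group_hom ?D G "\<lambda>x. \<Phi>\<^sub>G (?\<iota> x)"
      using \<Phi>\<iota> G group_fibre_braid_group by (simp add: group_hom_def group_hom_axioms_def)
    interpret h: group_hom ?F "heis_group g" "heis_map g"
      using heis_map_fibre_hom group_fibre_braid_group by (simp add: group_hom_def group_hom_axioms_def)
    interpret h0: group_hom ?D "heis_group 0" "heis_map 0"
      using heis_map_fibre_hom group_fibre_braid_group by (simp add: group_hom_def group_hom_axioms_def)
    interpret heis_family G s z "\<lambda>j. \<Phi>\<^sub>G (?e (GA j))" "\<lambda>j. \<Phi>\<^sub>G (?e (GB j))" g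
      by (rule \<Phi>.H.fibre_hom_heis_family[OF kn(1) n1 \<Phi> cS cZ])
    have \<Phi>_theta: "\<Phi>\<^sub>G x = theta (heis_map g x)" if "x \<in> carrier ?F" for x
      by (rule fibre_hom_eq_theta[OF G \<Phi> cS cZ kn(1) n1 that])
    \<comment> \<open>As \<open>Phi\<close> is onto, triviality of the kernel of
      \<open>\<Phi>\<^sub>3\<close> can be tested on fibre elements, where it concerns
      \<open>\<Phi>\<^sub>G\<close> and exponents only. The disc is treated alike below.\<close>
    have surf: "inj_on \<Phi>\<^sub>3 (carrier (G_surface g k n)) \<longleftrightarrow>
        (\<forall>x\<in>carrier ?F. \<Phi>\<^sub>G x = \<one>\<^bsub>G\<^esub> \<longrightarrow> heis_map g x = \<one>\<^bsub>heis_group g\<^esub>)"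
    proof -
      interpret \<Phi>3: group_hom "lc_kernel 3 g k n" G \<Phi>\<^sub>3
        using \<Phi>3(1) G group_lc_kernel by (simp add: group_hom_def group_hom_axioms_def G_surface_def)
      have "(\<forall>y\<in>lc_restrict 3 g k n ` carrier ?F. \<Phi>\<^sub>3 y = \<one>\<^bsub>G\<^esub> \<longrightarrow> y = \<one>\<^bsub>lc_kernel 3 g k n\<^esub>) \<longleftrightarrow>
          (\<forall>x\<in>carrier ?F. \<Phi>\<^sub>3 (lc_restrict 3 g k n x) = \<one>\<^bsub>G\<^esub> \<longrightarrow> lc_restrict 3 g k n x = \<one>\<^bsub>lc_kernel 3 g k n\<^esub>)"
        by blast
      also have "\<dots> \<longleftrightarrow> (\<forall>x\<in>carrier ?F. \<Phi>\<^sub>G x = \<one>\<^bsub>G\<^esub> \<longrightarrow> heis_map g x = \<one>\<^bsub>heis_group g\<^esub>)"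
        using lc_restrict_eq_one_iff[of 3 g, OF _ kn]
        by (intro ball_cong HOL.refl) (simp add: \<Phi>3(2)[unfolded Phi_def])
      finally show ?thesis
        unfolding G_surface_def \<Phi>3.inj_on_one_iff unfolding lc_restrict_surj[OF n1] Ball_def .
    qed
    have disc: "inj_on \<Phi>\<^sub>2 (carrier (G_disc k n)) \<longleftrightarrow>
        (\<forall>x\<in>carrier ?D. \<Phi>\<^sub>G (?\<iota> x) = \<one>\<^bsub>G\<^esub> \<longrightarrow> heis_map 0 x = \<one>\<^bsub>heis_group 0\<^esub>)"
    proof -
      interpret \<Phi>2: group_hom "lc_kernel 2 0 k n" G \<Phi>\<^sub>2
        using \<Phi>2(1) G group_lc_kernel by (simp add: group_hom_def group_hom_axioms_def G_disc_def)
      have "(\<forall>y\<in>lc_restrict 2 0 k n ` carrier ?D. \<Phi>\<^sub>2 y = \<one>\<^bsub>G\<^esub> \<longrightarrow> y = \<one>\<^bsub>lc_kernel 2 0 k n\<^esub>) \<longleftrightarrow>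
          (\<forall>x\<in>carrier ?D. \<Phi>\<^sub>2 (lc_restrict 2 0 k n x) = \<one>\<^bsub>G\<^esub> \<longrightarrow> lc_restrict 2 0 k n x = \<one>\<^bsub>lc_kernel 2 0 k n\<^esub>)"
        by blast
      also have "\<dots> \<longleftrightarrow> (\<forall>x\<in>carrier ?D. \<Phi>\<^sub>G (?\<iota> x) = \<one>\<^bsub>G\<^esub> \<longrightarrow> heis_map 0 x = \<one>\<^bsub>heis_group 0\<^esub>)"
        using lc_restrict_eq_one_iff[of 2 0, OF _ kn]
        by (intro ball_cong HOL.refl) (simp add: \<Phi>2(2)[unfolded p_disc_def])
      finally show ?thesis
        unfolding G_disc_def \<Phi>2.inj_on_one_iff unfolding lc_restrict_surj[OF n1] Ball_def .
    qed
    show ?thesis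
      unfolding surf disc
    proof safe
      fix x
      assume L: "\<forall>x\<in>carrier ?F. \<Phi>\<^sub>G x = \<one>\<^bsub>G\<^esub> \<longrightarrow> heis_map g x = \<one>\<^bsub>heis_group g\<^esub>"
        and x: "x \<in> carrier ?D" and one: "\<Phi>\<^sub>G (?\<iota> x) = \<one>\<^bsub>G\<^esub>"
      have \<iota>x: "?\<iota> x \<in> carrier ?F" using \<iota> x by (rule hom_in_carrier)
      \<comment> \<open>The exponents of \<open>x\<close> in genus 0 and those of its image in genus
        g are compared by using the genus g model as target of a homomorphism from the disc
        group.\<close>
      let ?h = "\<lambda>x. heis_map g (?\<iota> x)" and ?y = "heis_map 0 x"
      have hom: "?h \<in> hom ?D (heis_group g)"
        using hom_compose[OF \<iota> heis_map_fibre_hom] by (simp add: o_def)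
      define S Z where SZ: "S = heis_gen (Sig 1)" "Z = heis_gen (Zeta 1)"
      have hS: "\<And>j. j \<in> {1..<k} \<Longrightarrow> ?h (?d (Sig j)) = S"
        and hZ: "\<And>j. j \<in> {1..n} \<Longrightarrow> ?h (?d (Zeta j)) = Z"
        by (simp_all add: iota_fibre_elem heis_map_fibre_elem SZ)
      interpret H: heis_family "heis_group g" S Z
        "\<lambda>j. ?h (?d (GA j))" "\<lambda>j. ?h (?d (GB j))" 0
        by (rule h.H.fibre_hom_heis_family[OF kn(1) n1 hom hS hZ])
      have "?h x = H.theta ?y"
        by (rule fibre_hom_eq_theta[OF group_heis hom hS hZ kn(1) n1 x])
      also have "\<dots> = Heis (h_s ?y) (h_z ?y) (\<lambda>_. 0) (\<lambda>_. 0) (\<lambda>_. 0) (\<lambda>_. 0)"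
        by (simp add: H.theta_def) (simp add: SZ heis_pow_s heis_pow_z)
      finally have "h_s ?y = 0" "h_z ?y = 0" using L one \<iota>x by auto
      moreover have "h_a ?y = (\<lambda>_. 0)" "h_b ?y = (\<lambda>_. 0)"
        using heis_map_support(3,4)[OF x] by auto
      ultimately show "heis_map 0 x = \<one>\<^bsub>heis_group 0\<^esub>"
        using heis_map_support(1,2)[OF x] by (simp add: heis.expand)
    next
      fix x
      assume R: "\<forall>x\<in>carrier ?D. \<Phi>\<^sub>G (?\<iota> x) = \<one>\<^bsub>G\<^esub> \<longrightarrow> heis_map 0 x = \<one>\<^bsub>heis_group 0\<^esub>"
        and x: "x \<in> carrier ?F" and one: "\<Phi>\<^sub>G x = \<one>\<^bsub>G\<^esub>"
      let ?y = "heis_map g x"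
      \<comment> \<open>Injectivity over the disc, tested on sigma^p zeta^q, says that
        \<open>s\<close> and \<open>z\<close> satisfy no relation of this form.\<close>
      have pq: "p = 0 \<and> q = 0" if "s [^]\<^bsub>G\<^esub> (p :: int) \<otimes>\<^bsub>G\<^esub> z [^]\<^bsub>G\<^esub> (q :: int) = \<one>\<^bsub>G\<^esub>" for p q
      proof -
        define u where "u = ?d (Sig 1) [^]\<^bsub>?D\<^esub> p \<otimes>\<^bsub>?D\<^esub> ?d (Zeta 1) [^]\<^bsub>?D\<^esub> q"
        have e0: "?d (Sig 1) \<in> carrier ?D" "?d (Zeta 1) \<in> carrier ?D" using kn by auto
        have u: "u \<in> carrier ?D" unfolding u_def using e0 by simp
        have "\<Phi>\<^sub>G (?\<iota> u) = s [^]\<^bsub>G\<^esub> p \<otimes>\<^bsub>G\<^esub> z [^]\<^bsub>G\<^esub> q"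
          unfolding u_def using e0 kn \<Phi>\<iota>.hom_int_pow
          by (simp add: iota_fibre_elem s_def z_def)
        then have "heis_map 0 u = \<one>\<^bsub>heis_group 0\<^esub>" using R u that by simp
        moreover have "heis_map 0 u = Heis p q (\<lambda>_. 0) (\<lambda>_. 0) (\<lambda>_. 0) (\<lambda>_. 0)"
          unfolding u_def using e0 kn h0.hom_int_pow
          by (simp add: heis_map_fibre_elem heis_pow_s heis_pow_z del: mult_heis)
            (simp add: pairing_def)
        ultimately show ?thesis by simp
      qed
      text \<open>The commutator of \<open>x\<close> with $b_j$ or $a_j$ is a power of $\sigma$ recording the
        exponent of $a_j$ or $b_j$ in \<open>x\<close>, and \<open>\<Phi>\<^sub>G\<close> kills it along with \<open>x\<close>.\<close>
      have comm: "theta (?y \<otimes>\<^bsub>heis_group g\<^esub> Y \<otimes>\<^bsub>heis_group g\<^esub> inv\<^bsub>heis_group g\<^esub> ?y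
          \<otimes>\<^bsub>heis_group g\<^esub> inv\<^bsub>heis_group g\<^esub> Y) = \<one>\<^bsub>G\<^esub>"
        if "v \<in> carrier ?F" "Y = heis_map g v" for v Y
      proof -
        have "\<Phi>\<^sub>G (x \<otimes>\<^bsub>?F\<^esub> v \<otimes>\<^bsub>?F\<^esub> inv\<^bsub>?F\<^esub> x \<otimes>\<^bsub>?F\<^esub> inv\<^bsub>?F\<^esub> v) = \<one>\<^bsub>G\<^esub>"
          using x that one by simp
        then show ?thesis
          using x that \<Phi>_theta[of "x \<otimes>\<^bsub>?F\<^esub> v \<otimes>\<^bsub>?F\<^esub> inv\<^bsub>?F\<^esub> x \<otimes>\<^bsub>?F\<^esub> inv\<^bsub>?F\<^esub> v"]
          by (simp del: mult_heis inv_heis)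
      qed
      have ab: "h_a ?y j = 0 \<and> h_b ?y j = 0" for j
      proof (cases "j \<in> {1..g}")
        case True
        have B: "?e (GB j) \<in> carrier ?F" "heis_gen (GB j) = heis_map g (?e (GB j))"
          and A: "?e (GA j) \<in> carrier ?F" "heis_gen (GA j) = heis_map g (?e (GA j))"
          using True by (simp_all add: heis_map_fibre_elem)
        \<comment> \<open>The coefficient 2 comes from [a_j,b_j] = sigma^2 and is harmless, since
          \<open>pq\<close> yields vanishing of an integer exponent. The trivial power of
          \<open>z\<close> brings the equation into the form of \<open>pq\<close>.\<close>
        have "s [^]\<^bsub>G\<^esub> (2 * h_a ?y j) \<otimes>\<^bsub>G\<^esub> z [^]\<^bsub>G\<^esub> (0 :: int) = \<one>\<^bsub>G\<^esub>"
          using comm[OF B] True heis_map_support(1,2)[OF x] by (simp add: theta_central)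
        moreover have "s [^]\<^bsub>G\<^esub> (- 2 * h_b ?y j) \<otimes>\<^bsub>G\<^esub> z [^]\<^bsub>G\<^esub> (0 :: int) = \<one>\<^bsub>G\<^esub>"
          using comm[OF A] True heis_map_support(1,2)[OF x] by (simp add: theta_central)
        ultimately show ?thesis using pq by fastforce
      qed (use heis_map_support(3,4)[OF x] in simp)
      then have y: "?y = Heis (h_s ?y) (h_z ?y) (\<lambda>_. 0) (\<lambda>_. 0) (\<lambda>_. 0) (\<lambda>_. 0)"
        using heis_map_support(1,2)[OF x] by (intro heis.expand) (auto intro!: ext)
      have "s [^]\<^bsub>G\<^esub> h_s ?y \<otimes>\<^bsub>G\<^esub> z [^]\<^bsub>G\<^esub> h_z ?y = \<one>\<^bsub>G\<^esub>"
        using \<Phi>_theta[OF x] one theta_central y by metis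
      then show "heis_map g x = \<one>\<^bsub>heis_group g\<^esub>"
        using pq y by (metis one_heis)
    qed
  qed
  \<comment> \<open>A given \<open>\<Phi>\<^sub>2\<close> as in (ii) witnesses condition
    (b).\<close>
  have const_if: const
    if "\<Phi>\<^sub>2 \<in> hom (G_disc k n) G" "\<And>x. x \<in> carrier ?D \<Longrightarrow> \<Phi>\<^sub>2 (p_disc k n x) = \<Phi>\<^sub>G (?\<iota> x)" for \<Phi>\<^sub>2
    using b that unfolding factors_through_def by metis
  show ?thesis
    unfolding a b c using const_if ex inj by blast
qed

end
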